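(* Let $N\ge 2$ be an integer and equip $SU(N)$ with the Zeitlin metric. The Ricci tensor $\mathrm{Ric}$ is block diagonal with respect to the decomposition $\mathfrak{su}(N)=V_1\oplus\cdots\oplus V_{N-1}$ and acts as a scalar multiple of the metric on each $V_\ell$: for all $1\le \ell,\ell'\le N-1$, all $u\in V_\ell$ and all $v\in V_{\ell'}$, $$\mathrm{Ric}(u,v)=r_\ell(N)\,\langle u,v\rangle .$$ Furthermore $r_\ell(N)=r_\ell(N)^+-r_\ell(N)^-$, where $r_\ell(N)^{+}$ and $r_\ell(N)^-$ are both nonnegative and given explicitly by $$r_\ell(N)^+=\frac{N}{\hbar_N^2}\sum_{\substack{k,k'=1\\ k+k'+\ell\ \mathrm{odd}}}^{N-1}\frac{\lambda_\ell}{\lambda_k\lambda_{k'}}(2k+1)(2k'+1)\left\{\begin{matrix}\ell&k&k'\\ \frac{N-1}{2}&\frac{N-1}{2}&\frac{N-1}{2}\end{matrix}\right\}^2,$$ $$r_\ell(N)^-=\frac{N}{\hbar_N^2}\sum_{\substack{k,k'=1\\ k+k'+\ell\ \mathrm{odd}}}^{N-1}\frac{(\lambda_k-\lambda_{k'})^2}{\lambda_k\lambda_{k'}\lambda_\ell}(2k+1)(2k'+1)\left\{\begin{matrix}\ell&k&k'\\ \frac{N-1}{2}&\frac{N-1}{2}&\frac{N-1}{2}\end{matrix}\right\}^2,$$ with $\lambda_i=i(i+1)$ and $\hbar_N=2/\sqrt{N^2-1}$.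
   Context: Let $\hbar_N=2/\sqrt{N^2-1}$. Let $S_1,S_2,S_3\in\mathfrak{su}(N)$ be the skew-Hermitian generators of the $N$-dimensional irreducible representation of $\mathfrak{so}(3)$, so $[S_1,S_2]=S_3$ and cyclically. Let $\mathcal{C}_i:\mathfrak{su}(N)\to\mathfrak{su}(N)$, $\mathcal{C}_i(u)=[S_i,u]$. The quantized Laplacian is $\Delta_N=\sum_{i=1}^3\mathcal{C}_i^2$. For $1\le\ell\le N-1$, $V_\ell\subset\mathfrak{su}(N)$ is the eigenspace of $\Delta_N$ with eigenvalue $-\ell(\ell+1)$; it is an irreducible $\mathfrak{so}(3)$-module of real dimension $2\ell+1$, and $\mathfrak{su}(N)=V_1\oplus\cdots\oplus V_{N-1}$. The Zeitlin metric is the right-invariant Riemannian metric on $SU(N)$ given on the Lie algebra by $\langle u,v\rangle=\frac1N\mathrm{Tr}(u^\dagger(-\Delta_N)v)$, where the Lie algebra $\mathfrak{su}(N)$ carries the scaled bracket $\frac1{\hbar_N}[\cdot,\cdot]$ ($[\cdot,\cdot]$ the matrix commutator), with $\mathrm{ad}_uv=-\frac{1}{\hbar_N}[u,v]$. (Equivalently, $u\in\mathfrak{su}(N)$ is identified with the tangent vector at the identity whose matrix is $u/\hbar_N$, and the metric is right-invariant with value $\langle u,v\rangle$ on the tangent vectors corresponding to $u,v$.) $\mathrm{Ric}(u,v)$ is the Ricci tensor (as a symmetric bilinear form) of this metric at the identity, evaluated on the tangent vectors corresponding to $u,v$. Concretely, sectional curvature is $$K(u,v)=\frac{\frac14\|\mathrm{ad}^\star_uv+\mathrm{ad}^\star_vu+\mathrm{ad}_uv\|^2-\langle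 \mathrm{ad}^\star_uv+\mathrm{ad}_uv,\mathrm{ad}_uv\rangle-\langle\mathrm{ad}^\star_uu,\mathrm{ad}^\star_vv\rangle}{\|u\|^2\|v\|^2-\langle u,v\rangle^2},$$ where $\langle\mathrm{ad}^\star_uv,w\rangle=\langle v,\mathrm{ad}_uw\rangle$. $\{:::\}$ with two rows of three entries denotes the Wigner $6j$ symbol, which is $0$ if its triangle conditions fail. *)

theory Defs
  imports "HOL-Analysis.Analysis"
begin

section \<open>The Lie algebra su(N) and the quantized Laplacian\<close>

text \<open>Matrices of size \<open>N = CARD('n)\<close> have type \<open>complex^'n^'n\<close>, regarded as a real vector space.\<close>

definition conj_transpose :: "complex^'n^'n \<Rightarrow> complex^'n^'n"
  where "conj_transpose A = (\<chi> i j. cnj (A $ j $ i))"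

definition su :: "(complex^'n^'n) set"
  where "su = {A. conj_transpose A = - A \<and> trace A = 0}"

definition commutator :: "complex^'n^'n \<Rightarrow> complex^'n^'n \<Rightarrow> complex^'n^'n"
  where "commutator A B = A ** B - B ** A"

text \<open>
  The three generators are indexed by the type \<open>3\<close>, whose elements are 1, 2 and 3 (with 3 = 0).
  Irreducibility refers to complex subspaces of \<open>complex^'n\<close>.
\<close>

definition so3_irrep :: "(3 \<Rightarrow> complex^'n^'n) \<Rightarrow> bool"
  where "so3_irrep S \<longleftrightarrow>
    (\<forall>i. S i \<in> su) \<and>
    commutator (S 1) (S 2) = S 3 \<and>
    commutator (S 2) (S 3) = S 1 \<and>
    commutator (S 3) (S 1) = S 2 \<and>
    (\<forall>W. vec.subspace W \<and> (\<forall>i. \<forall>w\<in>W. S i *v w \<in> W) \<longrightarrow> W = {0} \<or> W = UNIV)"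

definition laplacian :: "(3 \<Rightarrow> complex^'n^'n) \<Rightarrow> complex^'n^'n \<Rightarrow> complex^'n^'n"
  where "laplacian S u = (\<Sum>i\<in>UNIV. commutator (S i) (commutator (S i) u))"

definition eigval :: "nat \<Rightarrow> real"
  where "eigval l = real l * (real l + 1)"

definition V_space :: "(3 \<Rightarrow> complex^'n^'n) \<Rightarrow> nat \<Rightarrow> (complex^'n^'n) set"
  where "V_space S l = {u \<in> su. laplacian S u = - eigval l *\<^sub>R u}"


section \<open>The Zeitlin metric and its Ricci tensor\<close>

definition hbar :: "nat \<Rightarrow> real"
  where "hbar N = 2 / sqrt ((real N)\<^sup>2 - 1)"

text \<open>For \<open>u\<close> and \<open>v\<close> in \<open>su\<close> the trace below is real, so taking its real part loses nothing.\<close>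

definition zeitlin_metric :: "(3 \<Rightarrow> complex^'n^'n) \<Rightarrow> complex^'n^'n \<Rightarrow> complex^'n^'n \<Rightarrow> real"
  where "zeitlin_metric S u v = Re (trace (conj_transpose u ** (- laplacian S v))) / real CARD('n)"

text \<open>
  Let \<open>X\<^sub>u\<close> be the right-invariant vector field on SU(N) whose value at the identity is the matrix
  \<open>u / hbar N\<close>. The bracket of right-invariant vector fields is minus the right-invariant field of the matrix
  commutator, so \<open>[X\<^sub>u, X\<^sub>v] = X\<^sub>w\<close> with \<open>w = ad u v\<close> as follows.
\<close>

definition ad :: "complex^'n^'n \<Rightarrow> complex^'n^'n \<Rightarrow> complex^'n^'n"
  where "ad u v = - (1 / hbar CARD('n)) *\<^sub>R commutator u v"

definition ad_star :: "(3 \<Rightarrow> complex^'n^'n) \<Rightarrow> complex^'n^'n \<Rightarrow> complex^'n^'n \<Rightarrow> complex^'n^'n"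
  where "ad_star S u v = (THE x. x \<in> su \<and> (\<forall>w\<in>su. zeitlin_metric S x w = zeitlin_metric S v (ad u w)))"

text \<open>
  The Levi-Civita connection on right-invariant fields. Since the metric is constant on them,
  Koszul's formula for \<open>nabla u v\<close> reads
  \<open>2 \<langle>nabla u v, w\<rangle> = \<langle>ad u v, w\<rangle> - \<langle>v, ad u w\<rangle> - \<langle>u, ad v w\<rangle>\<close>.
\<close>

definition nabla :: "(3 \<Rightarrow> complex^'n^'n) \<Rightarrow> complex^'n^'n \<Rightarrow> complex^'n^'n \<Rightarrow> complex^'n^'n"
  where "nabla S u v = (1/2) *\<^sub>R (ad u v - ad_star S u v - ad_star S v u)"

text \<open>
  With this sign, \<open>\<langle>riemann S u v v, u\<rangle>\<close> is the numerator of the sectional curvature: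
  it equals \<open>1/4 \<parallel>ad\<^sup>\<star>\<^sub>u v + ad\<^sup>\<star>\<^sub>v u + ad\<^sub>u v\<parallel>\<^sup>2 - \<langle>ad\<^sup>\<star>\<^sub>u v + ad\<^sub>u v, ad\<^sub>u v\<rangle> - \<langle>ad\<^sup>\<star>\<^sub>u u, ad\<^sup>\<star>\<^sub>v v\<rangle>\<close>.
\<close>

definition riemann ::
  "(3 \<Rightarrow> complex^'n^'n) \<Rightarrow> complex^'n^'n \<Rightarrow> complex^'n^'n \<Rightarrow> complex^'n^'n \<Rightarrow> complex^'n^'n"
  where "riemann S u v w =
    nabla S u (nabla S v w) - nabla S v (nabla S u w) - nabla S (ad u v) w"

text \<open>
  The trace of a linear endomorphism \<open>T\<close> of a finite-dimensional real subspace \<open>E\<close>;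
  it does not depend on the chosen basis.
\<close>

definition trace_on :: "'a::real_vector set \<Rightarrow> ('a \<Rightarrow> 'a) \<Rightarrow> real"
  where "trace_on E T =
    (let B = (SOME B. independent B \<and> span B = E) in \<Sum>b\<in>B. representation B (T b) b)"

definition Ric :: "(3 \<Rightarrow> complex^'n^'n) \<Rightarrow> complex^'n^'n \<Rightarrow> complex^'n^'n \<Rightarrow> real"
  where "Ric S u v = trace_on su (\<lambda>w. riemann S w u v)"


section \<open>Wigner symbols\<close>

text \<open>
  All arguments are twice the usual half-integer ones: \<open>J\<close> stands for the spin \<open>J/2\<close> and \<open>M\<close>
  for the magnetic number \<open>M/2\<close>. So \<open>wigner6j (2*a) (2*b) (2*c) (2*d) (2*e) (2*f)\<close> is
  the symbol with upper row \<open>a b c\<close> and lower row \<open>d e f\<close>.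
\<close>

definition triad :: "nat \<Rightarrow> nat \<Rightarrow> nat \<Rightarrow> bool"
  where "triad J1 J2 J3 \<longleftrightarrow>
    even (J1 + J2 + J3) \<and> J1 \<le> J2 + J3 \<and> J2 \<le> J1 + J3 \<and> J3 \<le> J1 + J2"

definition magnetic :: "nat \<Rightarrow> int \<Rightarrow> bool"
  where "magnetic J M \<longleftrightarrow> \<bar>M\<bar> \<le> int J \<and> even (int J - M)"

text \<open>\<open>hfact (2*n)\<close> is the factorial of \<open>n\<close>; it is only used at nonnegative even arguments.\<close>

definition hfact :: "int \<Rightarrow> real"
  where "hfact n = fact (nat (n div 2))"

definition wigner3j :: "nat \<Rightarrow> nat \<Rightarrow> nat \<Rightarrow> int \<Rightarrow> int \<Rightarrow> int \<Rightarrow> real"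
  where "wigner3j J1 J2 J3 M1 M2 M3 =
    (if triad J1 J2 J3 \<and> magnetic J1 M1 \<and> magnetic J2 M2 \<and> magnetic J3 M3 \<and> M1 + M2 + M3 = 0
     then
       let j1 = int J1; j2 = int J2; j3 = int J3 in
       (if even ((j1 - j2 - M3) div 2) then 1 else -1) *
       sqrt (hfact (j1 + j2 - j3) * hfact (j1 - j2 + j3) * hfact (- j1 + j2 + j3)
             / hfact (j1 + j2 + j3 + 2)) *
       sqrt (hfact (j1 + M1) * hfact (j1 - M1) * hfact (j2 + M2) * hfact (j2 - M2)
             * hfact (j3 + M3) * hfact (j3 - M3)) *
       (\<Sum>s | 0 \<le> s \<and> 2 * s \<le> j1 + j2 - j3 \<and> 2 * s \<le> j1 - M1 \<and> 2 * s \<le> j2 + M2 \<and>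
              0 \<le> j3 - j2 + M1 + 2 * s \<and> 0 \<le> j3 - j1 - M2 + 2 * s.
          (if even s then 1 else -1) /
          (hfact (2 * s) * hfact (j1 + j2 - j3 - 2 * s) * hfact (j1 - M1 - 2 * s)
           * hfact (j2 + M2 - 2 * s) * hfact (j3 - j2 + M1 + 2 * s) * hfact (j3 - j1 - M2 + 2 * s)))
     else 0)"

text \<open>
  The 6j symbol as the contraction of four 3j symbols over all magnetic numbers. Indices of the
  wrong parity contribute 0, and so does the whole sum if one of the four triads
  \<open>(a, b, c)\<close>, \<open>(a, e, f)\<close>, \<open>(d, b, f)\<close>, \<open>(d, e, c)\<close> is not admissible.
\<close>

definition wigner6j :: "nat \<Rightarrow> nat \<Rightarrow> nat \<Rightarrow> nat \<Rightarrow> nat \<Rightarrow> nat \<Rightarrow> real"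
  where "wigner6j a b c d e f =
    (\<Sum>\<alpha>\<in>{- int a..int a}. \<Sum>\<beta>\<in>{- int b..int b}. \<Sum>\<gamma>\<in>{- int c..int c}.
     \<Sum>\<delta>\<in>{- int d..int d}. \<Sum>\<epsilon>\<in>{- int e..int e}. \<Sum>\<zeta>\<in>{- int f..int f}.
       (if even ((int d + \<delta> + int e + \<epsilon> + int f + \<zeta>) div 2) then 1 else -1) *
       wigner3j a b c \<alpha> \<beta> \<gamma> * wigner3j a e f \<alpha> \<epsilon> (- \<zeta>) *
       wigner3j d b f (- \<delta>) \<beta> \<zeta> * wigner3j d e c \<delta> (- \<epsilon>) \<gamma>)"


section \<open>The two parts of the Ricci eigenvalue\<close>

definition odd_pairs :: "nat \<Rightarrow> nat \<Rightarrow> (nat \<times> nat) set"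
  where "odd_pairs N l = {(k, k'). k \<in> {1..N-1} \<and> k' \<in> {1..N-1} \<and> odd (k + k' + l)}"

definition r_plus :: "nat \<Rightarrow> nat \<Rightarrow> real"
  where "r_plus N l = real N / (hbar N)\<^sup>2 *
    (\<Sum>(k, k')\<in>odd_pairs N l.
       eigval l / (eigval k * eigval k') * (2 * real k + 1) * (2 * real k' + 1) *
       (wigner6j (2*l) (2*k) (2*k') (N-1) (N-1) (N-1))\<^sup>2)"

definition r_minus :: "nat \<Rightarrow> nat \<Rightarrow> real"
  where "r_minus N l = real N / (hbar N)\<^sup>2 *
    (\<Sum>(k, k')\<in>odd_pairs N l.
       (eigval k - eigval k')\<^sup>2 / (eigval k * eigval k' * eigval l) *
       (2 * real k + 1) * (2 * real k' + 1) *
       (wigner6j (2*l) (2*k) (2*k') (N-1) (N-1) (N-1))\<^sup>2)"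

end

theory Submission
  imports Defs
begin

text \<open>
  Let \<open>A\<close> be minus the quantized Laplacian, and choose a basis \<open>\<tau> i\<close> of the complexification sl(N) of su(N),
  orthonormal for the trace form, with \<open>A (\<tau> i) = lam i \<cdot> \<tau> i\<close>. Koszul's formula builds the connection out of
  commutators, \<open>A\<close> and the inverse of \<open>A\<close>, so the trace defining the Ricci tensor is a double sum over the
  matrix entries \<open>D u i j\<close> of the commutator with \<open>u\<close>. These entries are skew-Hermitian, and after
  symmetrising in \<open>i\<close> and \<open>j\<close> the sum becomes, for \<open>A u = a u\<close> and \<open>A v = b v\<close>,
  \<open>Ric u v = 1/(4 h\<^sup>2) \<Sum> i j. (a b - (lam i - lam j)\<^sup>2) / (lam i \<cdot> lam j) \<cdot> Re (D u i j \<cdot> cnj (D v i j))\<close>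
  with \<open>h = hbar N\<close>, which is lemma \<open>Ric_structure_constants\<close>. The numerator already shows the positive and the negative part of
  the theorem.

  The basis is made of the spherical tensors \<open>T l \<alpha>\<close>: matrices whose entries in a weight basis are
  3j symbols \<open>(l s s)\<close> with \<open>s = (N - 1)/2\<close>. The ladder relations of the 3j symbol say that \<open>T l 0, ..., T l (2l)\<close>
  transform like the weight vectors of spin \<open>l\<close>, so they are eigenvectors of \<open>A\<close> with eigenvalue \<open>l (l + 1)\<close>.
  The trace of a product of three of them is an so(3)-invariant of three spins; such invariants form a line
  spanned by the 3j symbol (lemma \<open>invariant3_unique\<close>), and the factor is, by the very definition of the 6j symbol as a
  contraction of four 3j symbols, a multiple of \<open>{l k k'; s s s}\<close> (lemma \<open>triple_trace_eq\<close>). Reversing the order of the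
  factors multiplies the trace by the sign of \<open>l + k + k'\<close>, so a commutator doubles it when
  \<open>l + k + k'\<close> is odd and kills it otherwise.

  Hence \<open>D u i j\<close> on a pair of blocks \<open>k, k'\<close> is a 3j symbol contracted with the coordinates of \<open>u\<close>, times one
  6j symbol. The orthogonality relation of the 3j symbols evaluates the sum over the magnetic numbers of
  both blocks (lemma \<open>block_sum\<close>): the result is the trace form of \<open>u\<close> and \<open>v\<close> times a number that depends
  only on \<open>l, k, k'\<close>. This gives the eigenvalue, and also the block structure, because different \<open>V\<^sub>l\<close> are orthogonal.

  Two things have to be supplied: that the explicit formula for the 3j symbol satisfies the ladder
  relations, has the usual symmetries and the right normalisation, and that every irreducible
  representation has a weight basis on which so(3) acts by the standard ladder coefficients.
\<close>

section \<open>The 3j symbols\<close>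

text \<open>
  Magnetic numbers are indexed by \<open>p = j + m\<close>, an integer between \<open>0\<close> and \<open>J = 2 j\<close>. An admissible triad is
  \<open>J1 = A + b, J2 = A + a, J3 = a + b\<close> with natural numbers \<open>A, a, b\<close>.
\<close>

definition psign :: "int \<Rightarrow> real"
  where "psign s = (if even s then 1 else -1)"

lemma psign_add: "psign (s + t) = psign s * psign t"
  by (simp add: psign_def)

lemma psign_diff: "psign (s - t) = psign s * psign t"
  by (simp add: psign_def)

lemma psign_square [simp]: "psign s * psign s = 1" "psign s * (psign s * x) = x"
  by (simp_all add: psign_def)

text \<open>
  The reciprocal factorial, extended by \<open>0\<close> to the negative integers. Then \<open>n \<cdot> invfact n = invfact (n - 1)\<close>
  holds without exception, and sums over \<open>s\<close> can be shifted without boundary terms.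
\<close>
definition invfact :: "int \<Rightarrow> real"
  where "invfact n = (if n < 0 then 0 else 1 / fact (nat n))"

lemma mult_invfact: "of_int n * invfact n = invfact (n - 1)"
proof (cases "n \<le> 0")
  case True
  then show ?thesis by (cases "n = 0") (auto simp: invfact_def)
next
  case False
  then obtain k where "n = int (Suc k)"
    by (metis gr0_implies_Suc not_le pos_int_cases)
  moreover have "nat (1 + int k) = Suc k" by simp
  moreover have "(0::real) < fact k + fact k * real k" by (simp add: add_pos_nonneg)
  ultimately show ?thesis by (simp add: invfact_def nat_add_distrib field_simps)
qed

lemma invfact_neg: "n < 0 \<Longrightarrow> invfact n = 0"
  by (simp add: invfact_def)

lemma invfact_of_nat: "invfact (int n) = 1 / fact n"
  by (simp add: invfact_def)

text \<open>
  With the brackets \<open>[i j] = x\<^sub>i y\<^sub>j - y\<^sub>i x\<^sub>j\<close> of three pairs of variables, the sum of these terms is, up to a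
  factor, a coefficient of \<open>[1 2]\<^sup>A [2 3]\<^sup>a [3 1]\<^sup>b\<close>. The six arguments are the exponents
  chosen in the binomial expansions: \<open>s\<close> and \<open>A - s\<close> in the first bracket, \<open>p2 - s\<close> and \<open>a - p2 + s\<close> in the
  second, \<open>A + b - p1 - s\<close> and \<open>p1 - A + s\<close> in the third.
\<close>
definition racah_term :: "int \<Rightarrow> int \<Rightarrow> int \<Rightarrow> int \<Rightarrow> int \<Rightarrow> int \<Rightarrow> real"
  where "racah_term A a b p1 p2 s =
    psign s * (invfact s * invfact (A - s) * invfact (p2 - s) * invfact (a - p2 + s)
      * invfact (A + b - p1 - s) * invfact (p1 - A + s))"

definition racah_sum :: "int \<Rightarrow> int \<Rightarrow> int \<Rightarrow> int \<Rightarrow> int \<Rightarrow> real"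
  where "racah_sum A a b p1 p2 = (\<Sum>s\<in>{0..A}. racah_term A a b p1 p2 s)"

lemma racah_term_eq_0:
  assumes "s < 0 \<or> A < s \<or> p2 < s \<or> a - p2 + s < 0 \<or> A + b - p1 < s \<or> p1 - A + s < 0"
  shows "racah_term A a b p1 p2 s = 0"
  using assms by (auto simp: racah_term_def invfact_neg)

lemma racah_sum_superset:
  assumes "finite I" "{0..A} \<subseteq> I"
  shows "racah_sum A a b p1 p2 = (\<Sum>s\<in>I. racah_term A a b p1 p2 s)"
  unfolding racah_sum_def using assms
  by (intro sum.mono_neutral_left) (auto intro!: racah_term_eq_0)

lemma racah_sum_eq_0:
  assumes "p1 < 0 \<or> p2 < 0 \<or> A + b < p1 \<or> A + a < p2 \<or> A + a + b < p1 + p2 \<or> p1 + p2 < A"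
  shows "racah_sum A a b p1 p2 = 0"
  unfolding racah_sum_def using assms by (intro sum.neutral) (auto intro!: racah_term_eq_0)

definition threej :: "nat \<Rightarrow> nat \<Rightarrow> nat \<Rightarrow> int \<Rightarrow> int \<Rightarrow> int \<Rightarrow> real"
  where "threej J1 J2 J3 p1 p2 p3 =
    wigner3j J1 J2 J3 (2 * p1 - int J1) (2 * p2 - int J2) (2 * p3 - int J3)"

lemma hfact_double: "hfact (2 * n) = fact (nat n)"
  by (simp add: hfact_def)

lemma triadE:
  assumes "triad J1 J2 J3"
  obtains A a b where "J1 = A + b" "J2 = A + a" "J3 = a + b"
proof -
  from assms have e: "even (J1 + J2 + J3)" and le: "J1 \<le> J2 + J3" "J2 \<le> J1 + J3" "J3 \<le> J1 + J2"
    by (auto simp: triad_def)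
  from e obtain k where k: "J1 + J2 + J3 = 2 * k" by (rule evenE)
  show thesis
    by (rule that[of "k - J3" "k - J2" "k - J1"]) (use k le in auto)
qed

lemma triadI: "triad (A + b) (A + a) (a + b)"
  by (auto simp: triad_def)

lemma threej_not_triad: "\<not> triad J1 J2 J3 \<Longrightarrow> threej J1 J2 J3 p1 p2 p3 = 0"
  by (simp add: threej_def wigner3j_def)

text \<open>
  The norm of the monomial \<open>x\<^sup>p y\<^bsup>J - p\<^esup>\<close> in an invariant inner product on binary forms.
\<close>
definition weight_norm :: "nat \<Rightarrow> int \<Rightarrow> real"
  where "weight_norm J p = sqrt (fact (nat p) * fact (nat (int J - p)))"

definition triangle_coeff :: "nat \<Rightarrow> nat \<Rightarrow> nat \<Rightarrow> real"
  where "triangle_coeff A a b = sqrt (fact A * fact a * fact b / fact (A + a + b + 1))"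

lemma threej_eq:
  fixes A a b :: nat
  shows "threej (A + b) (A + a) (a + b) p1 p2 p3 =
    (if p1 + p2 + p3 = int (A + a + b)
     then psign (int b - p3) * triangle_coeff A a b *
       (weight_norm (A + b) p1 * weight_norm (A + a) p2 * weight_norm (a + b) p3) *
       racah_sum A a b p1 p2
     else 0)"
proof -
  let ?J1 = "int (A + b)" and ?J2 = "int (A + a)" and ?J3 = "int (a + b)"
  let ?M1 = "2 * p1 - ?J1" and ?M2 = "2 * p2 - ?J2" and ?M3 = "2 * p3 - ?J3"
  have mag: "magnetic J (2 * p - int J) \<longleftrightarrow> 0 \<le> p \<and> p \<le> int J" for J p
    by (auto simp: magnetic_def)
  have sum0: "?M1 + ?M2 + ?M3 = 0 \<longleftrightarrow> p1 + p2 + p3 = int (A + a + b)" by auto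
  consider (out) "p1 + p2 + p3 \<noteq> int (A + a + b)"
    | (out2) "p1 + p2 + p3 = int (A + a + b)"
        "\<not> (magnetic (A+b) ?M1 \<and> magnetic (A+a) ?M2 \<and> magnetic (a+b) ?M3)"
    | (ok) "p1 + p2 + p3 = int (A + a + b)"
        "magnetic (A+b) ?M1" "magnetic (A+a) ?M2" "magnetic (a+b) ?M3" by blast
  then show ?thesis
  proof cases
    case out
    then have "?M1 + ?M2 + ?M3 \<noteq> 0" using sum0 by blast
    with out show ?thesis by (simp only: threej_def wigner3j_def simp_thms if_False)
  next
    case out2
    have "racah_sum A a b p1 p2 = 0"
      using out2(2) unfolding mag unfolding of_nat_add
      by (intro racah_sum_eq_0) (use out2(1) in \<open>simp only: of_nat_add, presburger\<close>)
    moreover have "threej (A + b) (A + a) (a + b) p1 p2 p3 = 0"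
      unfolding threej_def wigner3j_def using out2(2) by auto
    ultimately show ?thesis by simp
  next
    case ok
    have e: "?J1 - ?J2 - ?M3 = 2 * (int b - p3)" "?J1 + ?J2 - ?J3 = 2 * int A"
      "?J1 - ?J2 + ?J3 = 2 * int b" "- ?J1 + ?J2 + ?J3 = 2 * int a"
      "?J1 + ?J2 + ?J3 + 2 = 2 * int (A + a + b + 1)"
      "?J1 + ?M1 = 2 * p1" "?J1 - ?M1 = 2 * (?J1 - p1)"
      "?J2 + ?M2 = 2 * p2" "?J2 - ?M2 = 2 * (?J2 - p2)"
      "?J3 + ?M3 = 2 * p3" "?J3 - ?M3 = 2 * (?J3 - p3)"
      by simp_all
    have f: "2 * int A - 2 * s = 2 * (int A - s)" "2 * (?J1 - p1) - 2 * s = 2 * (int A + int b - p1 - s)"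
      "2 * p2 - 2 * s = 2 * (p2 - s)" "?J3 - ?J2 + ?M1 + 2 * s = 2 * (p1 - int A + s)"
      "?J3 - ?J1 - ?M2 + 2 * s = 2 * (int a - p2 + s)" for s
      by simp_all
    let ?R = "{s. 0 \<le> s \<and> 2 * s \<le> 2 * int A \<and> 2 * s \<le> 2 * (?J1 - p1) \<and> 2 * s \<le> 2 * p2 \<and>
              0 \<le> 2 * (p1 - int A + s) \<and> 0 \<le> 2 * (int a - p2 + s)}"
    have "(\<Sum>s\<in>?R. (if even s then 1 else -1) / (fact (nat s) * fact (nat (int A - s))
        * fact (nat (int A + int b - p1 - s)) * fact (nat (p2 - s)) * fact (nat (p1 - int A + s))
        * fact (nat (int a - p2 + s)))) = (\<Sum>s\<in>?R. racah_term A a b p1 p2 s)"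
      by (intro sum.cong refl) (auto simp: racah_term_def invfact_def psign_def)
    also have "\<dots> = racah_sum A a b p1 p2"
      unfolding racah_sum_def
      by (intro sum.mono_neutral_left) (auto intro!: racah_term_eq_0)
    finally have s: "(\<Sum>s\<in>?R. (if even s then 1 else -1) / (fact (nat s) * fact (nat (int A - s))
        * fact (nat (int A + int b - p1 - s)) * fact (nat (p2 - s)) * fact (nat (p1 - int A + s))
        * fact (nat (int a - p2 + s)))) = racah_sum A a b p1 p2" .
    have sq: "sqrt (fact (nat p1) * fact (nat (?J1 - p1)) * fact (nat p2) * fact (nat (?J2 - p2))
        * fact (nat p3) * fact (nat (?J3 - p3))) =
        weight_norm (A + b) p1 * weight_norm (A + a) p2 * weight_norm (a + b) p3"
      by (simp add: weight_norm_def real_sqrt_mult)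
    have c: "sqrt (fact (nat (int A)) * fact (nat (int b)) * fact (nat (int a)) /
        fact (nat (int (A + a + b + 1)))) = triangle_coeff A a b"
      unfolding triangle_coeff_def nat_int by (simp add: mult_ac)
    show ?thesis
      using ok sum0 triadI[of A b a]
      unfolding threej_def wigner3j_def Let_def e f hfact_double s sq c
      by (simp add: psign_def)
  qed
qed

lemma threej_closed_form:
  assumes "J1 = A + b" "J2 = A + a" "J3 = a + b"
  shows "threej J1 J2 J3 p1 p2 p3 =
    (if p1 + p2 + p3 = int A + int a + int b
     then psign (int b - p3) * triangle_coeff A a b *
       (weight_norm J1 p1 * weight_norm J2 p2 * weight_norm J3 p3) * racah_sum A a b p1 p2
     else 0)"
  unfolding assms threej_eq by simp

subsection \<open>Symmetries\<close>

text \<open>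
  Exchanging the first two pairs of variables exchanges the exponents \<open>s\<close> and \<open>A - s\<close> of the bracket \<open>[1 2]\<close>,
  which changes its sign. Exchanging \<open>x\<close> and \<open>y\<close> in all pairs does the same.
\<close>
lemma racah_sum_swap: "racah_sum A b a p2 p1 = psign A * racah_sum A a b p1 p2"
  unfolding racah_sum_def sum_distrib_left
  by (rule sum.reindex_bij_witness[of _ "\<lambda>s. A - s" "\<lambda>s. A - s"])
     (auto simp: racah_term_def psign_diff algebra_simps)

lemma racah_sum_reflect:
  "racah_sum A a b (A + b - p1) (A + a - p2) = psign A * racah_sum A a b p1 p2"
  unfolding racah_sum_def sum_distrib_left
  by (rule sum.reindex_bij_witness[of _ "\<lambda>s. A - s" "\<lambda>s. A - s"])
     (auto simp: racah_term_def psign_diff algebra_simps)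

text \<open>
  After a cyclic permutation the first bracket is \<open>[2 3]\<close>, so the summation index becomes its exponent
  \<open>a - p2 + s\<close>.
\<close>
lemma racah_sum_cycle:
  "racah_sum a b A p2 (A + a + b - p1 - p2) = psign (a - p2) * racah_sum A a b p1 p2"
proof -
  let ?I = "{- \<bar>A\<bar> - \<bar>a\<bar> - \<bar>p2\<bar>..\<bar>A\<bar> + \<bar>a\<bar> + \<bar>p2\<bar>}"
  have "racah_sum a b A p2 (A + a + b - p1 - p2)
      = (\<Sum>s\<in>{0..a}. racah_term a b A p2 (A + a + b - p1 - p2) s)"
    by (simp add: racah_sum_def)
  also have "\<dots> = (\<Sum>s\<in>{p2 - a..p2}. racah_term a b A p2 (A + a + b - p1 - p2) (a - p2 + s))"
    by (rule sum.reindex_bij_witness[of _ "\<lambda>s. a - p2 + s" "\<lambda>s. s - (a - p2)"]) auto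
  also have "\<dots> = (\<Sum>s\<in>{p2 - a..p2}. psign (a - p2) * racah_term A a b p1 p2 s)"
    by (intro sum.cong refl) (simp add: racah_term_def psign_add psign_diff algebra_simps)
  also have "\<dots> = (\<Sum>s\<in>?I. psign (a - p2) * racah_term A a b p1 p2 s)"
    by (intro sum.mono_neutral_left) (auto intro!: racah_term_eq_0)
  also have "\<dots> = psign (a - p2) * racah_sum A a b p1 p2"
    unfolding sum_distrib_left[symmetric] by (subst racah_sum_superset[of ?I]) auto
  finally show ?thesis .
qed

lemma triad_perm: "triad J2 J3 J1 = triad J1 J2 J3" "triad J2 J1 J3 = triad J1 J2 J3"
  by (auto simp: triad_def add_ac)

lemma threej_cycle: "threej J2 J3 J1 p2 p3 p1 = threej J1 J2 J3 p1 p2 p3"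
proof (cases "triad J1 J2 J3")
  case True
  then obtain A a b where J: "J1 = A + b" "J2 = A + a" "J3 = a + b" by (rule triadE)
  have J': "J2 = a + A" "J3 = a + b" "J1 = b + A" using J by auto
  have t: "triangle_coeff a b A = triangle_coeff A a b"
    by (simp add: triangle_coeff_def ac_simps)
  show ?thesis
  proof (cases "p1 + p2 + p3 = int (A + a + b)")
    case True
    then have p3: "p3 = int A + int a + int b - p1 - p2" by simp
    have "racah_sum a b A p2 p3 = psign (int a - p2) * racah_sum A a b p1 p2"
      unfolding p3 by (rule racah_sum_cycle)
    moreover have "psign (int A - p1) * psign (int a - p2) = psign (int b - p3)"
      unfolding p3 by (simp add: psign_add psign_diff mult_ac)
    ultimately show ?thesis
      unfolding threej_closed_form[OF J] threej_closed_form[OF J'] t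
      using True by (simp add: add_ac mult_ac)
  next
    case False
    then show ?thesis
      unfolding threej_closed_form[OF J] threej_closed_form[OF J']
      by (simp add: add_ac)
  qed
next
  case False
  then show ?thesis by (simp add: threej_not_triad triad_perm)
qed

lemma threej_swap:
  assumes "J1 + J2 + J3 = 2 * g"
  shows "threej J2 J1 J3 p2 p1 p3 = psign (int g) * threej J1 J2 J3 p1 p2 p3"
proof (cases "triad J1 J2 J3")
  case True
  then obtain A a b where J: "J1 = A + b" "J2 = A + a" "J3 = a + b" by (rule triadE)
  have J': "J2 = A + a" "J1 = A + b" "J3 = b + a" using J by auto
  have t: "triangle_coeff A b a = triangle_coeff A a b"
    by (simp add: triangle_coeff_def ac_simps)
  have g: "int g = int A + int a + int b" using assms J by simp
  have "psign (int a - p3) = psign A * (psign (int g) * psign (int b - p3))"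
    unfolding g by (simp add: psign_add psign_diff mult_ac)
  then show ?thesis
    unfolding threej_closed_form[OF J] threej_closed_form[OF J'] t racah_sum_swap[of A a b]
    using J by (simp add: add_ac mult_ac)
next
  case False
  then show ?thesis by (simp add: threej_not_triad triad_perm)
qed

lemma threej_swap23:
  assumes "J1 + J2 + J3 = 2 * g"
  shows "threej J1 J3 J2 p1 p3 p2 = psign (int g) * threej J1 J2 J3 p1 p2 p3"
proof -
  have "threej J1 J3 J2 p1 p3 p2 = threej J3 J2 J1 p3 p2 p1" by (rule threej_cycle[symmetric])
  also have "\<dots> = psign (int g) * threej J2 J3 J1 p2 p3 p1"
    by (rule threej_swap) (use assms in simp)
  finally show ?thesis by (simp add: threej_cycle)
qed
lemma weight_norm_reflect: "weight_norm J (int J - p) = weight_norm J p"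
  by (simp add: weight_norm_def mult.commute)

lemma threej_reflect:
  assumes "J1 + J2 + J3 = 2 * g"
  shows "threej J1 J2 J3 (int J1 - p1) (int J2 - p2) (int J3 - p3)
    = psign (int g) * threej J1 J2 J3 p1 p2 p3"
proof (cases "triad J1 J2 J3")
  case True
  then obtain A a b where J: "J1 = A + b" "J2 = A + a" "J3 = a + b" by (rule triadE)
  have g: "int g = int A + int a + int b" using assms J by simp
  have "psign (int b - (int J3 - p3)) * psign A = psign (int g) * psign (int b - p3)"
    unfolding g J by (simp add: psign_add psign_diff mult_ac)
  moreover have "racah_sum A a b (int J1 - p1) (int J2 - p2) = psign A * racah_sum A a b p1 p2"
    using racah_sum_reflect[of A a b p1 p2] J by simp
  moreover have "int J1 - p1 + (int J2 - p2) + (int J3 - p3) = int A + int a + int b \<longleftrightarrow>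
      p1 + p2 + p3 = int A + int a + int b" using J by auto
  ultimately show ?thesis
    unfolding threej_closed_form[OF J] weight_norm_reflect by (simp add: mult_ac)
next
  case False
  then show ?thesis by (simp add: threej_not_triad)
qed

subsection \<open>Ladder relations\<close>

text \<open>
  The matrix element \<open>sqrt ((j - m) (j + m + 1))\<close> of the raising operator from \<open>p\<close> to \<open>p + 1\<close>.
\<close>
definition ladder :: "nat \<Rightarrow> int \<Rightarrow> real"
  where "ladder J p = sqrt (real_of_int ((int J - p) * (p + 1)))"

lemma ladder_ends [simp]: "ladder J (- 1) = 0" "ladder J (int J) = 0"
  by (simp_all add: ladder_def)

lemma ladder_pos: "0 \<le> p \<Longrightarrow> p < int J \<Longrightarrow> ladder J p > 0"
  by (simp add: ladder_def)

lemma ladder_square: "-1 \<le> p \<Longrightarrow> p \<le> int J \<Longrightarrow> (ladder J p)\<^sup>2 = real_of_int ((int J - p) * (p + 1))"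
  unfolding ladder_def by (subst real_sqrt_pow2) (simp_all only: of_int_0_le_iff, simp_all)

lemma ladder_reflect: "ladder J (int J - p) = ladder J (p - 1)"
  by (simp add: ladder_def mult.commute)

text \<open>
  The components of a vector in the tensor product of three irreducible representations that has total weight \<open>0\<close> and
  is annihilated by the total raising and lowering operators.
\<close>
definition invariant3 :: "nat \<Rightarrow> nat \<Rightarrow> nat \<Rightarrow> (int \<Rightarrow> int \<Rightarrow> int \<Rightarrow> real) \<Rightarrow> bool"
  where "invariant3 J1 J2 J3 F \<longleftrightarrow>
    (\<forall>p1 p2 p3. F p1 p2 p3 \<noteq> 0 \<longrightarrow> p1 \<in> {0..int J1} \<and> p2 \<in> {0..int J2} \<and> p3 \<in> {0..int J3} \<and>
       2 * (p1 + p2 + p3) = int (J1 + J2 + J3)) \<and>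
    (\<forall>p1 p2 p3. ladder J1 p1 * F (p1 + 1) p2 p3 + ladder J2 p2 * F p1 (p2 + 1) p3
       + ladder J3 p3 * F p1 p2 (p3 + 1) = 0) \<and>
    (\<forall>p1 p2 p3. ladder J1 (p1 - 1) * F (p1 - 1) p2 p3 + ladder J2 (p2 - 1) * F p1 (p2 - 1) p3
       + ladder J3 (p3 - 1) * F p1 p2 (p3 - 1) = 0)"

text \<open>
  Each of the three prefactors is the sum of two of the six exponents, and an exponent times its reciprocal
  factorial lowers that factorial. The six sums obtained in this way cancel in pairs, each pair
  belonging to one bracket with its power lowered by one.
\<close>
lemma racah_sum_ladder:
  "of_int (p1 + 1) * racah_sum A a b (p1 + 1) p2 + of_int (p2 + 1) * racah_sum A a b p1 (p2 + 1)
    = of_int (A + a + b - p1 - p2) * racah_sum A a b p1 p2"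
proof -
  let ?I = "{-1..\<bar>A\<bar>}"
  define f where "f x1 x2 x3 x4 x5 x6 = invfact x1 * invfact x2 * invfact x3 * invfact x4
    * invfact x5 * invfact x6" for x1 x2 x3 x4 x5 x6
  have rt: "racah_term A a b q1 q2 s
    = psign s * f s (A - s) (q2 - s) (a - q2 + s) (A + b - q1 - s) (q1 - A + s)" for q1 q2 s
    by (simp add: racah_term_def f_def)
  have m: "of_int x1 * f x1 x2 x3 x4 x5 x6 = f (x1 - 1) x2 x3 x4 x5 x6"
    "of_int x2 * f x1 x2 x3 x4 x5 x6 = f x1 (x2 - 1) x3 x4 x5 x6"
    "of_int x3 * f x1 x2 x3 x4 x5 x6 = f x1 x2 (x3 - 1) x4 x5 x6"
    "of_int x4 * f x1 x2 x3 x4 x5 x6 = f x1 x2 x3 (x4 - 1) x5 x6"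
    "of_int x5 * f x1 x2 x3 x4 x5 x6 = f x1 x2 x3 x4 (x5 - 1) x6"
    "of_int x6 * f x1 x2 x3 x4 x5 x6 = f x1 x2 x3 x4 x5 (x6 - 1)" for x1 x2 x3 x4 x5 x6
    by (simp_all add: f_def mult_invfact[symmetric] mult_ac)
  have I: "racah_sum A a b q1 q2 = (\<Sum>s\<in>?I. racah_term A a b q1 q2 s)" for q1 q2
    by (rule racah_sum_superset) auto
  have 1: "of_int (p1 + 1) * racah_term A a b (p1 + 1) p2 s
    = psign s * f s (A - s - 1) (p2 - s) (a - p2 + s) (A + b - p1 - 1 - s) (p1 + 1 - A + s)
    + psign s * f s (A - s) (p2 - s) (a - p2 + s) (A + b - p1 - s - 1) (p1 - A + s)" for s
  proof -
    have "of_int (p1 + 1) = of_int (A - s) + (of_int (p1 + 1 - A + s) :: real)" by simp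
    then show ?thesis unfolding rt
      using m(2)[of "A - s" s "p2 - s" "a - p2 + s" "A + b - (p1 + 1) - s" "p1 + 1 - A + s"]
        m(6)[of "p1 + 1 - A + s" s "A - s" "p2 - s" "a - p2 + s" "A + b - (p1 + 1) - s"]
      by (simp add: algebra_simps)
  qed
  have 2: "of_int (p2 + 1) * racah_term A a b p1 (p2 + 1) s
    = psign s * f (s - 1) (A - s) (p2 + 1 - s) (a - p2 - 1 + s) (A + b - p1 - s) (p1 - A + s)
    + psign s * f s (A - s) (p2 - s) (a - p2 + s - 1) (A + b - p1 - s) (p1 - A + s)" for s
  proof -
    have "of_int (p2 + 1) = of_int s + (of_int (p2 + 1 - s) :: real)" by simp
    then show ?thesis unfolding rt
      using m(1)[of s "A - s" "p2 + 1 - s" "a - (p2 + 1) + s" "A + b - p1 - s" "p1 - A + s"]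
        m(3)[of "p2 + 1 - s" s "A - s" "a - (p2 + 1) + s" "A + b - p1 - s" "p1 - A + s"]
      by (simp add: algebra_simps)
  qed
  have 3: "of_int (A + a + b - p1 - p2) * racah_term A a b p1 p2 s
    = psign s * f s (A - s) (p2 - s) (a - p2 + s - 1) (A + b - p1 - s) (p1 - A + s)
    + psign s * f s (A - s) (p2 - s) (a - p2 + s) (A + b - p1 - s - 1) (p1 - A + s)" for s
  proof -
    have "of_int (A + a + b - p1 - p2) = of_int (a - p2 + s) + (of_int (A + b - p1 - s) :: real)"
      by simp
    then show ?thesis unfolding rt
      using m(4)[of "a - p2 + s" s "A - s" "p2 - s" "A + b - p1 - s" "p1 - A + s"]
        m(5)[of "A + b - p1 - s" s "A - s" "p2 - s" "a - p2 + s" "p1 - A + s"]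
      by (simp only: distrib_left distrib_right mult.left_commute[of _ "psign s"] mult.assoc)
  qed
  \<comment> \<open>The two sums that belong to the bracket \<open>[1 2]\<close> differ by the shift \<open>s \<mapsto> s + 1\<close>, which costs a sign.\<close>
  have "(\<Sum>s\<in>?I. psign s * f (s - 1) (A - s) (p2 + 1 - s) (a - p2 - 1 + s) (A + b - p1 - s) (p1 - A + s))
    = (\<Sum>s\<in>{-2..\<bar>A\<bar> - 1}. - (psign s * f s (A - s - 1) (p2 - s) (a - p2 + s) (A + b - p1 - 1 - s)
        (p1 + 1 - A + s)))"
    by (rule sum.reindex_bij_witness[of _ "\<lambda>s. s + 1" "\<lambda>s. s - 1"])
      (auto simp: psign_def algebra_simps)
  also have "\<dots> = (\<Sum>s\<in>{-2..\<bar>A\<bar>}. - (psign s * f s (A - s - 1) (p2 - s) (a - p2 + s) (A + b - p1 - 1 - s)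
        (p1 + 1 - A + s)))"
    by (rule sum.mono_neutral_left) (auto simp: f_def invfact_neg)
  also have "\<dots> = (\<Sum>s\<in>?I. - (psign s * f s (A - s - 1) (p2 - s) (a - p2 + s) (A + b - p1 - 1 - s)
        (p1 + 1 - A + s)))"
    by (rule sum.mono_neutral_right) (auto simp: f_def invfact_neg)
  finally show ?thesis
    unfolding I sum_distrib_left 1 2 3 sum.distrib sum_negf by simp
qed

lemma weight_norm_ladder:
  assumes "0 \<le> p" "p < int J"
  shows "ladder J p * weight_norm J (p + 1) = of_int (p + 1) * weight_norm J p"
proof -
  obtain n where n: "p = int n" using assms by (metis nonneg_int_cases)
  obtain m where m: "int J - p = int (Suc m)"
    using assms by (metis diff_gt_0_iff_gt gr0_implies_Suc pos_int_cases)
  have e: "int J - (p + 1) = int m" "nat (p + 1) = Suc n" using m n by simp_all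
  have "ladder J p * weight_norm J (p + 1) = sqrt (real (Suc m) * real (Suc n) * (fact (Suc n) * fact m))"
    unfolding ladder_def weight_norm_def real_sqrt_mult[symmetric] e m by (simp add: n nat_add_distrib)
  also have "real (Suc m) * real (Suc n) * (fact (Suc n) * fact m)
      = (real (Suc n))\<^sup>2 * (fact n * fact (Suc m))"
    by (simp add: power2_eq_square)
  also have "sqrt \<dots> = real (Suc n) * sqrt (fact n * fact (Suc m))"
    by (simp add: real_sqrt_mult)
  finally show ?thesis unfolding weight_norm_def m nat_int by (simp add: n)
qed

lemma threej_support:
  assumes "threej J1 J2 J3 p1 p2 p3 \<noteq> 0"
  shows "p1 \<in> {0..int J1}" "p2 \<in> {0..int J2}" "p3 \<in> {0..int J3}"
    "2 * (p1 + p2 + p3) = int (J1 + J2 + J3)"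
proof -
  from assms have "magnetic J1 (2 * p1 - int J1)" "magnetic J2 (2 * p2 - int J2)"
     "magnetic J3 (2 * p3 - int J3)" "2 * p1 - int J1 + (2 * p2 - int J2) + (2 * p3 - int J3) = 0"
    unfolding threej_def wigner3j_def by meson+
  then show "p1 \<in> {0..int J1}" "p2 \<in> {0..int J2}" "p3 \<in> {0..int J3}"
    "2 * (p1 + p2 + p3) = int (J1 + J2 + J3)"
    by (auto simp: magnetic_def)
qed

lemma threej_raise:
  "ladder J1 p1 * threej J1 J2 J3 (p1 + 1) p2 p3 + ladder J2 p2 * threej J1 J2 J3 p1 (p2 + 1) p3
       + ladder J3 p3 * threej J1 J2 J3 p1 p2 (p3 + 1) = 0"
proof (cases "triad J1 J2 J3 \<and> 2 * (p1 + p2 + p3 + 1) = int (J1 + J2 + J3) \<and>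
    0 \<le> p1 \<and> p1 \<le> int J1 \<and> 0 \<le> p2 \<and> p2 \<le> int J2 \<and> 0 \<le> p3 \<and> p3 \<le> int J3")
  case True
  then obtain A a b where J: "J1 = A + b" "J2 = A + a" "J3 = a + b" by (auto elim: triadE)
  have s: "p1 + p2 + p3 + 1 = int (A + a + b)" using True J by auto
  let ?K = "psign (int b - p3) * triangle_coeff A a b *
    (weight_norm J1 p1 * weight_norm J2 p2 * weight_norm J3 p3)"
  have z: "racah_sum A a b (p1 + 1) p2 = 0" if "p1 = int J1"
    using that J by (intro racah_sum_eq_0) auto
  have z2: "racah_sum A a b p1 (p2 + 1) = 0" if "p2 = int J2"
    using that J by (intro racah_sum_eq_0) auto
  have z3: "racah_sum A a b p1 p2 = 0" if "p3 = int J3"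
    using that J s by (intro racah_sum_eq_0) auto
  have 1: "ladder J1 p1 * threej J1 J2 J3 (p1 + 1) p2 p3
      = ?K * (of_int (p1 + 1) * racah_sum A a b (p1 + 1) p2)"
  proof (cases "p1 = int J1")
    case False
    then have "ladder J1 p1 * weight_norm J1 (p1 + 1) = of_int (p1 + 1) * weight_norm J1 p1"
      using True by (intro weight_norm_ladder) auto
    then show ?thesis
      unfolding threej_closed_form[OF J] using s by (simp add: mult_ac add_ac)
  qed (use z in simp)
  have 2: "ladder J2 p2 * threej J1 J2 J3 p1 (p2 + 1) p3
      = ?K * (of_int (p2 + 1) * racah_sum A a b p1 (p2 + 1))"
  proof (cases "p2 = int J2")
    case False
    then have "ladder J2 p2 * weight_norm J2 (p2 + 1) = of_int (p2 + 1) * weight_norm J2 p2"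
      using True by (intro weight_norm_ladder) auto
    then show ?thesis
      unfolding threej_closed_form[OF J] using s by (simp add: mult_ac add_ac)
  qed (use z2 in simp)
  have 3: "ladder J3 p3 * threej J1 J2 J3 p1 p2 (p3 + 1)
      = - ?K * (of_int (p3 + 1) * racah_sum A a b p1 p2)"
  proof (cases "p3 = int J3")
    case False
    then have w: "ladder J3 p3 * weight_norm J3 (p3 + 1) = of_int (p3 + 1) * weight_norm J3 p3"
      using True by (intro weight_norm_ladder) auto
    have "psign (int b - (p3 + 1)) = - psign (int b - p3)" by (simp add: psign_def)
    with w show ?thesis
      unfolding threej_closed_form[OF J] using s by (simp add: mult_ac add_ac)
  qed (use z3 in simp)
  have "int A + int a + int b - p1 - p2 = p3 + 1" using s by simp
  then have "of_int (p1 + 1) * racah_sum A a b (p1 + 1) p2 + of_int (p2 + 1) * racah_sum A a b p1 (p2 + 1)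
    - of_int (p3 + 1) * racah_sum A a b p1 p2 = 0"
    using racah_sum_ladder[of p1 "int A" "int a" "int b" p2] by simp
  moreover have "k * x + k * y + - k * z = k * (x + y - z)" for k x y z :: real
    by (simp add: algebra_simps)
  ultimately show ?thesis unfolding 1 2 3 by (simp only: mult_zero_right)
next
  case False
  have z: "threej J1 J2 J3 q1 q2 q3 = 0" if "\<not> triad J1 J2 J3 \<or> 2 * (q1 + q2 + q3) \<noteq> int (J1 + J2 + J3) \<or>
     \<not> (0 \<le> q1 \<and> q1 \<le> int J1 \<and> 0 \<le> q2 \<and> q2 \<le> int J2 \<and> 0 \<le> q3 \<and> q3 \<le> int J3)" for q1 q2 q3
    using that threej_not_triad[of J1 J2 J3] threej_support[of J1 J2 J3 q1 q2 q3] by fastforce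
  have 1: "ladder J1 p1 * threej J1 J2 J3 (p1 + 1) p2 p3 = 0"
    by (cases "p1 = -1") (use False in \<open>auto intro!: z\<close>)
  have 2: "ladder J2 p2 * threej J1 J2 J3 p1 (p2 + 1) p3 = 0"
    by (cases "p2 = -1") (use False in \<open>auto intro!: z\<close>)
  have 3: "ladder J3 p3 * threej J1 J2 J3 p1 p2 (p3 + 1) = 0"
    by (cases "p3 = -1") (use False in \<open>auto intro!: z\<close>)
  show ?thesis unfolding 1 2 3 by simp
qed

text \<open>
  Reflecting all magnetic numbers turns the raising relation into the lowering relation.
\<close>
lemma invariant3_threej: "invariant3 J1 J2 J3 (threej J1 J2 J3)"
proof -
  have "ladder J1 (p1 - 1) * threej J1 J2 J3 (p1 - 1) p2 p3 + ladder J2 (p2 - 1) * threej J1 J2 J3 p1 (p2 - 1) p3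
       + ladder J3 (p3 - 1) * threej J1 J2 J3 p1 p2 (p3 - 1) = 0" for p1 p2 p3
  proof (cases "triad J1 J2 J3")
    case True
    then obtain g where g: "J1 + J2 + J3 = 2 * g" unfolding triad_def by (metis evenE)
    note r = threej_reflect[OF g]
    have e: "int J - p + 1 = int J - (p - 1)" for J p by simp
    have "psign (int g) * (ladder J1 (p1 - 1) * threej J1 J2 J3 (p1 - 1) p2 p3
        + ladder J2 (p2 - 1) * threej J1 J2 J3 p1 (p2 - 1) p3
        + ladder J3 (p3 - 1) * threej J1 J2 J3 p1 p2 (p3 - 1)) = 0"
      using threej_raise[of J1 "int J1 - p1" J2 J3 "int J2 - p2" "int J3 - p3"]
      unfolding ladder_reflect e r by (simp add: algebra_simps)
    then show ?thesis by (simp add: psign_def split: if_splits)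
  qed (simp add: threej_not_triad)
  then show ?thesis
    unfolding invariant3_def using threej_support threej_raise by meson
qed


subsection \<open>Orthogonality and uniqueness\<close>

text \<open>
  The contraction of two families over their first two indices. For invariant families it is an
  intertwiner between the representations of the third indices, so Schur's lemma applies to it: it
  vanishes for different spins and is a multiple of the identity for equal ones.
\<close>
definition overlap :: "nat \<Rightarrow> nat \<Rightarrow> (int \<Rightarrow> int \<Rightarrow> int \<Rightarrow> real) \<Rightarrow> (int \<Rightarrow> int \<Rightarrow> int \<Rightarrow> real) \<Rightarrow> int \<Rightarrow> int \<Rightarrow> real"
  where "overlap J1 J2 F G p q = (\<Sum>p1\<in>{0..int J1}. \<Sum>p2\<in>{0..int J2}. F p1 p2 p * G p1 p2 q)"

lemma overlap_commute: "overlap J1 J2 F G p q = overlap J1 J2 G F q p"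
  by (simp add: overlap_def mult.commute)

lemma invariant3_support:
  assumes "invariant3 J1 J2 J3 F"
  shows "\<not> (p1 \<in> {0..int J1} \<and> p2 \<in> {0..int J2} \<and> p3 \<in> {0..int J3} \<and>
       2 * (p1 + p2 + p3) = int (J1 + J2 + J3)) \<Longrightarrow> F p1 p2 p3 = 0"
  using assms unfolding invariant3_def by blast

lemma invariant3_raise:
  assumes "invariant3 J1 J2 J3 F"
  shows "ladder J1 p1 * F (p1 + 1) p2 p3 + ladder J2 p2 * F p1 (p2 + 1) p3
       + ladder J3 p3 * F p1 p2 (p3 + 1) = 0"
  using assms unfolding invariant3_def by blast

lemma invariant3_lower:
  assumes "invariant3 J1 J2 J3 F"
  shows "ladder J1 (p1 - 1) * F (p1 - 1) p2 p3 + ladder J2 (p2 - 1) * F p1 (p2 - 1) p3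
       + ladder J3 (p3 - 1) * F p1 p2 (p3 - 1) = 0"
  using assms unfolding invariant3_def by blast

lemma sum_shift:
  fixes f :: "int \<Rightarrow> 'a::comm_monoid_add"
  assumes "f (- 1) = 0" "f (int J) = 0"
  shows "(\<Sum>p\<in>{0..int J}. f p) = (\<Sum>p\<in>{0..int J}. f (p - 1))"
proof -
  have "(\<Sum>p\<in>{0..int J}. f p) = (\<Sum>p\<in>{-1..int J - 1}. f p)"
  proof (rule sum.mono_neutral_cong)
    fix p assume "p \<in> {0..int J} - {-1..int J - 1}"
    then have "p = int J" by auto
    with assms show "f p = 0" by simp
  next
    fix p assume "p \<in> {-1..int J - 1} - {0..int J}"
    then have "p = -1" by auto
    with assms show "f p = 0" by simp
  qed auto
  also have "\<dots> = (\<Sum>p\<in>{0..int J}. f (p - 1))"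
    by (rule sum.reindex_bij_witness[of _ "\<lambda>p. p - 1" "\<lambda>p. p + 1"]) auto
  finally show ?thesis .
qed

lemma sum_ladder_shift:
  "(\<Sum>p\<in>{0..int J}. ladder J p * f (p + 1) * g p) = (\<Sum>p\<in>{0..int J}. ladder J (p - 1) * f p * g (p - 1))"
  using sum_shift[of "\<lambda>p. ladder J p * f (p + 1) * g p" J] by simp

text \<open>
  Raising and lowering operators are adjoint, so they may be moved from one factor to the other.
\<close>
lemma overlap_step:
  assumes F: "invariant3 J1 J2 J3 F" and G: "invariant3 J1 J2 J3' G"
  shows "ladder J3 p * overlap J1 J2 F G (p + 1) q = ladder J3' (q - 1) * overlap J1 J2 F G p (q - 1)"
proof -
  let ?S = "\<lambda>h. \<Sum>p1\<in>{0..int J1}. \<Sum>p2\<in>{0..int J2}. h p1 p2 :: real"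
  have a: "?S (\<lambda>p1 p2. ladder J1 p1 * F (p1 + 1) p2 p * G p1 p2 q)
      = ?S (\<lambda>p1 p2. ladder J1 (p1 - 1) * F p1 p2 p * G (p1 - 1) p2 q)"
    by (subst (1 2) sum.swap) (intro sum.cong refl sum_ladder_shift)
  have b: "?S (\<lambda>p1 p2. ladder J2 p2 * F p1 (p2 + 1) p * G p1 p2 q)
      = ?S (\<lambda>p1 p2. ladder J2 (p2 - 1) * F p1 p2 p * G p1 (p2 - 1) q)"
    by (intro sum.cong refl sum_ladder_shift)
  have "ladder J3 p * F p1 p2 (p + 1) = - (ladder J1 p1 * F (p1 + 1) p2 p) - ladder J2 p2 * F p1 (p2 + 1) p"
    for p1 p2 using invariant3_raise[OF F, of p1 p2 p] by simp
  then have "ladder J3 p * overlap J1 J2 F G (p + 1) q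
      = ?S (\<lambda>p1 p2. (- (ladder J1 p1 * F (p1 + 1) p2 p) - ladder J2 p2 * F p1 (p2 + 1) p) * G p1 p2 q)"
    by (simp add: overlap_def sum_distrib_left mult.assoc[symmetric])
  also have "\<dots> = - ?S (\<lambda>p1 p2. ladder J1 p1 * F (p1 + 1) p2 p * G p1 p2 q)
      - ?S (\<lambda>p1 p2. ladder J2 p2 * F p1 (p2 + 1) p * G p1 p2 q)"
    by (simp add: algebra_simps sum.distrib sum_negf sum_subtractf)
  also have "\<dots> = ?S (\<lambda>p1 p2. F p1 p2 p * (- (ladder J1 (p1 - 1) * G (p1 - 1) p2 q)
      - ladder J2 (p2 - 1) * G p1 (p2 - 1) q))"
    unfolding a b by (simp add: algebra_simps sum.distrib sum_negf sum_subtractf)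
  also have "(\<lambda>p1 p2. - (ladder J1 (p1 - 1) * G (p1 - 1) p2 q) - ladder J2 (p2 - 1) * G p1 (p2 - 1) q)
      = (\<lambda>p1 p2. ladder J3' (q - 1) * G p1 p2 (q - 1))"
  proof (intro ext)
    fix p1 p2
    show "- (ladder J1 (p1 - 1) * G (p1 - 1) p2 q) - ladder J2 (p2 - 1) * G p1 (p2 - 1) q
      = ladder J3' (q - 1) * G p1 p2 (q - 1)"
      using invariant3_lower[OF G, of p1 p2 q] by linarith
  qed
  then have "?S (\<lambda>p1 p2. F p1 p2 p * (- (ladder J1 (p1 - 1) * G (p1 - 1) p2 q)
      - ladder J2 (p2 - 1) * G p1 (p2 - 1) q)) = ladder J3' (q - 1) * overlap J1 J2 F G p (q - 1)"
    
    by (simp add: overlap_def sum_distrib_left fun_eq_iff mult.left_commute)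
  finally show ?thesis .
qed

lemma overlap_eq_0:
  assumes F: "invariant3 J1 J2 J3 F" and G: "invariant3 J1 J2 J3' G"
    and "\<not> (p \<in> {0..int J3} \<and> q \<in> {0..int J3'} \<and> 2 * p - int J3 = 2 * q - int J3')"
  shows "overlap J1 J2 F G p q = 0"
proof -
  have "F p1 p2 p * G p1 p2 q = 0" for p1 p2
  proof (rule ccontr)
    assume "F p1 p2 p * G p1 p2 q \<noteq> 0"
    then have "F p1 p2 p \<noteq> 0" "G p1 p2 q \<noteq> 0" by auto
    with invariant3_support[OF F, of p1 p2 p] invariant3_support[OF G, of p1 p2 q] assms(3)
    show False by fastforce
  qed
  then show ?thesis unfolding overlap_def by (simp only: sum.neutral_const)
qed

text \<open>
  Stepping up in one factor and back in the other multiplies the overlap by the squared ladder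
  coefficients of both spins; at equal magnetic number these squares differ by the difference of \<open>j (j + 1)\<close>.
\<close>
lemma overlap_different_spin:
  assumes F: "invariant3 J1 J2 J3 F" and G: "invariant3 J1 J2 J3' G" and "J3 \<noteq> J3'"
  shows "overlap J1 J2 F G p q = 0"
proof (cases "p \<in> {0..int J3} \<and> q \<in> {0..int J3'} \<and> 2 * p - int J3 = 2 * q - int J3'")
  case True
  have "ladder J3 p * overlap J1 J2 F G (p + 1) (q + 1) = ladder J3' q * overlap J1 J2 F G p q"
    using overlap_step[OF F G, of p "q + 1"] by simp
  moreover have "ladder J3' q * overlap J1 J2 F G (p + 1) (q + 1) = ladder J3 p * overlap J1 J2 F G p q"
    using overlap_step[OF G F, of q "p + 1"] by (simp add: overlap_commute[of J1 J2 G])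
  ultimately have "((ladder J3 p)\<^sup>2 - (ladder J3' q)\<^sup>2) * overlap J1 J2 F G p q = 0"
    by algebra
  moreover have "(ladder J3 p)\<^sup>2 - (ladder J3' q)\<^sup>2 = of_int ((int J3 - p) * (p + 1) - (int J3' - q) * (q + 1))"
    using True by (simp add: ladder_square)
  moreover have "(int J3 - p) * (p + 1) - (int J3' - q) * (q + 1) \<noteq> 0"
  proof -
    define d where "d = q - p"
    have e: "int J3' = int J3 + 2 * d" "q = p + d" using True by (auto simp: d_def)
    have "(int J3 - p) * (p + 1) - (int J3' - q) * (q + 1) = - (d * (int J3 + 1 + d))"
      unfolding e by (simp add: algebra_simps)
    moreover have "d \<noteq> 0" using e assms(3) by auto
    moreover have "int J3 + 1 + d \<noteq> 0" using e(1) by linarith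
    ultimately show ?thesis by simp
  qed
  ultimately show ?thesis by (metis mult_eq_0_iff of_int_eq_0_iff)
qed (rule overlap_eq_0[OF F G])

lemma overlap_constant:
  assumes F: "invariant3 J1 J2 J3 F" and G: "invariant3 J1 J2 J3 G" and "p \<in> {0..int J3}"
  shows "overlap J1 J2 F G p p = overlap J1 J2 F G (int J3) (int J3)"
proof -
  have "overlap J1 J2 F G (int J3 - int n) (int J3 - int n) = overlap J1 J2 F G (int J3) (int J3)"
    if "n \<le> J3" for n using that
  proof (induction n)
    case (Suc n)
    let ?p = "int J3 - int (Suc n)"
    have "ladder J3 ?p * overlap J1 J2 F G (?p + 1) (?p + 1) = ladder J3 ?p * overlap J1 J2 F G ?p ?p"
      using overlap_step[OF F G, of ?p "?p + 1"] by (simp only: add_diff_cancel_right')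
    moreover have "ladder J3 ?p > 0" using Suc by (intro ladder_pos) auto
    moreover have "?p + 1 = int J3 - int n" by simp
    ultimately show ?case using Suc by (metis Suc_leD less_irrefl mult_cancel_left)
  qed simp
  from this[of "nat (int J3 - p)"] assms(3) show ?thesis by (simp add: nat_le_iff)
qed

text \<open>
  At \<open>p3 = J3\<close> the raising relation involves only the first two indices and determines the components on
  the line \<open>p1 + p2 = A\<close> from a single one. The sum of the squares of the components with given
  \<open>p3\<close> is an overlap, hence the same for all \<open>p3\<close>.
\<close>
lemma invariant3_zero_line:
  assumes F: "invariant3 J1 J2 J3 F" and A: "2 * A = int J1 + int J2 - int J3"
    and z: "F 0 A (int J3) = 0"
  shows "F = (\<lambda>_ _ _. 0)"
proof -
  have line: "F (int n) (A - int n) (int J3) = 0" for n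
  proof (induction n)
    case (Suc n)
    show ?case
    proof (cases "n < J1")
      case True
      have "ladder J1 (int n) * F (int n + 1) (A - int n - 1) (int J3) = 0"
        using invariant3_raise[OF F, of "int n" "A - int n - 1" "int J3"] Suc by simp
      moreover have "ladder J1 (int n) \<noteq> 0" using ladder_pos[of "int n" J1] True by simp
      ultimately show ?thesis by (simp add: algebra_simps)
    next
      case False
      then show ?thesis by (intro invariant3_support[OF F]) auto
    qed
  qed (use z in simp)
  have top: "F p1 p2 (int J3) = 0" for p1 p2
  proof (cases "0 \<le> p1 \<and> p2 = A - p1")
    case True
    then show ?thesis using line[of "nat p1"] by simp
  next
    case False
    then show ?thesis by (intro invariant3_support[OF F]) (use A in auto)
  qed
  have "F p1 p2 p3 = 0" for p1 p2 p3
  proof (cases "p1 \<in> {0..int J1} \<and> p2 \<in> {0..int J2} \<and> p3 \<in> {0..int J3}")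
    case True
    have "overlap J1 J2 F F p3 p3 = overlap J1 J2 F F (int J3) (int J3)"
      using True by (intro overlap_constant[OF F F]) auto
    also have "\<dots> = 0" by (simp add: overlap_def top)
    finally have "(\<Sum>p1\<in>{0..int J1}. \<Sum>p2\<in>{0..int J2}. F p1 p2 p3 * F p1 p2 p3) = 0"
      by (simp add: overlap_def)
    then have "\<forall>p1\<in>{0..int J1}. (\<Sum>p2\<in>{0..int J2}. F p1 p2 p3 * F p1 p2 p3) = 0"
      by (subst (asm) sum_nonneg_eq_0_iff) (auto intro!: sum_nonneg)
    then have "\<forall>p2\<in>{0..int J2}. F p1 p2 p3 * F p1 p2 p3 = 0"
      using True by (subst (asm) sum_nonneg_eq_0_iff) (auto intro!: sum_nonneg)
    then show ?thesis using True by simp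
  next
    case False
    then show ?thesis by (intro invariant3_support[OF F]) auto
  qed
  then show ?thesis by blast
qed

lemma invariant3_swap:
  assumes F: "invariant3 J1 J2 J3 F"
  shows "invariant3 J2 J1 J3 (\<lambda>p2 p1 p3. F p1 p2 p3)"
proof -
  have "F p1 p2 p3 \<noteq> 0 \<Longrightarrow> p2 \<in> {0..int J2} \<and> p1 \<in> {0..int J1} \<and> p3 \<in> {0..int J3} \<and>
       2 * (p2 + p1 + p3) = int (J2 + J1 + J3)" for p1 p2 p3
    using invariant3_support[OF F, of p1 p2 p3] by (auto simp: algebra_simps)
  moreover have "ladder J2 p2 * F p1 (p2 + 1) p3 + ladder J1 p1 * F (p1 + 1) p2 p3
       + ladder J3 p3 * F p1 p2 (p3 + 1) = 0" for p1 p2 p3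
    using invariant3_raise[OF F, of p1 p2 p3] by simp
  moreover have "ladder J2 (p2 - 1) * F p1 (p2 - 1) p3 + ladder J1 (p1 - 1) * F (p1 - 1) p2 p3
       + ladder J3 (p3 - 1) * F p1 p2 (p3 - 1) = 0" for p1 p2 p3
    using invariant3_lower[OF F, of p1 p2 p3] by simp
  ultimately show ?thesis unfolding invariant3_def by blast
qed

text \<open>
  If the parity of the three spins is wrong, no weights add up to \<open>0\<close>. If a triangle inequality fails, an end of
  the line \<open>p1 + p2 = A\<close> lies outside the range of magnetic numbers, and the component there is zero.
\<close>
lemma invariant3_not_triad:
  assumes F: "invariant3 J1 J2 J3 F" and nt: "\<not> triad J1 J2 J3"
  shows "F = (\<lambda>_ _ _. 0)"
proof (cases "even (J1 + J2 + J3)")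
  case True
  then have "even (int J1 + int J2 - int J3)" by simp
  then obtain A where A: "int J1 + int J2 - int J3 = 2 * A" by (rule evenE)
  from nt True have "J1 > J2 + J3 \<or> J2 > J1 + J3 \<or> J3 > J1 + J2"
    by (auto simp: triad_def)
  then consider "A > int J2 \<or> A < 0" | "A > int J1" using A by linarith
  then show ?thesis
  proof cases
    case 1
    then show ?thesis
      by (intro invariant3_zero_line[OF F A[symmetric]] invariant3_support[OF F]) auto
  next
    case 2
    have "(\<lambda>p2 p1 p3. F p1 p2 p3) = (\<lambda>_ _ _. 0)"
      using 2 A by (intro invariant3_zero_line[OF invariant3_swap[OF F], of A] invariant3_support[OF F]) auto
    then show ?thesis by (metis ext)
  qed
next
  case False
  have "F p1 p2 p3 = 0" for p1 p2 p3
    by (rule invariant3_support[OF F]) (use False in \<open>metis dvd_triv_left even_of_nat\<close>)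
  then show ?thesis by blast
qed

lemma invariant3_diff_scaled:
  assumes F: "invariant3 J1 J2 J3 F" and G: "invariant3 J1 J2 J3 G"
  shows "invariant3 J1 J2 J3 (\<lambda>p1 p2 p3. F p1 p2 p3 - c * G p1 p2 p3)"
proof -
  have e: "x * (f1 - c * g1) + y * (f2 - c * g2) + z * (f3 - c * g3)
    = (x * f1 + y * f2 + z * f3) - c * (x * g1 + y * g2 + z * g3)" for x y z f1 f2 f3 g1 g2 g3 :: real
    by (simp add: algebra_simps)
  have "p1 \<in> {0..int J1} \<and> p2 \<in> {0..int J2} \<and> p3 \<in> {0..int J3} \<and>
       2 * (p1 + p2 + p3) = int (J1 + J2 + J3)" if "F p1 p2 p3 - c * G p1 p2 p3 \<noteq> 0" for p1 p2 p3
    using that invariant3_support[OF F, of p1 p2 p3] invariant3_support[OF G, of p1 p2 p3] by force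
  then show ?thesis
    unfolding invariant3_def e invariant3_raise[OF F] invariant3_raise[OF G]
      invariant3_lower[OF F] invariant3_lower[OF G] by simp
qed


subsection \<open>Normalisation\<close>

text \<open>
  Vandermonde convolution with negative upper arguments \<open>- (a + 1)\<close> and \<open>- (b + 1)\<close>.
\<close>
lemma sum_binomial_convolution:
  "(\<Sum>n\<le>A. ((n + a) choose n) * ((A - n + b) choose (A - n))) = (A + a + b + 1) choose A"
proof -
  have neg: "(- (real c + 1)) gchoose k = (-1) ^ k * real ((k + c) choose k)" for c k
    using gbinomial_minus[of "real c + 1" k]
    by (simp add: binomial_gbinomial add_ac)
  have "(-1) ^ A * (\<Sum>n\<le>A. real (((n + a) choose n) * ((A - n + b) choose (A - n))))
    = (\<Sum>n\<le>A. ((- (real a + 1)) gchoose n) * ((- (real b + 1)) gchoose (A - n)))"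
    unfolding sum_distrib_left
  proof (intro sum.cong refl)
    fix n assume "n \<in> {..A}"
    then have "(-1 :: real) ^ A = (-1) ^ n * (-1) ^ (A - n)" by (simp add: power_add[symmetric])
    then show "(-1) ^ A * real (((n + a) choose n) * ((A - n + b) choose (A - n)))
      = ((- (real a + 1)) gchoose n) * ((- (real b + 1)) gchoose (A - n))"
      unfolding neg by simp
  qed
  also have "\<dots> = (- (real (a + b + 1) + 1)) gchoose A"
  proof -
    have "- (real a + 1) + - (real b + 1) = - (real (a + b + 1) + 1)" by simp
    with gbinomial_Vandermonde[of "- (real a + 1)" "- (real b + 1)" A] show ?thesis
      by (simp only: atMost_atLeast0)
  qed
  also have "\<dots> = (-1) ^ A * real ((A + a + b + 1) choose A)"
    by (subst neg) (simp add: add_ac)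
  finally have "real (\<Sum>n\<le>A. ((n + a) choose n) * ((A - n + b) choose (A - n))) = real ((A + a + b + 1) choose A)"
    by simp
  then show ?thesis by (simp only: of_nat_eq_iff)
qed

text \<open>
  For \<open>p3 = J3\<close> the exponents \<open>p2 - s\<close> and \<open>p1 - A + s\<close> add up to \<open>0\<close>, so only \<open>s = p2\<close> contributes.
\<close>
lemma racah_sum_top:
  "racah_sum (int (n + m)) (int a) (int b) (int n) (int m) = psign (int m) / (fact m * fact n * fact a * fact b)"
proof -
  have "racah_sum (int (n + m)) (int a) (int b) (int n) (int m)
    = (\<Sum>s\<in>{int m}. racah_term (int (n + m)) (int a) (int b) (int n) (int m) s)"
    unfolding racah_sum_def by (intro sum.mono_neutral_right) (auto intro!: racah_term_eq_0)
  then show ?thesis by (simp add: racah_term_def invfact_of_nat) (simp add: invfact_def)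
qed

lemma threej_top_square:
  assumes "n + m = A"
  shows "(threej (A + b) (A + a) (a + b) (int n) (int m) (int (a + b)))\<^sup>2
    = fact A * fact (a + b) / fact (A + a + b + 1) * real (((n + a) choose n) * ((m + b) choose m))"
proof -
  have t: "threej (A + b) (A + a) (a + b) (int n) (int m) (int (a + b))
    = psign (int b - int (a + b)) * triangle_coeff A a b * (sqrt (fact n * fact (m + b)) *
      sqrt (fact m * fact (n + a)) * sqrt (fact (a + b))) * (psign (int m) / (fact m * fact n * fact a * fact b))"
  proof -
    have e: "int (A + b) - int n = int (m + b)" "int (A + a) - int m = int (n + a)" using assms by auto
    have "int n + int m + int (a + b) = int (A + a + b)" using assms by simp
    then show ?thesis
      unfolding threej_eq weight_norm_def e nat_int assms[symmetric] racah_sum_top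
      by (simp add: nat_int_add)
  qed
  have p: "(psign s)\<^sup>2 = 1" for s by (simp add: psign_def)
  have q: "(sqrt x)\<^sup>2 = x" if "x \<ge> 0" for x using that by simp
  show ?thesis
    unfolding t power_mult_distrib power_divide p triangle_coeff_def
    by (simp add: q binomial_fact power2_eq_square field_simps)
qed

text \<open>
  The overlap does not depend on \<open>p\<close>, and at the top weight \<open>p = J3\<close> it is a sum of explicit squares, which the
  binomial convolution evaluates.
\<close>
lemma overlap_threej_same:
  assumes "triad J1 J2 J3" "p \<in> {0..int J3}"
  shows "overlap J1 J2 (threej J1 J2 J3) (threej J1 J2 J3) p p = 1 / (real J3 + 1)"
proof -
  obtain A a b where J: "J1 = A + b" "J2 = A + a" "J3 = a + b" using assms(1) by (rule triadE)
  let ?X = "threej J1 J2 J3"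
  have "overlap J1 J2 ?X ?X p p = overlap J1 J2 ?X ?X (int J3) (int J3)"
    using assms(2) by (intro overlap_constant invariant3_threej)
  also have "\<dots> = (\<Sum>p1\<in>{0..int J1}. if p1 \<le> int A then (?X p1 (int A - p1) (int J3))\<^sup>2 else 0)"
    unfolding overlap_def
  proof (intro sum.cong refl)
    fix p1 assume p1: "p1 \<in> {0..int J1}"
    have "(\<Sum>p2\<in>{0..int J2}. ?X p1 p2 (int J3) * ?X p1 p2 (int J3))
        = (\<Sum>p2\<in>{0..int J2}. if p2 = int A - p1 then (?X p1 (int A - p1) (int J3))\<^sup>2 else 0)"
    proof (intro sum.cong refl)
      fix p2
      show "?X p1 p2 (int J3) * ?X p1 p2 (int J3) = (if p2 = int A - p1 then (?X p1 (int A - p1) (int J3))\<^sup>2 else 0)"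
      proof (cases "p2 = int A - p1")
        case False
        have "?X p1 p2 (int J3) = 0"
        proof (rule ccontr)
          assume "?X p1 p2 (int J3) \<noteq> 0"
          from threej_support(4)[OF this] False J show False by simp
        qed
        with False show ?thesis by simp
      qed (simp add: power2_eq_square)
    qed
    also have "\<dots> = (if p1 \<le> int A then (?X p1 (int A - p1) (int J3))\<^sup>2 else 0)"
      using p1 J by auto
    finally show "(\<Sum>p2\<in>{0..int J2}. ?X p1 p2 (int J3) * ?X p1 p2 (int J3)) = \<dots>" .
  qed
  also have "\<dots> = (\<Sum>p1\<in>{0..int A}. (?X p1 (int A - p1) (int J3))\<^sup>2)"
    by (rule sum.mono_neutral_cong_right) (auto simp: J)
  also have "\<dots> = (\<Sum>n\<le>A. (?X (int n) (int (A - n)) (int J3))\<^sup>2)"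
    by (rule sum.reindex_bij_witness[of _ int nat]) (auto simp: of_nat_diff nat_le_iff)
  also have "\<dots> = (\<Sum>n\<le>A. fact A * fact (a + b) / fact (A + a + b + 1) *
      real (((n + a) choose n) * ((A - n + b) choose (A - n))))"
    unfolding J by (intro sum.cong refl threej_top_square) auto
  also have "\<dots> = fact A * fact (a + b) / fact (A + a + b + 1) * real ((A + a + b + 1) choose A)"
    unfolding sum_binomial_convolution[symmetric] of_nat_sum sum_distrib_left ..
  also have "\<dots> = 1 / (real J3 + 1)"
  proof -
    define X :: real where "X = fact (A + a + b + 1)"
    have "X > 0" by (simp add: X_def)
    have "A + a + b + 1 - A = a + b + 1" by simp
    then have "real ((A + a + b + 1) choose A) = X / (fact A * fact (a + b + 1))"
      using binomial_fact[of A "A + a + b + 1", where ?'a = real]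
      by (simp add: X_def)
    moreover have "fact (a + b + 1) = (real J3 + 1) * fact (a + b)" by (simp add: J)
    ultimately show ?thesis using \<open>X > 0\<close> unfolding X_def[symmetric] by simp
  qed
  finally show ?thesis .
qed

text \<open>
  The orthogonality relation of the 3j symbols.
\<close>
lemma overlap_threej:
  assumes "triad J1 J2 J3 \<or> triad J1 J2 J3'"
  shows "overlap J1 J2 (threej J1 J2 J3) (threej J1 J2 J3') p q
    = (if J3 = J3' \<and> p = q \<and> p \<in> {0..int J3} then 1 / (real J3 + 1) else 0)"
proof (cases "J3 = J3' \<and> p = q \<and> p \<in> {0..int J3}")
  case True
  then show ?thesis using assms by (auto simp: overlap_threej_same)
next
  case False
  note X = invariant3_threej[of J1 J2 J3] and X' = invariant3_threej[of J1 J2 J3']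
  show ?thesis
  proof (cases "J3 = J3'")
    case True
    with False have "\<not> (p \<in> {0..int J3} \<and> q \<in> {0..int J3'} \<and> 2 * p - int J3 = 2 * q - int J3')" by auto
    from overlap_eq_0[OF X X' this] False show ?thesis by simp
  qed (simp add: overlap_different_spin[OF X X'])
qed

text \<open>
  The component at \<open>(0, A, J3)\<close> of the 3j symbol is nonzero, so subtracting a multiple of the symbol makes the
  line argument applicable. The multiple is then computed by pairing with the symbol, which has norm one.
\<close>
lemma invariant3_unique:
  assumes F: "invariant3 J1 J2 J3 F" and tr: "triad J1 J2 J3"
  shows "F p1 p2 p3 = (\<Sum>q\<in>{0..int J3}. overlap J1 J2 F (threej J1 J2 J3) q q) * threej J1 J2 J3 p1 p2 p3"
proof -
  obtain A a b where J: "J1 = A + b" "J2 = A + a" "J3 = a + b" using tr by (rule triadE)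
  let ?X = "threej J1 J2 J3"
  have "(?X 0 (int A) (int J3))\<^sup>2 > 0"
    using threej_top_square[of 0 A A b a] unfolding J by (simp add: zero_less_mult_iff)
  then have nz: "?X 0 (int A) (int J3) \<noteq> 0" by auto
  define c where "c = F 0 (int A) (int J3) / ?X 0 (int A) (int J3)"
  have "(\<lambda>p1 p2 p3. F p1 p2 p3 - c * ?X p1 p2 p3) = (\<lambda>_ _ _. 0)"
    by (rule invariant3_zero_line[OF invariant3_diff_scaled[OF F invariant3_threej], of "int A"])
      (use J nz in \<open>auto simp: c_def\<close>)
  then have eq: "F p1 p2 p3 = c * ?X p1 p2 p3" for p1 p2 p3
    by (metis eq_iff_diff_eq_0)
  have "(\<Sum>q\<in>{0..int J3}. overlap J1 J2 F ?X q q) = (\<Sum>q\<in>{0..int J3}. c * overlap J1 J2 ?X ?X q q)"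
    unfolding overlap_def eq sum_distrib_left by (simp add: mult.assoc)
  also have "\<dots> = (\<Sum>q\<in>{0..int J3}. c * (1 / (real J3 + 1)))"
    by (intro sum.cong refl) (simp add: overlap_threej_same[OF tr])
  also have "\<dots> = c" by (simp add: add.commute)
  finally show ?thesis by (simp add: eq)
qed

subsection \<open>The 6j symbol\<close>

text \<open>
  Passes from magnetic numbers \<open>M\<close>, of which only those with the parity of \<open>J\<close> count, to \<open>p = (J + M)/2\<close>.
\<close>
lemma sum_over_magnetic:
  assumes "\<And>M. \<not> magnetic J M \<Longrightarrow> f M = 0"
  shows "(\<Sum>M\<in>{- int J..int J}. f M) = (\<Sum>p\<in>{0..int J}. f (2 * p - int J))"
proof -
  have "(\<Sum>M\<in>{- int J..int J}. f M) = (\<Sum>M\<in>(\<lambda>p. 2 * p - int J) ` {0..int J}. f M)"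
  proof (rule sum.mono_neutral_right)
    show "\<forall>M\<in>{- int J..int J} - (\<lambda>p. 2 * p - int J) ` {0..int J}. f M = 0"
    proof
      fix M assume M: "M \<in> {- int J..int J} - (\<lambda>p. 2 * p - int J) ` {0..int J}"
      show "f M = 0"
      proof (rule assms, rule notI)
        assume "magnetic J M"
        then have "even (int J + M)" by (auto simp: magnetic_def)
        then obtain p where "int J + M = 2 * p" by (rule evenE)
        then have "M = 2 * p - int J" "p \<in> {0..int J}" using M by auto
        with M show False by blast
      qed
    qed
  qed auto
  also have "\<dots> = (\<Sum>p\<in>{0..int J}. f (2 * p - int J))"
    by (subst sum.reindex) (auto simp: inj_on_def)
  finally show ?thesis .
qed

lemma wigner3j_not_magnetic:
  "\<not> (magnetic J1 M1 \<and> magnetic J2 M2 \<and> magnetic J3 M3) \<Longrightarrow> wigner3j J1 J2 J3 M1 M2 M3 = 0"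
  unfolding wigner3j_def by auto

lemma wigner6j_threej:
  "wigner6j a b c d e f =
    (\<Sum>\<alpha>\<in>{0..int a}. \<Sum>\<beta>\<in>{0..int b}. \<Sum>\<gamma>\<in>{0..int c}.
     \<Sum>\<delta>\<in>{0..int d}. \<Sum>\<epsilon>\<in>{0..int e}. \<Sum>\<zeta>\<in>{0..int f}.
       psign (\<delta> + \<epsilon> + \<zeta>) *
       threej a b c \<alpha> \<beta> \<gamma> * threej a e f \<alpha> \<epsilon> (int f - \<zeta>) *
       threej d b f (int d - \<delta>) \<beta> \<zeta> * threej d e c \<delta> (int e - \<epsilon>) \<gamma>)"
proof -
  define t where "t \<alpha> \<beta> \<gamma> \<delta> \<epsilon> \<zeta> = (if even ((int d + \<delta> + int e + \<epsilon> + int f + \<zeta>) div 2) then 1 else -1) *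
       wigner3j a b c \<alpha> \<beta> \<gamma> * wigner3j a e f \<alpha> \<epsilon> (- \<zeta>) *
       wigner3j d b f (- \<delta>) \<beta> \<zeta> * wigner3j d e c \<delta> (- \<epsilon>) \<gamma>" for \<alpha> \<beta> \<gamma> \<delta> \<epsilon> \<zeta>
  have z: "t \<alpha> \<beta> \<gamma> \<delta> \<epsilon> \<zeta> = 0" if "\<not> (magnetic a \<alpha> \<and> magnetic b \<beta> \<and> magnetic c \<gamma> \<and>
      magnetic d \<delta> \<and> magnetic e \<epsilon> \<and> magnetic f \<zeta>)" for \<alpha> \<beta> \<gamma> \<delta> \<epsilon> \<zeta>
    using that wigner3j_not_magnetic[of a \<alpha> b \<beta> c \<gamma>] wigner3j_not_magnetic[of a \<alpha> e \<epsilon> f "- \<zeta>"]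
      wigner3j_not_magnetic[of d "- \<delta>" b \<beta> f \<zeta>] wigner3j_not_magnetic[of d \<delta> e "- \<epsilon>" c \<gamma>]
    unfolding t_def by auto
  have e: "- (2 * p - int J) = 2 * (int J - p) - int J" for p J by simp
  have ph: "(if even ((int d + (2 * \<delta> - int d) + int e + (2 * \<epsilon> - int e) + int f + (2 * \<zeta> - int f)) div 2) then 1 else -1)
    = psign (\<delta> + \<epsilon> + \<zeta>)" for \<delta> \<epsilon> \<zeta>
  proof -
    have "int d + (2 * \<delta> - int d) + int e + (2 * \<epsilon> - int e) + int f + (2 * \<zeta> - int f) = 2 * (\<delta> + \<epsilon> + \<zeta>)"
      by simp
    then show ?thesis unfolding psign_def by (simp only: nonzero_mult_div_cancel_left)
  qed
  have s1: "(\<Sum>\<zeta>\<in>{- int f..int f}. t \<alpha> \<beta> \<gamma> \<delta> \<epsilon> \<zeta>)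
    = (\<Sum>\<zeta>\<in>{0..int f}. t \<alpha> \<beta> \<gamma> \<delta> \<epsilon> (2 * \<zeta> - int f))" for \<alpha> \<beta> \<gamma> \<delta> \<epsilon>
    by (rule sum_over_magnetic) (simp add: z)
  have s2: "(\<Sum>\<epsilon>\<in>{- int e..int e}. \<Sum>\<zeta>\<in>{0..int f}. t \<alpha> \<beta> \<gamma> \<delta> \<epsilon> (2 * \<zeta> - int f))
    = (\<Sum>\<epsilon>\<in>{0..int e}. \<Sum>\<zeta>\<in>{0..int f}. t \<alpha> \<beta> \<gamma> \<delta> (2 * \<epsilon> - int e) (2 * \<zeta> - int f))" for \<alpha> \<beta> \<gamma> \<delta>
    by (rule sum_over_magnetic) (simp add: z)
  have s3: "(\<Sum>\<delta>\<in>{- int d..int d}. \<Sum>\<epsilon>\<in>{0..int e}. \<Sum>\<zeta>\<in>{0..int f}. t \<alpha> \<beta> \<gamma> \<delta> (2 * \<epsilon> - int e) (2 * \<zeta> - int f))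
    = (\<Sum>\<delta>\<in>{0..int d}. \<Sum>\<epsilon>\<in>{0..int e}. \<Sum>\<zeta>\<in>{0..int f}. t \<alpha> \<beta> \<gamma> (2 * \<delta> - int d) (2 * \<epsilon> - int e) (2 * \<zeta> - int f))" for \<alpha> \<beta> \<gamma>
    by (rule sum_over_magnetic) (simp add: z)
  have s4: "(\<Sum>\<gamma>\<in>{- int c..int c}. \<Sum>\<delta>\<in>{0..int d}. \<Sum>\<epsilon>\<in>{0..int e}. \<Sum>\<zeta>\<in>{0..int f}. t \<alpha> \<beta> \<gamma> (2 * \<delta> - int d) (2 * \<epsilon> - int e) (2 * \<zeta> - int f))
    = (\<Sum>\<gamma>\<in>{0..int c}. \<Sum>\<delta>\<in>{0..int d}. \<Sum>\<epsilon>\<in>{0..int e}. \<Sum>\<zeta>\<in>{0..int f}. t \<alpha> \<beta> (2 * \<gamma> - int c) (2 * \<delta> - int d) (2 * \<epsilon> - int e) (2 * \<zeta> - int f))" for \<alpha> \<beta>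
    by (rule sum_over_magnetic) (simp add: z)
  have s5: "(\<Sum>\<beta>\<in>{- int b..int b}. \<Sum>\<gamma>\<in>{0..int c}. \<Sum>\<delta>\<in>{0..int d}. \<Sum>\<epsilon>\<in>{0..int e}. \<Sum>\<zeta>\<in>{0..int f}. t \<alpha> \<beta> (2 * \<gamma> - int c) (2 * \<delta> - int d) (2 * \<epsilon> - int e) (2 * \<zeta> - int f))
    = (\<Sum>\<beta>\<in>{0..int b}. \<Sum>\<gamma>\<in>{0..int c}. \<Sum>\<delta>\<in>{0..int d}. \<Sum>\<epsilon>\<in>{0..int e}. \<Sum>\<zeta>\<in>{0..int f}. t \<alpha> (2 * \<beta> - int b) (2 * \<gamma> - int c) (2 * \<delta> - int d) (2 * \<epsilon> - int e) (2 * \<zeta> - int f))" for \<alpha>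
    by (rule sum_over_magnetic) (simp add: z)
  have s6: "(\<Sum>\<alpha>\<in>{- int a..int a}. \<Sum>\<beta>\<in>{0..int b}. \<Sum>\<gamma>\<in>{0..int c}. \<Sum>\<delta>\<in>{0..int d}. \<Sum>\<epsilon>\<in>{0..int e}. \<Sum>\<zeta>\<in>{0..int f}. t \<alpha> (2 * \<beta> - int b) (2 * \<gamma> - int c) (2 * \<delta> - int d) (2 * \<epsilon> - int e) (2 * \<zeta> - int f))
    = (\<Sum>\<alpha>\<in>{0..int a}. \<Sum>\<beta>\<in>{0..int b}. \<Sum>\<gamma>\<in>{0..int c}. \<Sum>\<delta>\<in>{0..int d}. \<Sum>\<epsilon>\<in>{0..int e}. \<Sum>\<zeta>\<in>{0..int f}. t (2 * \<alpha> - int a) (2 * \<beta> - int b) (2 * \<gamma> - int c) (2 * \<delta> - int d) (2 * \<epsilon> - int e) (2 * \<zeta> - int f))"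
    by (rule sum_over_magnetic) (simp add: z)
  have "wigner6j a b c d e f = (\<Sum>\<alpha>\<in>{- int a..int a}. \<Sum>\<beta>\<in>{- int b..int b}. \<Sum>\<gamma>\<in>{- int c..int c}.
     \<Sum>\<delta>\<in>{- int d..int d}. \<Sum>\<epsilon>\<in>{- int e..int e}. \<Sum>\<zeta>\<in>{- int f..int f}. t \<alpha> \<beta> \<gamma> \<delta> \<epsilon> \<zeta>)"
    unfolding wigner6j_def t_def ..
  also have "\<dots> = (\<Sum>\<alpha>\<in>{0..int a}. \<Sum>\<beta>\<in>{0..int b}. \<Sum>\<gamma>\<in>{0..int c}.
     \<Sum>\<delta>\<in>{0..int d}. \<Sum>\<epsilon>\<in>{0..int e}. \<Sum>\<zeta>\<in>{0..int f}.
       t (2 * \<alpha> - int a) (2 * \<beta> - int b) (2 * \<gamma> - int c) (2 * \<delta> - int d) (2 * \<epsilon> - int e) (2 * \<zeta> - int f))"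
    by (simp only: s1 s2 s3 s4 s5 s6)
  finally show ?thesis
    unfolding t_def ph e threej_def .
qed

text \<open>
  The entry in row \<open>p\<close> and column \<open>q\<close> of the normalised tensor operator of rank \<open>l\<close> acting on spin \<open>J/2\<close>. The column index is
  reflected and carries a sign because it belongs to the dual representation.
\<close>

definition tensor_coeff :: "nat \<Rightarrow> nat \<Rightarrow> int \<Rightarrow> int \<Rightarrow> int \<Rightarrow> real"
  where "tensor_coeff J l \<alpha> p q = sqrt (2 * real l + 1) * psign q * threej (2 * l) J J \<alpha> p (int J - q)"

definition triple_trace :: "nat \<Rightarrow> nat \<Rightarrow> nat \<Rightarrow> nat \<Rightarrow> int \<Rightarrow> int \<Rightarrow> int \<Rightarrow> real"
  where "triple_trace J l k k' \<alpha> \<beta> \<gamma> = (\<Sum>p\<in>{0..int J}. \<Sum>q\<in>{0..int J}. \<Sum>r\<in>{0..int J}.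
    tensor_coeff J l \<alpha> p q * tensor_coeff J k \<beta> q r * tensor_coeff J k' \<gamma> r p)"

text \<open>
  The invariant is its pairing with the 3j symbol times that symbol. Each tensor coefficient is a 3j symbol, so the
  pairing is a contraction of four 3j symbols; after cyclic permutations of their columns it
  is the one that defines the 6j symbol.
\<close>
lemma triple_trace_eq:
  assumes inv: "invariant3 (2 * l) (2 * k) (2 * k') (triple_trace J l k k')"
  shows "triple_trace J l k k' \<alpha> \<beta> \<gamma>
    = sqrt (2 * real l + 1) * sqrt (2 * real k + 1) * sqrt (2 * real k' + 1)
      * wigner6j (2 * l) (2 * k) (2 * k') J J J * threej (2 * l) (2 * k) (2 * k') \<alpha> \<beta> \<gamma>"
proof (cases "triad (2 * l) (2 * k) (2 * k')")
  case True
  let ?X = "threej (2 * l) (2 * k) (2 * k')" and ?I = "{0..int J}"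
  let ?s = "sqrt (2 * real l + 1) * sqrt (2 * real k + 1) * sqrt (2 * real k' + 1)"
  have summand: "?X \<alpha> \<beta> \<gamma> * triple_trace J l k k' \<alpha> \<beta> \<gamma> = ?s * (\<Sum>\<delta>\<in>?I. \<Sum>\<epsilon>\<in>?I. \<Sum>\<zeta>\<in>?I.
      psign (\<delta> + \<epsilon> + \<zeta>) * ?X \<alpha> \<beta> \<gamma> * threej (2 * l) J J \<alpha> \<epsilon> (int J - \<zeta>) *
       threej J (2 * k) J (int J - \<delta>) \<beta> \<zeta> * threej J J (2 * k') \<delta> (int J - \<epsilon>) \<gamma>)" for \<alpha> \<beta> \<gamma>
  proof -
    have "triple_trace J l k k' \<alpha> \<beta> \<gamma> = (\<Sum>\<delta>\<in>?I. \<Sum>\<epsilon>\<in>?I. \<Sum>\<zeta>\<in>?I.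
        tensor_coeff J l \<alpha> \<epsilon> \<zeta> * tensor_coeff J k \<beta> \<zeta> \<delta> * tensor_coeff J k' \<gamma> \<delta> \<epsilon>)"
    proof -
      let ?f = "\<lambda>p q r. tensor_coeff J l \<alpha> p q * tensor_coeff J k \<beta> q r * tensor_coeff J k' \<gamma> r p"
      have "(\<Sum>p\<in>?I. \<Sum>q\<in>?I. \<Sum>r\<in>?I. ?f p q r) = (\<Sum>p\<in>?I. \<Sum>r\<in>?I. \<Sum>q\<in>?I. ?f p q r)"
        by (intro sum.cong refl sum.swap)
      also have "\<dots> = (\<Sum>r\<in>?I. \<Sum>p\<in>?I. \<Sum>q\<in>?I. ?f p q r)" by (rule sum.swap)
      finally show ?thesis unfolding triple_trace_def .
    qed
    moreover have "threej (2 * k) J J \<beta> q (int J - r) = threej J (2 * k) J (int J - r) \<beta> q" for q r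
      by (rule threej_cycle)
    moreover have "threej (2 * k') J J \<gamma> r (int J - p) = threej J J (2 * k') r (int J - p) \<gamma>" for p r
      by (simp add: threej_cycle)
    ultimately show ?thesis
      by (simp add: tensor_coeff_def psign_add sum_distrib_left mult_ac)
  qed
  have "(\<Sum>\<gamma>\<in>{0..int (2 * k')}. overlap (2 * l) (2 * k) (triple_trace J l k k') ?X \<gamma> \<gamma>)
    = (\<Sum>\<alpha>\<in>{0..int (2 * l)}. \<Sum>\<beta>\<in>{0..int (2 * k)}. \<Sum>\<gamma>\<in>{0..int (2 * k')}.
        ?X \<alpha> \<beta> \<gamma> * triple_trace J l k k' \<alpha> \<beta> \<gamma>)"
    unfolding overlap_def by (subst sum.swap, subst (2) sum.swap) (simp add: mult.commute)
  also have "\<dots> = ?s * wigner6j (2 * l) (2 * k) (2 * k') J J J"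
    unfolding summand wigner6j_threej sum_distrib_left ..
  finally show ?thesis
    using invariant3_unique[OF inv True, of \<alpha> \<beta> \<gamma>] by simp
next
  case False
  then show ?thesis using invariant3_not_triad[OF inv False] by (simp add: threej_not_triad)
qed

section \<open>Complex matrices\<close>

definition cscale :: "complex \<Rightarrow> complex^'n^'n \<Rightarrow> complex^'n^'n"
  where "cscale z A = (\<chi> i j. z * A $ i $ j)"

definition cinner :: "complex^'n \<Rightarrow> complex^'n \<Rightarrow> complex"
  where "cinner v w = (\<Sum>i\<in>UNIV. cnj (v $ i) * w $ i)"

definition outer :: "complex^'n \<Rightarrow> complex^'n \<Rightarrow> complex^'n^'n"
  where "outer v w = (\<chi> i j. v $ i * cnj (w $ j))"

lemma cscale_nth [simp]: "cscale z A $ i $ j = z * A $ i $ j"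
  by (simp add: cscale_def)

lemma conj_transpose_nth [simp]: "conj_transpose A $ i $ j = cnj (A $ j $ i)"
  by (simp add: conj_transpose_def)

lemma matrix_mult_nth: "(A ** B) $ i $ j = (\<Sum>k\<in>UNIV. A $ i $ k * B $ k $ j)"
  by (simp add: matrix_matrix_mult_def)

lemma cscale_simps [simp]: "cscale 1 A = A" "cscale 0 A = 0" "cscale z 0 = 0"
  "cscale z (cscale w A) = cscale (z * w) A"
  by (simp_all add: vec_eq_iff)

lemma cscale_distrib: "cscale z (A + B) = cscale z A + cscale z B"
  "cscale z (A - B) = cscale z A - cscale z B" "cscale z (- A) = - cscale z A"
  "cscale (z + w) A = cscale z A + cscale w A" "cscale (z - w) A = cscale z A - cscale w A"
  "cscale (- z) A = - cscale z A"
  by (simp_all add: vec_eq_iff algebra_simps)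

lemma scaleR_eq_cscale: "r *\<^sub>R A = cscale (of_real r) A"
  by (simp add: vec_eq_iff scaleR_conv_of_real[where 'a = complex])

lemma cscale_sum: "cscale z (\<Sum>i\<in>I. f i) = (\<Sum>i\<in>I. cscale z (f i))"
  by (induction I rule: infinite_finite_induct) (simp_all add: cscale_distrib)

lemma cscale_sum_left: "cscale (\<Sum>i\<in>I. f i) A = (\<Sum>i\<in>I. cscale (f i) A)"
  by (induction I rule: infinite_finite_induct) (simp_all add: cscale_distrib)

lemma cscale_mult: "cscale z A ** B = cscale z (A ** B)" "A ** cscale z B = cscale z (A ** B)"
  by (simp_all add: vec_eq_iff matrix_mult_nth sum_distrib_left mult_ac)

lemma matrix_mult_minus: "(- A) ** B = - (A ** B)" "A ** (- B) = - (A ** B)"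
  for A B :: "complex^'n^'n"
  by (simp_all add: vec_eq_iff matrix_mult_nth sum_negf)

lemma matrix_mult_zero [simp]: "0 ** A = 0" "A ** 0 = 0"
  for A :: "complex^'n^'n"
  by (simp_all add: vec_eq_iff matrix_mult_nth)

lemma matrix_mult_distrib: "(A + B) ** C = A ** C + B ** C" "A ** (B + C) = A ** B + A ** C"
    "(A - B) ** C = A ** C - B ** C" "A ** (B - C) = A ** B - A ** C"
  for A B C :: "complex^'n^'n"
  by (simp_all add: vec_eq_iff matrix_mult_nth sum.distrib sum_subtractf algebra_simps)

lemma trace_simps [simp]: "trace (cscale z A) = z * trace A" "trace (- A) = - trace A"
    "trace (0 :: complex^'n^'n) = 0"
  by (simp_all add: trace_def sum_distrib_left sum_negf)

lemma trace_sum: "trace (\<Sum>i\<in>I. f i) = (\<Sum>i\<in>I. trace (f i))"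
  for f :: "'i \<Rightarrow> complex^'n^'n"
  by (induction I rule: infinite_finite_induct) (simp_all add: trace_add)

lemma conj_transpose_simps [simp]: "conj_transpose (A + B) = conj_transpose A + conj_transpose B"
    "conj_transpose (A - B) = conj_transpose A - conj_transpose B"
    "conj_transpose (- A) = - conj_transpose A"
    "conj_transpose (cscale z A) = cscale (cnj z) (conj_transpose A)"
    "conj_transpose (conj_transpose A) = A" "conj_transpose 0 = 0"
  by (simp_all add: vec_eq_iff)

lemma conj_transpose_mult: "conj_transpose (A ** B) = conj_transpose B ** conj_transpose A"
  by (simp add: vec_eq_iff matrix_mult_nth mult.commute)

lemma trace_conj_transpose: "trace (conj_transpose A) = cnj (trace A)"
  by (simp add: trace_def)

lemma commutator_simps [simp]: "commutator (A + B) C = commutator A C + commutator B C"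
    "commutator A (B + C) = commutator A B + commutator A C"
    "commutator (A - B) C = commutator A C - commutator B C"
    "commutator A (B - C) = commutator A B - commutator A C"
    "commutator (cscale z A) B = cscale z (commutator A B)"
    "commutator A (cscale z B) = cscale z (commutator A B)"
    "commutator (- A) B = - commutator A B" "commutator A (- B) = - commutator A B"
    "commutator 0 A = 0" "commutator A 0 = 0" "commutator A A = 0"
  by (simp_all add: commutator_def matrix_mult_distrib cscale_mult matrix_mult_minus cscale_distrib)

lemma commutator_commute: "commutator A B = - commutator B A"
  by (simp add: commutator_def)

lemma commutator_sum: "commutator A (\<Sum>i\<in>I. f i) = (\<Sum>i\<in>I. commutator A (f i))"
  by (induction I rule: infinite_finite_induct) simp_all

lemma commutator_mult: "commutator A (B ** C) = commutator A B ** C + B ** commutator A C"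
  by (simp add: commutator_def matrix_mult_distrib matrix_mul_assoc)

lemma trace_mult_commute: "trace (A ** B) = trace (B ** A)" for A B :: "complex^'n^'n"
  by (rule trace_mul_sym)

lemma trace_commutator [simp]: "trace (commutator A B) = 0"
  by (simp add: commutator_def trace_sub trace_mult_commute[of A B])

lemma cinner_simps: "cinner (u + v) w = cinner u w + cinner v w" "cinner w (u + v) = cinner w u + cinner w v"
    "cinner (z *s v) w = cnj z * cinner v w" "cinner w (z *s v) = z * cinner w v"
    "cinner 0 w = 0" "cinner w 0 = 0"
  by (simp_all add: cinner_def sum.distrib sum_distrib_left algebra_simps)

lemma cinner_matrix: "cinner v (A *v w) = cinner (conj_transpose A *v v) w"
proof -
  have "cinner v (A *v w) = (\<Sum>i\<in>UNIV. \<Sum>j\<in>UNIV. cnj (v $ i) * (A $ i $ j * w $ j))"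
    by (simp add: cinner_def matrix_vector_mult_def sum_distrib_left)
  also have "\<dots> = (\<Sum>j\<in>UNIV. \<Sum>i\<in>UNIV. cnj (v $ i) * (A $ i $ j * w $ j))"
    by (rule sum.swap)
  also have "\<dots> = cinner (conj_transpose A *v v) w"
    by (simp add: cinner_def matrix_vector_mult_def sum_distrib_right)
      (simp add: mult_ac)
  finally show ?thesis .
qed

lemma inner_eq_Re_cinner: "v \<bullet> w = Re (cinner v w)"
  by (simp add: inner_vec_def cinner_def inner_complex_def)

lemma cinner_self: "cinner v v = of_real (v \<bullet> v)"
  by (simp add: cinner_def inner_vec_def complex_eq_iff inner_complex_def)

lemma scaleR_eq_smult: "r *\<^sub>R v = of_real r *s v" for v :: "complex^'n"
  by (simp add: vec_eq_iff scaleR_conv_of_real[where 'a = complex])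

lemma matrix_vector_simps: "(cscale z A) *v x = z *s (A *v x)" "A *v (z *s x) = z *s (A *v x)"
   "A *v (r *\<^sub>R x) = r *\<^sub>R (A *v x)" "A *v 0 = 0"
  for A :: "complex^'n^'n"
  by (simp_all add: vec_eq_iff matrix_vector_mult_def sum_distrib_left scaleR_sum_right mult_ac)

lemma matrix_outer: "A ** outer v w = outer (A *v v) w" "outer v w ** A = outer v (conj_transpose A *v w)"
  by (simp_all add: vec_eq_iff matrix_mult_nth outer_def matrix_vector_mult_def
    sum_distrib_right sum_distrib_left mult_ac)

lemma outer_outer: "outer v w ** outer x y = cscale (cinner w x) (outer v y)"
  by (simp add: vec_eq_iff matrix_mult_nth outer_def cinner_def sum_distrib_left sum_distrib_right mult_ac)

lemma trace_outer: "trace (outer v w) = cinner w v"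
  by (simp add: trace_def outer_def cinner_def mult.commute)

lemma conj_transpose_outer: "conj_transpose (outer v w) = outer w v"
  by (simp add: vec_eq_iff outer_def)

lemma outer_simps: "outer (r *\<^sub>R v) w = cscale (of_real r) (outer v w)"
    "outer v (r *\<^sub>R w) = cscale (of_real r) (outer v w)"
  by (simp_all add: vec_eq_iff outer_def scaleR_conv_of_real[where 'a = complex])

section \<open>The weight basis\<close>

text \<open>
  A maximiser \<open>v\<close> of the quadratic form on the unit sphere: the form \<open>c (x \<bullet> x) - L x \<bullet> x\<close> is nonnegative and vanishes
  at \<open>v\<close>, so its first variation there vanishes. The variation is taken in the direction
  \<open>w = c v - L v\<close> itself.
\<close>
lemma symmetric_top_eigenvector:
  fixes L :: "'a::euclidean_space \<Rightarrow> 'a"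
  assumes lin: "linear L" and sym: "\<And>x y. L x \<bullet> y = x \<bullet> L y"
  obtains v c where "norm v = 1" "L v = c *\<^sub>R v" "\<And>x. L x \<bullet> x \<le> c * (x \<bullet> x)"
proof -
  interpret L: linear L by (rule lin)
  have cont: "continuous_on (sphere 0 1) (\<lambda>x. L x \<bullet> x)"
    using lin by (intro continuous_intros linear_continuous_on linear_linear[THEN iffD2]) (simp add: linear_conv_bounded_linear)
  have "(sphere 0 1 :: 'a set) \<noteq> {}" using vector_choose_size[of 1, where ?'a = 'a] by auto
  then obtain v where v: "v \<in> sphere 0 1" and max: "\<And>y. y \<in> sphere 0 1 \<Longrightarrow> L y \<bullet> y \<le> L v \<bullet> v"
    using continuous_attains_sup[OF compact_sphere _ cont] by blast
  define c where "c = L v \<bullet> v"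
  have le: "L x \<bullet> x \<le> c * (x \<bullet> x)" for x
  proof (cases "x = 0")
    case False
    have "L ((1 / norm x) *\<^sub>R x) \<bullet> ((1 / norm x) *\<^sub>R x) \<le> c"
      unfolding c_def using False by (intro max) simp
    moreover have "norm x * norm x = x \<bullet> x" by (simp add: dot_square_norm power2_eq_square)
    ultimately have "(L x \<bullet> x) / (x \<bullet> x) \<le> c" by (simp add: L.scaleR)
    then show ?thesis using False by (simp add: pos_divide_le_eq)
  qed (simp add: L.zero)
  have vv: "v \<bullet> v = 1" using v by (simp add: dot_square_norm)
  define w where "w = c *\<^sub>R v - L v"
  define b where "b = w \<bullet> w"
  define d where "d = c * (w \<bullet> w) - L w \<bullet> w"
  have d: "d \<ge> 0" using le[of w] by (simp add: d_def)
  have "0 \<le> 2 * t * b + t\<^sup>2 * d" for t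
  proof -
    have "c * ((v + t *\<^sub>R w) \<bullet> (v + t *\<^sub>R w)) - L (v + t *\<^sub>R w) \<bullet> (v + t *\<^sub>R w)
      = (c * (v \<bullet> v) - L v \<bullet> v) + 2 * t * ((c *\<^sub>R v - L v) \<bullet> w) + t\<^sup>2 * (c * (w \<bullet> w) - L w \<bullet> w)"
    proof -
      have 1: "L w \<bullet> v = L v \<bullet> w" using sym[of w v] by (simp add: inner_commute)
      have 2: "w \<bullet> v = v \<bullet> w" by (rule inner_commute)
      have "L (v + t *\<^sub>R w) \<bullet> (v + t *\<^sub>R w) = L v \<bullet> v + 2 * t * (L v \<bullet> w) + t * t * (L w \<bullet> w)"
        unfolding L.add L.scaleR inner_add_left inner_add_right inner_scaleR_left inner_scaleR_right 1
        by (simp add: algebra_simps)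
      moreover have "(v + t *\<^sub>R w) \<bullet> (v + t *\<^sub>R w) = v \<bullet> v + 2 * t * (v \<bullet> w) + t * t * (w \<bullet> w)"
        unfolding inner_add_left inner_add_right inner_scaleR_left inner_scaleR_right 2
        by (simp add: algebra_simps)
      ultimately show ?thesis
        unfolding inner_diff_left inner_scaleR_left by (simp add: power2_eq_square algebra_simps)
    qed
    with le[of "v + t *\<^sub>R w"] show ?thesis unfolding b_def d_def w_def[symmetric] vv c_def[symmetric] by simp
  qed
  \<comment> \<open>The value \<open>t = - b / (d + 1)\<close> makes the quadratic negative unless \<open>b = 0\<close>, also if \<open>d = 0\<close>.\<close>
  moreover define s where "s = d + 1"
  moreover have "2 * (- b / s) * b + (- b / s)\<^sup>2 * (s - 1) = - (b\<^sup>2 * (s + 1)) / s\<^sup>2" if "s \<noteq> 0"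
    using that by (simp add: field_simps power2_eq_square)
  ultimately have "0 \<le> - (b\<^sup>2 * (s + 1)) / s\<^sup>2" "s > 0" using d by (metis add_diff_cancel_right' add_nonneg_pos less_irrefl zero_less_one)+
  then have "b\<^sup>2 * (s + 1) \<le> 0" by (auto simp: divide_le_0_iff)
  with \<open>s > 0\<close> have "b = 0" by (simp add: mult_le_0_iff)
  then have "L v = c *\<^sub>R v" by (simp add: b_def w_def)
  moreover have "norm v = 1" using v by simp
  ultimately show thesis using that le by blast
qed

text \<open>
  The generators \<open>S i\<close> are skew-Hermitian; \<open>\<i> S i\<close> are the Hermitian spin operators with \<open>[J\<^sub>1, J\<^sub>2] = \<i> J\<^sub>3\<close>. The following are
  \<open>J\<^sub>3\<close>, \<open>J\<^sub>1 + \<i> J\<^sub>2\<close> and \<open>J\<^sub>1 - \<i> J\<^sub>2\<close>.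
\<close>
definition spin3 :: "(3 \<Rightarrow> complex^'n^'n) \<Rightarrow> complex^'n^'n"
  where "spin3 S = cscale \<i> (S 3)"

definition spin_up :: "(3 \<Rightarrow> complex^'n^'n) \<Rightarrow> complex^'n^'n"
  where "spin_up S = cscale \<i> (S 1) - S 2"

definition spin_down :: "(3 \<Rightarrow> complex^'n^'n) \<Rightarrow> complex^'n^'n"
  where "spin_down S = cscale \<i> (S 1) + S 2"

lemma so3_irrep_brackets:
  assumes "so3_irrep S"
  shows "commutator (S 1) (S 2) = S 3" "commutator (S 2) (S 3) = S 1" "commutator (S 3) (S 1) = S 2"
    "commutator (S 2) (S 1) = - S 3" "commutator (S 3) (S 2) = - S 1" "commutator (S 1) (S 3) = - S 2"
  using assms commutator_commute[of "S 2" "S 1"] commutator_commute[of "S 3" "S 2"]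
    commutator_commute[of "S 1" "S 3"] by (auto simp: so3_irrep_def)

lemma spin_brackets:
  assumes "so3_irrep S"
  shows "commutator (spin3 S) (spin_up S) = spin_up S"
    "commutator (spin3 S) (spin_down S) = - spin_down S"
    "commutator (spin_up S) (spin_down S) = cscale 2 (spin3 S)"
  by (simp_all add: spin3_def spin_up_def spin_down_def so3_irrep_brackets[OF assms] cscale_distrib)
     (simp_all add: vec_eq_iff)

lemma conj_transpose_spin:
  assumes "so3_irrep S"
  shows "conj_transpose (spin3 S) = spin3 S" "conj_transpose (spin_up S) = spin_down S"
    "conj_transpose (spin_down S) = spin_up S"
proof -
  have "conj_transpose (S i) = - S i" for i using assms by (auto simp: so3_irrep_def su_def)
  then show "conj_transpose (spin3 S) = spin3 S" "conj_transpose (spin_up S) = spin_down S"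
    "conj_transpose (spin_down S) = spin_up S"
    by (simp_all add: spin3_def spin_up_def spin_down_def cscale_distrib)
qed


lemma spin_commute_vector:
  fixes S :: "3 \<Rightarrow> complex^'n^'n"
  assumes "so3_irrep S"
  shows "spin3 S *v (spin_up S *v x) = spin_up S *v (spin3 S *v x) + spin_up S *v x"
    "spin3 S *v (spin_down S *v x) = spin_down S *v (spin3 S *v x) - spin_down S *v x"
    "spin_up S *v (spin_down S *v x) = spin_down S *v (spin_up S *v x) + 2 *s (spin3 S *v x)"
proof -
  have "A *v (B *v x) = B *v (A *v x) + commutator A B *v x" for A B :: "complex^'n^'n"
    by (simp add: commutator_def matrix_vector_mul_assoc matrix_vector_mult_diff_rdistrib)
  from this[of "spin3 S" "spin_up S"] this[of "spin3 S" "spin_down S"] this[of "spin_up S" "spin_down S"]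
  show "spin3 S *v (spin_up S *v x) = spin_up S *v (spin3 S *v x) + spin_up S *v x"
    "spin3 S *v (spin_down S *v x) = spin_down S *v (spin3 S *v x) - spin_down S *v x"
    "spin_up S *v (spin_down S *v x) = spin_down S *v (spin_up S *v x) + 2 *s (spin3 S *v x)"
    by (simp_all add: spin_brackets[OF assms] matrix_vector_simps)
       (simp add: vec_eq_iff matrix_vector_mult_def sum_negf)
qed

definition weight_basis :: "(3 \<Rightarrow> complex^'n^'n) \<Rightarrow> nat \<Rightarrow> (int \<Rightarrow> complex^'n) \<Rightarrow> bool"
  where "weight_basis S J e \<longleftrightarrow>
    (\<forall>p\<in>{0..int J}. \<forall>q\<in>{0..int J}. cinner (e p) (e q) = (if p = q then 1 else 0)) \<and>
    (\<forall>p\<in>{0..int J}. spin3 S *v e p = (of_int p - real J / 2) *\<^sub>R e p \<and>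
       spin_up S *v e p = ladder J p *\<^sub>R e (p + 1) \<and>
       spin_down S *v e p = ladder J (p - 1) *\<^sub>R e (p - 1))"

text \<open>
  A top eigenvector of \<open>J\<^sub>3\<close> is annihilated by the raising operator. The squared norms of its successive images \<open>v k\<close>
  under the lowering operator are multiplied by \<open>(k + 1) (2 m - k)\<close>, so the sequence must reach \<open>0\<close>, and the last
  nonzero index \<open>J\<close> satisfies \<open>J = 2 m\<close>. The span of the \<open>v k\<close> is invariant, hence everything; as the
  \<open>v k\<close> are orthogonal, \<open>J + 1\<close> is the dimension.
\<close>
lemma weight_basis_exists:
  fixes S :: "3 \<Rightarrow> complex^'n^'n"
  assumes irrep: "so3_irrep S"
  obtains e where "weight_basis S (CARD('n) - 1) e"
proof -
  let ?H = "spin3 S" and ?U = "spin_up S" and ?D = "spin_down S"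
  note ct = conj_transpose_spin[OF irrep] and comm = spin_commute_vector[OF irrep]
  have adj: "(?D *v x) \<bullet> y = x \<bullet> (?U *v y)" "(?H *v x) \<bullet> y = x \<bullet> (?H *v y)" for x y
    by (simp_all add: inner_eq_Re_cinner cinner_matrix ct)
  have lin: "linear ((*v) ?H)"
    by (rule linearI) (simp_all add: matrix_vector_right_distrib matrix_vector_simps)
  obtain v0 m where v0: "norm v0 = 1" and H0: "?H *v v0 = m *\<^sub>R v0"
    and top: "\<And>x. (?H *v x) \<bullet> x \<le> m * (x \<bullet> x)"
    using symmetric_top_eigenvector[OF lin adj(2)] by blast
  have U0: "?U *v v0 = 0"
  proof -
    have "?H *v (?U *v v0) = (m + 1) *\<^sub>R (?U *v v0)"
      by (simp add: comm H0 matrix_vector_simps scaleR_add_left)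
    with top[of "?U *v v0"] have "(?U *v v0) \<bullet> (?U *v v0) \<le> 0" by (simp add: algebra_simps)
    then show ?thesis by (simp add: not_less[symmetric])
  qed
  define v where "v k = ((*v) ?D ^^ k) v0" for k
  have v_0: "v 0 = v0" and v_Suc: "v (Suc k) = ?D *v v k" for k by (simp_all add: v_def)
  have Hv: "?H *v v k = (m - real k) *\<^sub>R v k" for k
  proof (induction k)
    case (Suc k)
    have "?H *v v (Suc k) = (m - real k) *\<^sub>R v (Suc k) - v (Suc k)"
      unfolding v_Suc comm(2) Suc.IH by (simp add: matrix_vector_simps)
    then show ?case by (simp add: algebra_simps)
  qed (simp add: v_0 H0)
  have Uv: "?U *v v (Suc k) = ((real k + 1) * (2 * m - real k)) *\<^sub>R v k" for k
  proof (induction k)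
    case 0
    show ?case unfolding v_Suc comm(3) v_0 U0 H0
      by (simp add: matrix_vector_simps scaleR_eq_smult)
  next
    case (Suc k)
    have "?U *v v (Suc (Suc k)) = ((real k + 1) * (2 * m - real k)) *\<^sub>R v (Suc k)
        + 2 *s ((m - real (Suc k)) *\<^sub>R v (Suc k))"
      unfolding v_Suc[of "Suc k"] comm(3) Suc.IH Hv by (simp add: matrix_vector_simps v_Suc)
    also have "\<dots> = ((real k + 1) * (2 * m - real k) + 2 * (m - real (Suc k))) *\<^sub>R v (Suc k)"
      by (simp add: scaleR_eq_smult vec_eq_iff algebra_simps)
    also have "(real k + 1) * (2 * m - real k) + 2 * (m - real (Suc k))
        = (real (Suc k) + 1) * (2 * m - real (Suc k))" by (simp add: algebra_simps)
    finally show ?case .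
  qed
  have nv: "v (Suc k) \<bullet> v (Suc k) = (real k + 1) * (2 * m - real k) * (v k \<bullet> v k)" for k
  proof -
    have "v (Suc k) \<bullet> v (Suc k) = v k \<bullet> (?U *v v (Suc k))"
      by (metis adj(1) v_Suc)
    then show ?thesis unfolding Uv by simp
  qed
  have ex: "\<exists>k. v k = 0"
  proof (rule ccontr)
    assume nz: "\<nexists>k. v k = 0"
    obtain k :: nat where k: "2 * m \<le> real k" using real_arch_simple by blast
    have "v (Suc k) \<bullet> v (Suc k) > 0" "v k \<bullet> v k > 0" using nz by auto
    with nv[of k] k show False by (smt (verit) mult_nonneg_nonpos mult_nonpos_nonneg of_nat_0_le_iff)
  qed
  obtain d where d: "v d = 0" "\<And>k. k < d \<Longrightarrow> v k \<noteq> 0"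
    by (rule that[OF LeastI_ex[OF ex] not_less_Least[where P = "\<lambda>k. v k = 0"]])
  have "d \<noteq> 0" using d(1) v0 v_0 by (metis norm_zero zero_neq_one)
  then obtain J where dJ: "d = Suc J" by (cases d) auto
  have vJ: "v J \<noteq> 0" "v (Suc J) = 0" using d dJ by auto
  have mJ: "m = real J / 2"
    using nv[of J] vJ by simp
  have zero: "v k = 0" if "k \<ge> Suc J" for k
    using that
  proof (induction k rule: dec_induct)
    case base
    show ?case by (rule vJ(2))
  next
    case (step k)
    then show ?case by (simp add: v_Suc[of k] matrix_vector_simps)
  qed
  have orth: "cinner (v j) (v k) = 0" if "j \<noteq> k" for j k
  proof -
    have "of_real (m - real k) * cinner (v j) (v k) = of_real (m - real j) * cinner (v j) (v k)"
      using cinner_matrix[of "v j" ?H "v k"] 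
      unfolding ct Hv scaleR_eq_smult cinner_simps complex_cnj_complex_of_real .
    then have "of_real (real k - real j) * cinner (v j) (v k) = 0"
      by (auto simp: algebra_simps)
    then show ?thesis using that by (auto simp del: of_real_diff)
  qed
  \<comment> \<open>Irreducibility: the span of the weight vectors is invariant under all generators.\<close>
  define W where "W = vec.span (v ` {..J})"
  have vW: "v k \<in> W" for k
    using zero[of k] by (cases "k \<le> J") (auto simp: W_def vec.span_zero intro: vec.span_base)
  have W: "vec.subspace W" by (simp add: W_def)
  have Winv: "A *v w \<in> W" if A: "\<And>k. A *v v k \<in> W" and w: "w \<in> W" for A w
    using w unfolding W_def
  proof (induction rule: vec.span_induct_alt)
    case base then show ?case by (simp add: matrix_vector_simps vec.span_zero)
  next
    case (step c x y)
    then obtain k where "x = v k" by auto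
    then have "A *v x \<in> W" using A by simp
    then show ?case
      using step(2) W unfolding W_def
      by (simp add: matrix_vector_right_distrib matrix_vector_simps vec.span_add vec.span_scale)
  qed
  have Uk: "?U *v v k \<in> W" for k
    by (cases k) (auto simp: v_0 U0 Uv scaleR_eq_smult intro!: vec.subspace_scale[OF W] vW vec.subspace_0[OF W])
  have Dk: "?D *v v k \<in> W" for k using vW[of "Suc k"] by (simp add: v_Suc)
  have Hk: "?H *v v k \<in> W" for k
    unfolding Hv scaleR_eq_smult by (intro vec.subspace_scale[OF W] vW)
  have "S i *v w \<in> W" if w: "w \<in> W" for i w
  proof -
    have "S 1 *v w = (- \<i> / 2) *s (?U *v w + ?D *v w)" "S 2 *v w = (1 / 2) *s (?D *v w - ?U *v w)"
      "S 3 *v w = (- \<i>) *s (?H *v w)"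
      by (simp_all add: spin_up_def spin_down_def spin3_def matrix_vector_mult_add_rdistrib
        matrix_vector_mult_diff_rdistrib matrix_vector_simps)
        (simp_all add: vec_eq_iff)
    moreover have "?U *v w \<in> W" "?D *v w \<in> W" "?H *v w \<in> W"
      using Winv[OF Uk w] Winv[OF Dk w] Winv[OF Hk w] by auto
    ultimately have "S 1 *v w \<in> W" "S 2 *v w \<in> W" "S 3 *v w \<in> W"
      by (simp_all only: vec.subspace_scale[OF W] vec.subspace_add[OF W] vec.subspace_diff[OF W])
    then show ?thesis using exhaust_3[of i] by auto
  qed
  moreover have "W \<noteq> {0}" using vW[of J] vJ by auto
  ultimately have "W = UNIV" using irrep W unfolding so3_irrep_def by blast
  moreover have inj: "inj_on v {..J}"
  proof (rule inj_onI, rule ccontr)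
    fix j k assume "j \<in> {..J}" "k \<in> {..J}" "v j = v k" "j \<noteq> k"
    then have "v k \<bullet> v k = 0" "v k \<noteq> 0" using orth[of j k] d(2)[of k] dJ by (auto simp: cinner_self)
    then show False by simp
  qed
  moreover have "vec.independent (v ` {..J})"
    unfolding vec.dependent_finite[OF finite_imageI[OF finite_atMost]]
  proof
    assume "\<exists>u. (\<exists>x\<in>v ` {..J}. u x \<noteq> 0) \<and> (\<Sum>x\<in>v ` {..J}. u x *s x) = 0"
    then obtain u k where s: "(\<Sum>x\<in>v ` {..J}. u x *s x) = 0" and k: "k \<in> {..J}" "u (v k) \<noteq> 0"
      by blast
    have "0 = cinner (v k) (\<Sum>x\<in>v ` {..J}. u x *s x)" by (simp add: s cinner_simps)
    also have "\<dots> = cinner (v k) (\<Sum>j\<in>{..J}. u (v j) *s v j)"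
      using inj by (subst sum.reindex) auto
    also have "\<dots> = (\<Sum>j\<in>{..J}. u (v j) * cinner (v k) (v j))"
    proof -
      have "cinner w (\<Sum>j\<in>I. f j) = (\<Sum>j\<in>I. cinner w (f j))" for w :: "complex^'n" and f and I :: "nat set"
        by (induction I rule: infinite_finite_induct) (simp_all add: cinner_simps)
      then show ?thesis by (simp add: cinner_simps)
    qed
    also have "\<dots> = (\<Sum>j\<in>{..J}. if j = k then u (v k) * cinner (v k) (v k) else 0)"
      by (intro sum.cong refl) (auto simp: orth)
    finally have "v k \<bullet> v k = 0" using k by (simp add: cinner_self)
    then show False using d(2)[of k] k dJ by simp
  qed
  ultimately have "card (v ` {..J}) = CARD('n)"
    unfolding W_def by (metis vec.dim_eq_card vec_dim_card vec.span_UNIV)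
  then have J: "J = CARD('n) - 1" using inj by (simp add: card_image)
  \<comment> \<open>The lowering operator decreases \<open>p\<close>, while it increases the index \<open>k = J - p\<close> of \<open>v\<close>.\<close>
  define e where "e p = (1 / norm (v (nat (int J - p)))) *\<^sub>R v (nat (int J - p))" for p
  have step: "norm (v (Suc k)) = sqrt ((real k + 1) * (real J - real k)) * norm (v k)" if "k \<le> J" for k
  proof -
    have "norm (v (Suc k)) = sqrt ((real k + 1) * (2 * m - real k) * (v k \<bullet> v k))"
      unfolding nv[symmetric] by (simp add: norm_eq_sqrt_inner)
    then show ?thesis by (simp add: mJ real_sqrt_mult norm_eq_sqrt_inner)
  qed
  have nz: "norm (v k) \<noteq> 0" if "k \<le> J" for k using d(2)[of k] dJ that by simp
  have "cinner (e p) (e q) = (if p = q then 1 else 0)" if "p \<in> {0..int J}" "q \<in> {0..int J}" for p q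
  proof (cases "p = q")
    case True
    have "norm (v (nat (int J - p))) \<noteq> 0" using that by (intro nz) auto
    then show ?thesis using True
      by (simp add: cinner_self e_def dot_square_norm power2_eq_square[symmetric] power_divide)
  next
    case False
    then have "nat (int J - p) \<noteq> nat (int J - q)" using that by auto
    from orth[OF this] show ?thesis using False by (simp add: e_def scaleR_eq_smult cinner_simps)
  qed
  moreover have "?H *v e p = (of_int p - real J / 2) *\<^sub>R e p" if "p \<in> {0..int J}" for p
  proof -
    have "m - real (nat (int J - p)) = of_int p - real J / 2" using that by (simp add: mJ)
    then show ?thesis by (simp add: e_def matrix_vector_simps Hv)
  qed
  moreover have "?U *v e p = ladder J p *\<^sub>R e (p + 1)" if p: "p \<in> {0..int J}" for p
  proof (cases "p = int J")
    case True
    then show ?thesis by (simp add: e_def matrix_vector_simps v_0 U0)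
  next
    case False
    define k where "k = nat (int J - p - 1)"
    have k: "nat (int J - p) = Suc k" "nat (int J - (p + 1)) = k" "k \<le> J" "k < J" "real k = real J - of_int p - 1"
      using p False by (auto simp: k_def)
    let ?x = "(real k + 1) * (real J - real k)"
    have x: "?x > 0" using k by simp
    have "real J = real k + of_int p + 1" using k(5) by simp
    then have l: "ladder J p = sqrt ?x" by (simp add: ladder_def mult.commute add.commute)
    have "?U *v e p = (?x / (sqrt ?x * norm (v k))) *\<^sub>R v k"
      unfolding e_def k matrix_vector_simps Uv step[OF k(3)] mJ by simp
    also have "?x / (sqrt ?x * norm (v k)) = sqrt ?x / norm (v k)"
      using x nz[OF k(3)] by (metis divide_divide_eq_left less_eq_real_def real_div_sqrt)
    finally show ?thesis unfolding e_def k l by simp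
  qed
  moreover have "?D *v e p = ladder J (p - 1) *\<^sub>R e (p - 1)" if p: "p \<in> {0..int J}" for p
  proof (cases "p = 0")
    case True
    then show ?thesis using vJ(2) by (simp add: e_def matrix_vector_simps v_Suc)
  next
    case False
    define k where "k = nat (int J - p)"
    have k: "nat (int J - (p - 1)) = Suc k" "nat (int J - p) = k" "k \<le> J" "Suc k \<le> J" "real k = real J - of_int p"
      using p False by (auto simp: k_def)
    have l: "ladder J (p - 1) = sqrt ((real k + 1) * (real J - real k))"
    proof -
      have "real J = real k + of_int p" using k(5) by simp
      then show ?thesis by (simp add: ladder_def mult.commute add.commute)
    qed
    have "ladder J (p - 1) * (1 / norm (v (Suc k))) = 1 / norm (v k)"
      using nz[OF k(4)] nz[OF k(3)] unfolding step[OF k(3)] l by (simp add: field_simps)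
    then show ?thesis unfolding e_def k by (simp add: matrix_vector_simps v_Suc[symmetric])
  qed
  ultimately have "weight_basis S J e" by (simp add: weight_basis_def)
  then show thesis using that J by blast
qed

section \<open>Tensor operators\<close>

definition mat_inner :: "complex^'n^'n \<Rightarrow> complex^'n^'n \<Rightarrow> complex"
  where "mat_inner X Y = trace (conj_transpose X ** Y)"

lemma mat_inner_eq_sum: "mat_inner X Y = (\<Sum>i\<in>UNIV. \<Sum>j\<in>UNIV. cnj (X $ i $ j) * Y $ i $ j)"
  unfolding mat_inner_def trace_def by (simp add: matrix_mult_nth) (rule sum.swap)

lemma mat_inner_simps [simp]:
  "mat_inner (X + Y) Z = mat_inner X Z + mat_inner Y Z"
  "mat_inner Z (X + Y) = mat_inner Z X + mat_inner Z Y"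
  "mat_inner (X - Y) Z = mat_inner X Z - mat_inner Y Z"
  "mat_inner Z (X - Y) = mat_inner Z X - mat_inner Z Y"
  "mat_inner (- X) Z = - mat_inner X Z" "mat_inner Z (- X) = - mat_inner Z X"
  "mat_inner (cscale z X) Y = cnj z * mat_inner X Y"
  "mat_inner X (cscale z Y) = z * mat_inner X Y"
  "mat_inner 0 X = 0" "mat_inner X 0 = 0"
  by (simp_all add: mat_inner_eq_sum sum.distrib sum_subtractf sum_negf sum_distrib_left algebra_simps)

lemma mat_inner_sum_right: "mat_inner X (\<Sum>i\<in>I. f i) = (\<Sum>i\<in>I. mat_inner X (f i))"
  by (induction I rule: infinite_finite_induct) simp_all

lemma mat_inner_sum_left: "mat_inner (\<Sum>i\<in>I. f i) X = (\<Sum>i\<in>I. mat_inner (f i) X)"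
  by (induction I rule: infinite_finite_induct) simp_all

lemma cnj_mat_inner: "cnj (mat_inner X Y) = mat_inner Y X"
  by (simp add: mat_inner_eq_sum mult.commute)

lemma Re_mat_inner: "Re (mat_inner X Y) = X \<bullet> Y"
  by (simp add: mat_inner_eq_sum inner_vec_def inner_complex_def)

lemma mat_inner_commutator:
  "conj_transpose A = - A \<Longrightarrow> mat_inner X (commutator A Y) = - mat_inner (commutator A X) Y"
  by (simp add: mat_inner_def commutator_def conj_transpose_mult matrix_mult_distrib matrix_mult_minus
    matrix_mul_assoc trace_sub trace_add trace_mult_commute[of A "conj_transpose X ** Y"])
    (metis matrix_mul_assoc trace_mult_commute)

text \<open>
  An orthonormal family with as many members as the dimension spans, so the difference of both sides is orthogonal to itself.
\<close>
lemma orthonormal_family_expansion: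
  fixes f :: "'i \<Rightarrow> 'a::euclidean_space"
  assumes "finite K" and card: "card K = DIM('a)"
    and orth: "\<And>j k. j \<in> K \<Longrightarrow> k \<in> K \<Longrightarrow> f j \<bullet> f k = (if j = k then 1 else 0)"
  shows "x = (\<Sum>k\<in>K. (f k \<bullet> x) *\<^sub>R f k)"
proof -
  have inj: "inj_on f K" using orth by (intro inj_onI) (metis zero_neq_one)
  have "independent (f ` K)"
  proof (rule pairwise_orthogonal_independent)
    show "pairwise orthogonal (f ` K)"
      using orth by (auto simp: pairwise_def orthogonal_def)
    show "0 \<notin> f ` K" using orth by (metis imageE inner_zero_left zero_neq_one)
  qed
  then have "UNIV \<subseteq> span (f ` K)"
    using assms(1) by (intro card_ge_dim_independent) (auto simp: card_image[OF inj] card)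
  define y where "y = x - (\<Sum>k\<in>K. (f k \<bullet> x) *\<^sub>R f k)"
  have "orthogonal y z" if "z \<in> f ` K" for z
  proof -
    from that obtain j where j: "j \<in> K" "z = f j" by blast
    have "(\<Sum>k\<in>K. (f k \<bullet> x) *\<^sub>R f k) \<bullet> f j = (\<Sum>k\<in>K. if k = j then f j \<bullet> x else 0)"
      unfolding inner_sum_left using orth j by (intro sum.cong refl) auto
    then show ?thesis using j assms(1)
      unfolding orthogonal_def y_def inner_diff_left j(2) by (simp add: inner_commute[of x])
  qed
  then have "orthogonal y y"
    using \<open>UNIV \<subseteq> span (f ` K)\<close> orthogonal_to_span[of y "f ` K" y] by blast
  then show ?thesis by (simp add: orthogonal_def y_def)
qed

text \<open>
  The reflected transpose is an anti-automorphism of the matrix algebra under which the tensors of rank \<open>l\<close> are multiplied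
  by \<open>(-1)\<^sup>l\<close>, up to a diagonal change of signs.
\<close>
lemma tensor_coeff_flip:
  "tensor_coeff J l \<alpha> (int J - q) (int J - p) = psign (int l + p + q) * tensor_coeff J l \<alpha> p q"
proof -
  have "threej (2 * l) J J \<alpha> (int J - q) p = psign (int (l + J)) * threej (2 * l) J J \<alpha> p (int J - q)"
    by (rule threej_swap23) simp
  then show ?thesis by (simp add: tensor_coeff_def psign_add psign_diff mult_ac)
qed

lemma tensor_coeff_support:
  assumes "tensor_coeff J l \<alpha> p q \<noteq> 0"
  shows "\<alpha> \<in> {0..2 * int l}" "p - q = int l - \<alpha>"
proof -
  have "threej (2 * l) J J \<alpha> p (int J - q) \<noteq> 0" using assms by (auto simp: tensor_coeff_def)
  from threej_support[OF this] show "\<alpha> \<in> {0..2 * int l}" "p - q = int l - \<alpha>" by auto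
qed

lemma tensor_coeff_transpose:
  "tensor_coeff J l (2 * int l - \<alpha>) p q = psign (\<alpha> - int l) * tensor_coeff J l \<alpha> q p"
proof -
  have "threej (2 * l) J J (int (2 * l) - \<alpha>) (int J - (int J - p)) (int J - q)
      = psign (int (l + J)) * threej (2 * l) J J \<alpha> (int J - p) q"
    by (rule threej_reflect) simp
  also have "threej (2 * l) J J \<alpha> (int J - p) q = psign (int (l + J)) * threej (2 * l) J J \<alpha> q (int J - p)"
    by (rule threej_swap23) simp
  finally have eq: "threej (2 * l) J J (2 * int l - \<alpha>) p (int J - q) = threej (2 * l) J J \<alpha> q (int J - p)"
    by simp
  show ?thesis
  proof (cases "tensor_coeff J l \<alpha> q p = 0")
    case True
    then show ?thesis using eq by (auto simp: tensor_coeff_def psign_def)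
  next
    case False
    then have "q = p + (int l - \<alpha>)" using tensor_coeff_support(2)[of J l \<alpha> q p] by simp
    then have "psign q = psign (\<alpha> - int l) * psign p" by (simp add: psign_add psign_diff mult_ac)
    then show ?thesis using eq by (simp add: tensor_coeff_def)
  qed
qed

text \<open>
  The ladder relation of the 3j symbol in its three slots, read as a commutator with a ladder operator.
\<close>
lemma tensor_coeff_lower:
  "ladder J (p - 1) * tensor_coeff J l \<alpha> (p - 1) q - ladder J q * tensor_coeff J l \<alpha> p (q + 1)
    = - ladder (2 * l) (\<alpha> - 1) * tensor_coeff J l (\<alpha> - 1) p q"
proof -
  let ?X = "threej (2 * l) J J"
  have "ladder J (p - 1) * ?X \<alpha> (p - 1) (int J - q) + ladder J q * ?X \<alpha> p (int J - (q + 1))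
    = - ladder (2 * l) (\<alpha> - 1) * ?X (\<alpha> - 1) p (int J - q)"
    using invariant3_lower[OF invariant3_threej[of "2 * l" J J], of \<alpha> p "int J - q"]
      ladder_reflect[of J "int J - q"] by (simp add: algebra_simps)
  moreover have "psign (q + 1) = - psign q" by (simp add: psign_def)
  ultimately show ?thesis unfolding tensor_coeff_def by algebra
qed

lemma tensor_coeff_raise:
  "ladder J p * tensor_coeff J l \<alpha> (p + 1) q - ladder J (q - 1) * tensor_coeff J l \<alpha> p (q - 1)
    = - ladder (2 * l) \<alpha> * tensor_coeff J l (\<alpha> + 1) p q"
proof -
  let ?X = "threej (2 * l) J J"
  have "ladder J p * ?X \<alpha> (p + 1) (int J - q) + ladder J (q - 1) * ?X \<alpha> p (int J - (q - 1))
    = - ladder (2 * l) \<alpha> * ?X (\<alpha> + 1) p (int J - q)"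
    using invariant3_raise[OF invariant3_threej[of "2 * l" J J], of \<alpha> p "int J - q"]
      ladder_reflect[of J q] by (simp add: algebra_simps)
  moreover have "psign (q - 1) = - psign q" by (simp add: psign_def)
  ultimately show ?thesis unfolding tensor_coeff_def by algebra
qed

lemma sum_reflect: "(\<Sum>p\<in>{0..int J}. f (int J - p)) = (\<Sum>p\<in>{0..int J}. f p)"
  by (rule sum.reindex_bij_witness[of _ "\<lambda>p. int J - p" "\<lambda>p. int J - p"]) auto

lemma tensor_coeff_orthonormal:
  assumes "l \<le> J" "l' \<le> J" "\<alpha> \<in> {0..2 * int l}"
  shows "(\<Sum>p\<in>{0..int J}. \<Sum>q\<in>{0..int J}. tensor_coeff J l \<alpha> p q * tensor_coeff J l' \<beta> p q)
    = (if l = l' \<and> \<alpha> = \<beta> then 1 else 0)"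
proof -
  let ?X = "\<lambda>l. threej J J (2 * l)" and ?s = "\<lambda>l. sqrt (2 * real l + 1)"
  have X: "threej (2 * l) J J \<alpha> p q = ?X l p q \<alpha>" for l \<alpha> p q by (rule threej_cycle[symmetric])
  have "(\<Sum>p\<in>{0..int J}. \<Sum>q\<in>{0..int J}. tensor_coeff J l \<alpha> p q * tensor_coeff J l' \<beta> p q)
    = (\<Sum>p\<in>{0..int J}. \<Sum>q\<in>{0..int J}. ?s l * ?s l' * (?X l p (int J - q) \<alpha> * ?X l' p (int J - q) \<beta>))"
    by (intro sum.cong refl) (simp only: tensor_coeff_def X, simp add: mult_ac)
  also have "\<dots> = ?s l * ?s l' * overlap J J (?X l) (?X l') \<alpha> \<beta>"
    unfolding overlap_def sum_distrib_left
    by (intro sum.cong refl sum_reflect[where f = "\<lambda>q. ?s l * ?s l' * (?X l p q \<alpha> * ?X l' p q \<beta>)" for p])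
  also have "overlap J J (?X l) (?X l') \<alpha> \<beta> = (if 2 * l = 2 * l' \<and> \<alpha> = \<beta> \<and> \<alpha> \<in> {0..int (2 * l)} then 1 / (real (2 * l) + 1) else 0)"
    by (rule overlap_threej) (use assms in \<open>auto simp: triad_def\<close>)
  finally show ?thesis using assms(3) by (auto simp: add_nonneg_pos)
qed

text \<open>
  An anti-automorphism reverses products; its diagonal signs occur twice each and cancel in the trace.
\<close>
lemma triple_trace_reverse:
  "triple_trace J l k' k \<alpha> \<gamma> \<beta> = psign (int (l + k + k')) * triple_trace J l k k' \<alpha> \<beta> \<gamma>"
proof -
  let ?I = "{0..int J}" and ?t = "tensor_coeff J"
  have reflect3: "(\<Sum>p\<in>?I. \<Sum>q\<in>?I. \<Sum>r\<in>?I. f p q r)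
      = (\<Sum>p\<in>?I. \<Sum>q\<in>?I. \<Sum>r\<in>?I. f (int J - p) (int J - q) (int J - r))" for f :: "int \<Rightarrow> int \<Rightarrow> int \<Rightarrow> real"
    unfolding sum_reflect[where f = "\<lambda>r. f (int J - p) (int J - q) r" for p q]
      sum_reflect[where f = "\<lambda>q. \<Sum>r\<in>?I. f (int J - p) q r" for p]
      sum_reflect[where f = "\<lambda>p. \<Sum>q\<in>?I. \<Sum>r\<in>?I. f p q r"] ..
  have "triple_trace J l k' k \<alpha> \<gamma> \<beta> = (\<Sum>p\<in>?I. \<Sum>q\<in>?I. \<Sum>r\<in>?I.
      ?t l \<alpha> (int J - p) (int J - q) * ?t k' \<gamma> (int J - q) (int J - r) * ?t k \<beta> (int J - r) (int J - p))"
    unfolding triple_trace_def by (rule reflect3)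
  also have "\<dots> = (\<Sum>p\<in>?I. \<Sum>q\<in>?I. \<Sum>r\<in>?I. psign (int (l + k + k')) * (?t l \<alpha> q p * ?t k \<beta> p r * ?t k' \<gamma> r q))"
    by (intro sum.cong refl) (simp add: tensor_coeff_flip psign_add mult_ac)
  also have "\<dots> = psign (int (l + k + k')) * triple_trace J l k k' \<alpha> \<beta> \<gamma>"
    unfolding triple_trace_def sum_distrib_left by (rule sum.swap)
  finally show ?thesis .
qed

text \<open>
  An irreducible representation with a chosen weight basis; the spin is \<open>J/2\<close> and the dimension \<open>J + 1\<close>.
\<close>
locale spin_representation =
  fixes S :: "3 \<Rightarrow> complex^'n^'n" and J :: nat and e :: "int \<Rightarrow> complex^'n"
  assumes irrep: "so3_irrep S" and card_n: "CARD('n) = J + 1" and basis: "weight_basis S J e"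
begin

definition basis_op :: "(int \<Rightarrow> int \<Rightarrow> real) \<Rightarrow> complex^'n^'n"
  where "basis_op t = (\<Sum>p\<in>{0..int J}. \<Sum>q\<in>{0..int J}. cscale (of_real (t p q)) (outer (e p) (e q)))"

definition T :: "nat \<Rightarrow> int \<Rightarrow> complex^'n^'n"
  where "T l \<alpha> = basis_op (tensor_coeff J l \<alpha>)"

lemma e_orth: "p \<in> {0..int J} \<Longrightarrow> q \<in> {0..int J} \<Longrightarrow> cinner (e p) (e q) = (if p = q then 1 else 0)"
  using basis by (simp add: weight_basis_def)

lemma e_action:
  assumes "p \<in> {0..int J}"
  shows "spin3 S *v e p = (of_int p - real J / 2) *\<^sub>R e p" "spin_up S *v e p = ladder J p *\<^sub>R e (p + 1)"
   "spin_down S *v e p = ladder J (p - 1) *\<^sub>R e (p - 1)"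
  using basis assms by (auto simp: weight_basis_def)

lemma basis_op_scale: "cscale (of_real c) (basis_op t) = basis_op (\<lambda>p q. c * t p q)"
  by (simp add: basis_op_def cscale_sum)

lemma basis_op_diff: "basis_op s - basis_op t = basis_op (\<lambda>p q. s p q - t p q)"
  by (simp add: basis_op_def sum_subtractf[symmetric] cscale_distrib)

lemma matrix_mult_sum: "A ** (\<Sum>i\<in>I. f i) = (\<Sum>i\<in>I. A ** f i)" "(\<Sum>i\<in>I. f i) ** A = (\<Sum>i\<in>I. f i ** A)"
  for A :: "complex^'n^'n"
  by (induction I rule: infinite_finite_induct) (simp_all add: matrix_mult_distrib)

lemma basis_op_mult: "basis_op s ** basis_op t = basis_op (\<lambda>p r. \<Sum>q\<in>{0..int J}. s p q * t q r)"
proof -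
  let ?I = "{0..int J}"
  have "basis_op s ** basis_op t = (\<Sum>p\<in>?I. \<Sum>q\<in>?I. \<Sum>q'\<in>?I. \<Sum>r\<in>?I.
      cscale (of_real (s p q * t q' r)) (outer (e p) (e q) ** outer (e q') (e r)))"
    unfolding basis_op_def matrix_mult_sum(2) unfolding matrix_mult_sum(1) by (simp add: cscale_mult mult_ac)
  also have "\<dots> = (\<Sum>p\<in>?I. \<Sum>q\<in>?I. \<Sum>q'\<in>?I. if q' = q then \<Sum>r\<in>?I.
      cscale (of_real (s p q * t q r)) (outer (e p) (e r)) else 0)"
    by (intro sum.cong refl) (auto simp: outer_outer e_orth intro!: sum.neutral)
  also have "\<dots> = (\<Sum>p\<in>?I. \<Sum>q\<in>?I. \<Sum>r\<in>?I. cscale (of_real (s p q * t q r)) (outer (e p) (e r)))"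
    by (rule sum.cong[OF refl], rule sum.cong[OF refl]) simp
  also have "\<dots> = (\<Sum>p\<in>?I. \<Sum>r\<in>?I. \<Sum>q\<in>?I. cscale (of_real (s p q * t q r)) (outer (e p) (e r)))"
    by (intro sum.cong refl sum.swap)
  finally show ?thesis by (simp add: basis_op_def cscale_sum_left)
qed

lemma trace_op: "trace (basis_op t) = of_real (\<Sum>p\<in>{0..int J}. t p p)"
proof -
  have "trace (basis_op t) = (\<Sum>p\<in>{0..int J}. \<Sum>q\<in>{0..int J}. if q = p then of_real (t p p) else 0)"
    unfolding basis_op_def trace_sum by (intro sum.cong refl) (auto simp: trace_outer e_orth)
  then show ?thesis by simp
qed

lemma conj_transpose_sum: "conj_transpose (\<Sum>i\<in>I. f i) = (\<Sum>i\<in>I. conj_transpose (f i :: complex^'n^'n))"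
  by (induction I rule: infinite_finite_induct) simp_all

lemma conj_transpose_op: "conj_transpose (basis_op t) = basis_op (\<lambda>p q. t q p)"
  unfolding basis_op_def conj_transpose_sum by (subst sum.swap) (simp add: conj_transpose_outer)

lemma mat_inner_op: "mat_inner (basis_op s) (basis_op t) = of_real (\<Sum>p\<in>{0..int J}. \<Sum>q\<in>{0..int J}. s p q * t p q)"
  unfolding mat_inner_def conj_transpose_op basis_op_mult trace_op by (subst sum.swap) (rule refl)

lemma commutator_spin_op:
  "commutator (spin3 S) (basis_op t) = basis_op (\<lambda>p q. of_int (p - q) * t p q)"
  "commutator (spin_up S) (basis_op t) = basis_op (\<lambda>p q. ladder J (p - 1) * t (p - 1) q - ladder J q * t p (q + 1))"
  "commutator (spin_down S) (basis_op t) = basis_op (\<lambda>p q. ladder J p * t (p + 1) q - ladder J (q - 1) * t p (q - 1))"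
proof -
  let ?I = "{0..int J}" and ?E = "\<lambda>p q. outer (e p) (e q)"
  note ct = conj_transpose_spin[OF irrep]
  show "commutator (spin3 S) (basis_op t) = basis_op (\<lambda>p q. of_int (p - q) * t p q)"
    unfolding basis_op_def commutator_sum
    by (intro sum.cong refl) (simp add: commutator_def cscale_mult matrix_outer ct e_action outer_simps,
      simp add: cscale_distrib(5)[symmetric] algebra_simps)
  have "spin_up S ** basis_op t = (\<Sum>q\<in>?I. \<Sum>p\<in>?I. cscale (of_real (ladder J p * t p q)) (?E (p + 1) q))"
    unfolding basis_op_def matrix_mult_sum
    by (subst sum.swap) (simp add: cscale_mult matrix_outer e_action outer_simps mult_ac)
  also have "\<dots> = (\<Sum>q\<in>?I. \<Sum>p\<in>?I. cscale (of_real (ladder J (p - 1) * t (p - 1) q)) (?E p q))"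
    by (rule sum.cong[OF refl]) (use sum_shift[of "\<lambda>p. cscale (of_real (ladder J p * t p x)) (?E (p + 1) x)" J for x] in simp)
  finally have 1: "spin_up S ** basis_op t = basis_op (\<lambda>p q. ladder J (p - 1) * t (p - 1) q)"
    unfolding basis_op_def by (subst sum.swap)
  have "basis_op t ** spin_up S = (\<Sum>p\<in>?I. \<Sum>q\<in>?I. cscale (of_real (ladder J (q - 1) * t p q)) (?E p (q - 1)))"
    unfolding basis_op_def matrix_mult_sum
    by (simp add: cscale_mult matrix_outer ct e_action outer_simps mult_ac)
  also have "\<dots> = (\<Sum>p\<in>?I. \<Sum>q\<in>?I. cscale (of_real (ladder J q * t p (q + 1))) (?E p q))"
    by (rule sum.cong[OF refl]) (use sum_shift[of "\<lambda>q. cscale (of_real (ladder J q * t x (q + 1))) (?E x q)" J for x] in simp)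
  finally have 2: "basis_op t ** spin_up S = basis_op (\<lambda>p q. ladder J q * t p (q + 1))" unfolding basis_op_def .
  show "commutator (spin_up S) (basis_op t) = basis_op (\<lambda>p q. ladder J (p - 1) * t (p - 1) q - ladder J q * t p (q + 1))"
    unfolding commutator_def 1 2 basis_op_diff ..
  have "spin_down S ** basis_op t = (\<Sum>q\<in>?I. \<Sum>p\<in>?I. cscale (of_real (ladder J (p - 1) * t p q)) (?E (p - 1) q))"
    unfolding basis_op_def matrix_mult_sum
    by (subst sum.swap) (simp add: cscale_mult matrix_outer e_action outer_simps mult_ac)
  also have "\<dots> = (\<Sum>q\<in>?I. \<Sum>p\<in>?I. cscale (of_real (ladder J p * t (p + 1) q)) (?E p q))"
    by (rule sum.cong[OF refl]) (use sum_shift[of "\<lambda>p. cscale (of_real (ladder J p * t (p + 1) x)) (?E p x)" J for x] in simp)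
  finally have 1: "spin_down S ** basis_op t = basis_op (\<lambda>p q. ladder J p * t (p + 1) q)"
    unfolding basis_op_def by (subst sum.swap)
  have "basis_op t ** spin_down S = (\<Sum>p\<in>?I. \<Sum>q\<in>?I. cscale (of_real (ladder J q * t p q)) (?E p (q + 1)))"
    unfolding basis_op_def matrix_mult_sum
    by (simp add: cscale_mult matrix_outer ct e_action outer_simps mult_ac)
  also have "\<dots> = (\<Sum>p\<in>?I. \<Sum>q\<in>?I. cscale (of_real (ladder J (q - 1) * t p (q - 1))) (?E p q))"
    by (rule sum.cong[OF refl]) (use sum_shift[of "\<lambda>q. cscale (of_real (ladder J q * t x q)) (?E x (q + 1))" J for x] in simp)
  finally have 2: "basis_op t ** spin_down S = basis_op (\<lambda>p q. ladder J (q - 1) * t p (q - 1))" unfolding basis_op_def .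
  show "commutator (spin_down S) (basis_op t) = basis_op (\<lambda>p q. ladder J p * t (p + 1) q - ladder J (q - 1) * t p (q - 1))"
    unfolding commutator_def 1 2 basis_op_diff ..
qed

lemma commutator_spin_T:
  "commutator (spin3 S) (T l \<alpha>) = cscale (of_real (of_int (int l - \<alpha>))) (T l \<alpha>)"
  "commutator (spin_up S) (T l \<alpha>) = cscale (of_real (- ladder (2 * l) (\<alpha> - 1))) (T l (\<alpha> - 1))"
  "commutator (spin_down S) (T l \<alpha>) = cscale (of_real (- ladder (2 * l) \<alpha>)) (T l (\<alpha> + 1))"
proof -
  have "of_int (p - q) * tensor_coeff J l \<alpha> p q = of_int (int l - \<alpha>) * tensor_coeff J l \<alpha> p q" for p q
    using tensor_coeff_support(2)[of J l \<alpha> p q] by (cases "tensor_coeff J l \<alpha> p q = 0") auto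
  then show "commutator (spin3 S) (T l \<alpha>) = cscale (of_real (of_int (int l - \<alpha>))) (T l \<alpha>)"
    unfolding T_def commutator_spin_op basis_op_scale by (simp only:)
qed (simp_all only: T_def commutator_spin_op basis_op_scale tensor_coeff_lower tensor_coeff_raise)

lemma S_eq: "S 1 = cscale (- \<i> / 2) (spin_up S + spin_down S)" "S 2 = cscale (1 / 2) (spin_down S - spin_up S)"
    "S 3 = cscale (- \<i>) (spin3 S)"
  by (simp_all add: spin_up_def spin_down_def spin3_def vec_eq_iff algebra_simps)

lemma laplacian_eq:
  "laplacian S u = - (cscale (1 / 2) (commutator (spin_up S) (commutator (spin_down S) u)
     + commutator (spin_down S) (commutator (spin_up S) u)) + commutator (spin3 S) (commutator (spin3 S) u))"
  unfolding laplacian_def sum_3 unfolding S_eq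
  by (simp add: cscale_distrib) (simp add: vec_eq_iff)

text \<open>
  The Casimir operator in terms of the ladder operators: half of the two squared ladder coefficients plus \<open>m\<^sup>2\<close> is
  \<open>l (l + 1)\<close>.
\<close>
lemma laplacian_T:
  assumes "\<alpha> \<in> {0..2 * int l}"
  shows "laplacian S (T l \<alpha>) = cscale (- of_real (eigval l)) (T l \<alpha>)"
proof -
  have "laplacian S (T l \<alpha>) = cscale (- of_real (1 / 2 * ((ladder (2 * l) \<alpha>)\<^sup>2 + (ladder (2 * l) (\<alpha> - 1))\<^sup>2)
      + (of_int (int l - \<alpha>))\<^sup>2)) (T l \<alpha>)"
    unfolding laplacian_eq
    by (simp add: commutator_spin_T) (simp add: vec_eq_iff power2_eq_square algebra_simps)
  also have "1 / 2 * ((ladder (2 * l) \<alpha>)\<^sup>2 + (ladder (2 * l) (\<alpha> - 1))\<^sup>2) + (of_int (int l - \<alpha>))\<^sup>2 = eigval l"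
  proof -
    have "(ladder (2 * l) \<alpha>)\<^sup>2 = of_int ((2 * int l - \<alpha>) * (\<alpha> + 1))"
      "(ladder (2 * l) (\<alpha> - 1))\<^sup>2 = of_int ((2 * int l - \<alpha> + 1) * \<alpha>)"
      using ladder_square[of \<alpha> "2 * l"] ladder_square[of "\<alpha> - 1" "2 * l"] assms by simp_all
    then show ?thesis by (simp add: eigval_def power2_eq_square algebra_simps)
  qed
  finally show ?thesis .
qed

lemma conj_transpose_T: "conj_transpose (T l \<alpha>) = cscale (of_real (psign (\<alpha> - int l))) (T l (2 * int l - \<alpha>))"
  unfolding T_def conj_transpose_op basis_op_scale by (simp add: tensor_coeff_transpose)

lemma T_orthonormal:
  assumes "l \<le> J" "l' \<le> J" "\<alpha> \<in> {0..2 * int l}"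
  shows "mat_inner (T l \<alpha>) (T l' \<beta>) = (if l = l' \<and> \<alpha> = \<beta> then 1 else 0)"
  unfolding T_def mat_inner_op tensor_coeff_orthonormal[OF assms] by simp

lemma trace_T3: "trace (T l \<alpha> ** T k \<beta> ** T k' \<gamma>) = of_real (triple_trace J l k k' \<alpha> \<beta> \<gamma>)"
proof -
  have "(\<Sum>p\<in>{0..int J}. \<Sum>r\<in>{0..int J}. (\<Sum>q\<in>{0..int J}. tensor_coeff J l \<alpha> p q * tensor_coeff J k \<beta> q r)
      * tensor_coeff J k' \<gamma> r p) = triple_trace J l k k' \<alpha> \<beta> \<gamma>"
    unfolding triple_trace_def sum_distrib_right by (intro sum.cong refl sum.swap)
  then show ?thesis unfolding T_def basis_op_mult trace_op by simp
qed

text \<open>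
  The trace of a commutator vanishes; expanding the commutator of a ladder operator with a product of three
  tensors by the product rule gives the two ladder relations.
\<close>
lemma invariant3_triple_trace: "invariant3 (2 * l) (2 * k) (2 * k') (triple_trace J l k k')"
proof -
  let ?F = "triple_trace J l k k'"
  have supp: "\<alpha> \<in> {0..int (2 * l)} \<and> \<beta> \<in> {0..int (2 * k)} \<and> \<gamma> \<in> {0..int (2 * k')} \<and>
      2 * (\<alpha> + \<beta> + \<gamma>) = int (2 * l + 2 * k + 2 * k')" if "?F \<alpha> \<beta> \<gamma> \<noteq> 0" for \<alpha> \<beta> \<gamma>
  proof -
    from that obtain p q r where "tensor_coeff J l \<alpha> p q * tensor_coeff J k \<beta> q r * tensor_coeff J k' \<gamma> r p \<noteq> 0"
      unfolding triple_trace_def by (metis (no_types, lifting) sum.neutral)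
    then have "tensor_coeff J l \<alpha> p q \<noteq> 0" "tensor_coeff J k \<beta> q r \<noteq> 0" "tensor_coeff J k' \<gamma> r p \<noteq> 0" by auto
    from tensor_coeff_support[OF this(1)] tensor_coeff_support[OF this(2)] tensor_coeff_support[OF this(3)]
    show ?thesis by auto
  qed
  have tr: "trace (commutator A (X ** Y ** Z)) = trace (commutator A X ** Y ** Z) + trace (X ** commutator A Y ** Z)
      + trace (X ** Y ** commutator A Z)" for A X Y Z :: "complex^'n^'n"
    by (simp only: commutator_mult matrix_mult_distrib trace_add)
  have "of_real (ladder (2 * l) (\<alpha> - 1) * ?F (\<alpha> - 1) \<beta> \<gamma> + ladder (2 * k) (\<beta> - 1) * ?F \<alpha> (\<beta> - 1) \<gamma>
      + ladder (2 * k') (\<gamma> - 1) * ?F \<alpha> \<beta> (\<gamma> - 1)) = (0 :: complex)" for \<alpha> \<beta> \<gamma>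
    using tr[of "spin_up S" "T l \<alpha>" "T k \<beta>" "T k' \<gamma>"]
    by (simp add: commutator_spin_T cscale_mult trace_T3 algebra_simps add_eq_0_iff)
  moreover have "of_real (ladder (2 * l) \<alpha> * ?F (\<alpha> + 1) \<beta> \<gamma> + ladder (2 * k) \<beta> * ?F \<alpha> (\<beta> + 1) \<gamma>
      + ladder (2 * k') \<gamma> * ?F \<alpha> \<beta> (\<gamma> + 1)) = (0 :: complex)" for \<alpha> \<beta> \<gamma>
    using tr[of "spin_down S" "T l \<alpha>" "T k \<beta>" "T k' \<gamma>"]
    by (simp add: commutator_spin_T cscale_mult trace_T3 algebra_simps add_eq_0_iff)
  ultimately show ?thesis
    unfolding invariant3_def of_real_eq_0_iff using supp by blast
qed

lemma trace_T_commutator: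
  "trace (T l \<alpha> ** commutator (T k \<beta>) (T k' \<gamma>)) = of_real ((1 - psign (int (l + k + k'))) *
    (sqrt (2 * real l + 1) * sqrt (2 * real k + 1) * sqrt (2 * real k' + 1)
      * wigner6j (2 * l) (2 * k) (2 * k') J J J * threej (2 * l) (2 * k) (2 * k') \<alpha> \<beta> \<gamma>))"
proof -
  have "trace (T l \<alpha> ** commutator (T k \<beta>) (T k' \<gamma>))
    = trace (T l \<alpha> ** T k \<beta> ** T k' \<gamma>) - trace (T l \<alpha> ** T k' \<gamma> ** T k \<beta>)"
    by (simp add: commutator_def matrix_mult_distrib trace_sub matrix_mul_assoc)
  also have "\<dots> = of_real ((1 - psign (int (l + k + k'))) * triple_trace J l k k' \<alpha> \<beta> \<gamma>)"
    unfolding trace_T3 triple_trace_reverse[of J l k' k \<alpha> \<gamma> \<beta>] by (simp add: left_diff_distrib)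
  finally show ?thesis unfolding triple_trace_eq[OF invariant3_triple_trace] .
qed

text \<open>
  The tensors and their multiples by \<open>\<i>\<close> are orthonormal for the real inner product, and there are
  \<open>2 \<Sum> l\<le>J. (2 l + 1) = 2 (J + 1)\<^sup>2\<close> of them, the real dimension of the space of matrices.
\<close>
lemma T_expansion:
  "X = (\<Sum>(l, \<alpha>)\<in>Sigma {0..J} (\<lambda>l. {0..2 * int l}). cscale (mat_inner (T l \<alpha>) X) (T l \<alpha>))"
proof -
  let ?I = "Sigma {0..J} (\<lambda>l. {0..2 * int l})"
  define f where "f = (\<lambda>(b, l, \<alpha>). cscale (if b then \<i> else 1) (T l \<alpha>))"
  have card: "card (UNIV \<times> ?I :: (bool \<times> nat \<times> int) set) = DIM(complex^'n^'n)"
  proof -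
    have "(\<Sum>l\<in>{0..J}. nat (2 * int l + 1)) = (J + 1) * (J + 1)"
      by (induction J) (simp_all add: nat_add_distrib nat_mult_distrib)
    then show ?thesis by (simp add: card_cartesian_product card_n)
  qed
  have orth: "f j \<bullet> f k = (if j = k then 1 else 0)" if "j \<in> UNIV \<times> ?I" "k \<in> UNIV \<times> ?I" for j k
  proof -
    obtain b l \<alpha> b' l' \<alpha>' where jk: "j = (b, l, \<alpha>)" "k = (b', l', \<alpha>')" by (metis prod_cases3)
    have "mat_inner (T l \<alpha>) (T l' \<alpha>') = (if l = l' \<and> \<alpha> = \<alpha>' then 1 else 0)"
      using that jk by (intro T_orthonormal) auto
    then show ?thesis unfolding Re_mat_inner[symmetric] jk f_def by auto
  qed
  have i: "mat_inner (cscale \<i> (T l \<alpha>)) X = - \<i> * mat_inner (T l \<alpha>) X" for l \<alpha> by simp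
  have "X = (\<Sum>k\<in>UNIV \<times> ?I. (f k \<bullet> X) *\<^sub>R f k)"
    by (rule orthonormal_family_expansion[OF _ card orth]) auto
  also have "\<dots> = (\<Sum>i\<in>?I. \<Sum>b\<in>UNIV. (f (b, i) \<bullet> X) *\<^sub>R f (b, i))"
    by (subst sum.swap) (simp add: sum.cartesian_product')
  also have "\<dots> = (\<Sum>(l, \<alpha>)\<in>?I. cscale (mat_inner (T l \<alpha>) X) (T l \<alpha>))"
  proof (intro sum.cong refl)
    fix i assume "i \<in> ?I"
    obtain l \<alpha> where "i = (l, \<alpha>)" by (cases i)
    then show "(\<Sum>b\<in>UNIV. (f (b, i) \<bullet> X) *\<^sub>R f (b, i)) = (case i of (l, \<alpha>) \<Rightarrow> cscale (mat_inner (T l \<alpha>) X) (T l \<alpha>))"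
      by (simp add: UNIV_bool f_def Re_mat_inner[symmetric] scaleR_eq_cscale cscale_distrib(4)[symmetric]
        complex_eq_iff[symmetric]) (metis complex_eq mult.commute)
  qed
  finally show ?thesis .
qed

end

section \<open>The trace over su(N)\<close>

lemma su_iff: "X \<in> su \<longleftrightarrow> conj_transpose X = - X \<and> trace X = 0"
  by (simp add: su_def)

lemma su_closed:
  "X \<in> su \<Longrightarrow> Y \<in> su \<Longrightarrow> X + Y \<in> su" "X \<in> su \<Longrightarrow> Y \<in> su \<Longrightarrow> X - Y \<in> su" "X \<in> su \<Longrightarrow> - X \<in> su"
  "X \<in> su \<Longrightarrow> cscale (of_real r) X \<in> su" "0 \<in> su" "X \<in> su \<Longrightarrow> Y \<in> su \<Longrightarrow> commutator X Y \<in> su"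
  by (simp_all add: su_iff trace_add trace_sub cscale_distrib)
     (simp add: commutator_def conj_transpose_mult matrix_mult_minus)

lemma subspace_su: "subspace su"
  by (simp add: subspace_def su_closed scaleR_eq_cscale)

lemma zeitlin_metric_eq: "zeitlin_metric S u v = (u \<bullet> (- laplacian S v)) / real CARD('n)"
  for S :: "3 \<Rightarrow> complex^'n^'n"
  unfolding zeitlin_metric_def mat_inner_def[symmetric] Re_mat_inner ..

definition skew_part :: "complex^'n^'n \<Rightarrow> complex^'n^'n"
  where "skew_part X = cscale (1 / 2) (X - conj_transpose X)"

lemma skew_part_su: "trace X = 0 \<Longrightarrow> skew_part X \<in> su"
  by (simp add: su_iff skew_part_def trace_sub trace_conj_transpose cscale_distrib)

lemma skew_part_of_su: "X \<in> su \<Longrightarrow> skew_part X = X"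
  by (simp add: su_iff skew_part_def vec_eq_iff)

lemma skew_part_decompose: "X = skew_part X + cscale \<i> (skew_part (cscale (- \<i>) X))"
  by (simp add: skew_part_def vec_eq_iff algebra_simps)

lemma skew_part_add: "skew_part (X + Y) = skew_part X + skew_part Y"
  by (simp add: skew_part_def vec_eq_iff algebra_simps)

lemma skew_part_sum: "skew_part (\<Sum>i\<in>I. f i) = (\<Sum>i\<in>I. skew_part (f i))"
proof -
  have "skew_part 0 = 0" by (simp add: skew_part_def)
  then show ?thesis by (induction I rule: infinite_finite_induct) (simp_all add: skew_part_add)
qed

lemma skew_part_cscale:
  "skew_part (cscale z X) = Re z *\<^sub>R skew_part X - Im z *\<^sub>R skew_part (cscale (- \<i>) X)"
  by (simp add: skew_part_def vec_eq_iff complex_eq_iff field_simps)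

text \<open>
  Linearity over the complex numbers, which act on matrices by \<open>cscale\<close>.
\<close>
definition clinear :: "(complex^'n^'n \<Rightarrow> complex^'n^'n) \<Rightarrow> bool"
  where "clinear L \<longleftrightarrow> (\<forall>X Y. L (X + Y) = L X + L Y) \<and> (\<forall>z X. L (cscale z X) = cscale z (L X))"

lemma clinearD:
  assumes "clinear L"
  shows "L (X + Y) = L X + L Y" "L (cscale z X) = cscale z (L X)" "L (- X) = - L X"
    "L (X - Y) = L X - L Y" "L 0 = 0" "L (r *\<^sub>R X) = r *\<^sub>R L X"
proof -
  show a: "L (X + Y) = L X + L Y" and s: "L (cscale z X) = cscale z (L X)" for X Y z
    using assms by (auto simp: clinear_def)
  show m: "L (- X) = - L X" for X using s[of "-1" X] by (simp add: cscale_distrib)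
  show "L (X - Y) = L X - L Y" using a[of X "- Y"] m by simp
  show "L 0 = 0" using s[of 0 0] by simp
  show "L (r *\<^sub>R X) = r *\<^sub>R L X" unfolding scaleR_eq_cscale by (rule s)
qed

lemma clinear_sum: "clinear L \<Longrightarrow> L (\<Sum>i\<in>I. f i) = (\<Sum>i\<in>I. L (f i))"
  by (induction I rule: infinite_finite_induct) (simp_all add: clinearD)

text \<open>
  sl(N) is the complexification of su(N), so the trace of a real-linear map of su(N) is the trace of its
  complex-linear extension \<open>L\<close>, and that may be computed in a complex orthonormal basis of sl(N). In detail: a real basis \<open>B\<close> of su(N)
  has coordinates that extend to sl(N) through the decomposition of a matrix into a skew-Hermitian and a Hermitian part.
\<close>
lemma trace_on_su:
  fixes \<tau> :: "'i \<Rightarrow> complex^'n^'n"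
  assumes lin: "clinear L" and maps: "\<And>X. X \<in> su \<Longrightarrow> L X \<in> su" and eq: "\<And>X. X \<in> su \<Longrightarrow> f X = L X"
    and fin: "finite I" and tr: "\<And>i. i \<in> I \<Longrightarrow> trace (\<tau> i) = 0"
    and expand: "\<And>X. X \<in> su \<Longrightarrow> X = (\<Sum>i\<in>I. cscale (mat_inner (\<tau> i) X) (\<tau> i))"
  shows "trace_on su f = Re (\<Sum>i\<in>I. mat_inner (\<tau> i) (L (\<tau> i)))"
proof -
  define B :: "(complex^'n^'n) set" where "B = (SOME B. independent B \<and> span B = su)"
  have "\<exists>B :: (complex^'n^'n) set. independent B \<and> span B = su"
  proof -
    obtain B :: "(complex^'n^'n) set" where "B \<subseteq> su" "independent B" "su \<subseteq> span B"
      using basis_exists[of su] by metis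
    moreover have "span B \<subseteq> su" using \<open>B \<subseteq> su\<close> subspace_su by (rule span_minimal)
    ultimately show ?thesis by blast
  qed
  from someI_ex[OF this] have indep: "independent B" and span: "span B = su"
    unfolding B_def[symmetric] by auto
  have finB: "finite B" using indep by (rule independent_imp_finite)
  have Bsu: "b \<in> su" if "b \<in> B" for b using that span span_base by blast
  let ?r = "representation B"
  define s1 s2 where "s1 i = L (skew_part (\<tau> i))" and "s2 i = L (skew_part (cscale (- \<i>) (\<tau> i)))" for i
  have su12: "s1 i \<in> su" "s2 i \<in> su" if "i \<in> I" for i
    using tr[OF that] unfolding s1_def s2_def by (auto intro!: maps skew_part_su)
  have diag: "?r (f b) b = (\<Sum>i\<in>I. Re (mat_inner (\<tau> i) b) * ?r (s1 i) b - Im (mat_inner (\<tau> i) b) * ?r (s2 i) b)"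
    if b: "b \<in> B" for b
  proof -
    let ?z = "\<lambda>i. mat_inner (\<tau> i) b"
    have "b = skew_part (\<Sum>i\<in>I. cscale (?z i) (\<tau> i))"
      using skew_part_of_su[OF Bsu[OF b]] by (simp only: expand[OF Bsu[OF b], symmetric])
    also have "\<dots> = (\<Sum>i\<in>I. Re (?z i) *\<^sub>R skew_part (\<tau> i) - Im (?z i) *\<^sub>R skew_part (cscale (- \<i>) (\<tau> i)))"
      unfolding skew_part_sum by (rule sum.cong[OF refl skew_part_cscale])
    finally have "L b = L (\<Sum>i\<in>I. Re (?z i) *\<^sub>R skew_part (\<tau> i) - Im (?z i) *\<^sub>R skew_part (cscale (- \<i>) (\<tau> i)))"
      by (rule arg_cong)
    also have "\<dots> = (\<Sum>i\<in>I. Re (?z i) *\<^sub>R s1 i - Im (?z i) *\<^sub>R s2 i)"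
      unfolding clinear_sum[OF lin] clinearD[OF lin] s1_def s2_def ..
    finally have "f b = (\<Sum>i\<in>I. Re (?z i) *\<^sub>R s1 i - Im (?z i) *\<^sub>R s2 i)"
      unfolding eq[OF Bsu[OF b]] .
    moreover have "?r (\<Sum>i\<in>I. Re (?z i) *\<^sub>R s1 i - Im (?z i) *\<^sub>R s2 i) b
      = (\<Sum>i\<in>I. ?r (Re (?z i) *\<^sub>R s1 i - Im (?z i) *\<^sub>R s2 i) b)"
      using su12 by (subst representation_sum[OF indep]) (auto simp: span su_closed scaleR_eq_cscale)
    moreover have "?r (x *\<^sub>R s1 i - y *\<^sub>R s2 i) b = x * ?r (s1 i) b - y * ?r (s2 i) b" if "i \<in> I" for i x y
      using su12[OF that]
      by (subst representation_diff[OF indep]) (auto simp: span su_closed scaleR_eq_cscale[symmetric]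
        representation_scale[OF indep] subspace_scale[OF subspace_su])
    ultimately show ?thesis by simp
  qed
  have exp: "mat_inner (\<tau> i) X = (\<Sum>b\<in>B. of_real (?r X b) * mat_inner (\<tau> i) b)" if "X \<in> su" for X i
  proof -
    have "X = (\<Sum>b\<in>B. ?r X b *\<^sub>R b)"
      by (rule sum_representation_eq[symmetric]) (use that indep span finB in auto)
    then have "mat_inner (\<tau> i) X = mat_inner (\<tau> i) (\<Sum>b\<in>B. ?r X b *\<^sub>R b)" by (rule arg_cong)
    also have "\<dots> = (\<Sum>b\<in>B. of_real (?r X b) * mat_inner (\<tau> i) b)"
      by (simp add: mat_inner_sum_right scaleR_eq_cscale)
    finally show ?thesis .
  qed
  have "Re (mat_inner (\<tau> i) (L (\<tau> i)))
    = (\<Sum>b\<in>B. Re (mat_inner (\<tau> i) b) * ?r (s1 i) b - Im (mat_inner (\<tau> i) b) * ?r (s2 i) b)" if i: "i \<in> I" for i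
  proof -
    have "L (\<tau> i) = s1 i + cscale \<i> (s2 i)"
      unfolding s1_def s2_def clinearD(1,2)[OF lin, symmetric] skew_part_decompose[symmetric] ..
    then have "mat_inner (\<tau> i) (L (\<tau> i)) = mat_inner (\<tau> i) (s1 i) + \<i> * mat_inner (\<tau> i) (s2 i)" by simp
    then show ?thesis
      unfolding exp[OF su12(1)[OF i]] exp[OF su12(2)[OF i]]
      by (simp add: sum_subtractf mult.commute)
  qed
  then have "Re (\<Sum>i\<in>I. mat_inner (\<tau> i) (L (\<tau> i)))
    = (\<Sum>i\<in>I. \<Sum>b\<in>B. Re (mat_inner (\<tau> i) b) * ?r (s1 i) b - Im (mat_inner (\<tau> i) b) * ?r (s2 i) b)"
    by simp
  also have "\<dots> = (\<Sum>b\<in>B. ?r (f b) b)"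
    by (subst sum.swap) (simp add: diag)
  finally show ?thesis unfolding trace_on_def Let_def B_def by simp
qed

section \<open>The Ricci tensor in the tensor basis\<close>

lemma eigval_pos: "l \<ge> 1 \<Longrightarrow> eigval l > 0"
  by (simp add: eigval_def)

lemma eigval_inject: "eigval l = eigval k \<longleftrightarrow> l = k"
proof
  assume "eigval l = eigval k"
  then have "(real l - real k) * (real l + real k + 1) = 0" by (simp add: eigval_def algebra_simps)
  moreover have "real l + real k + 1 \<noteq> 0" by (smt (verit) of_nat_0_le_iff)
  ultimately show "l = k" by simp
qed simp

lemma hbar_pos: "N \<ge> 2 \<Longrightarrow> hbar N > 0"
proof -
  assume "N \<ge> 2"
  then have "(real N)\<^sup>2 \<ge> 2\<^sup>2" by (intro power_mono) auto
  then show ?thesis by (simp add: hbar_def)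
qed

lemma mat_inner_mat_1:
  fixes X :: "complex^'n^'n"
  shows "mat_inner (mat 1) X = trace X"
proof -
  have "conj_transpose (mat 1) = (mat 1 :: complex^'n^'n)" by (simp add: vec_eq_iff mat_def)
  then show ?thesis by (simp add: mat_inner_def)
qed

lemma laplacian_linear:
  "laplacian S (X + Y) = laplacian S X + laplacian S Y" "laplacian S (X - Y) = laplacian S X - laplacian S Y"
  "laplacian S (cscale z X) = cscale z (laplacian S X)" "laplacian S (- X) = - laplacian S X"
  "laplacian S 0 = 0"
  by (simp_all add: laplacian_def sum.distrib sum_subtractf sum_negf cscale_sum)

lemma laplacian_sum: "laplacian S (\<Sum>i\<in>I. f i) = (\<Sum>i\<in>I. laplacian S (f i))"
  by (induction I rule: infinite_finite_induct) (simp_all add: laplacian_linear)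

lemma trace_laplacian: "trace (laplacian S X) = 0"
  unfolding laplacian_def trace_sum by simp

context spin_representation
begin

lemma S_su: "S i \<in> su"
  using irrep by (simp add: so3_irrep_def)

lemma laplacian_symmetric: "mat_inner X (laplacian S Y) = mat_inner (laplacian S X) Y"
proof -
  have "conj_transpose (S i) = - S i" for i using S_su by (simp add: su_iff)
  then show ?thesis
    by (simp add: laplacian_def mat_inner_sum_right mat_inner_sum_left mat_inner_commutator)
qed

lemma laplacian_conj_transpose: "laplacian S (conj_transpose X) = conj_transpose (laplacian S X)"
proof -
  have "conj_transpose (S i) = - S i" for i using S_su by (simp add: su_iff)
  then have "commutator (S i) (conj_transpose Y) = conj_transpose (commutator (S i) Y)" for i Y
    by (simp add: commutator_def conj_transpose_mult matrix_mult_minus)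
  then show ?thesis by (simp add: laplacian_def conj_transpose_sum)
qed

definition idx :: "(nat \<times> int) set"
  where "idx = Sigma {1..J} (\<lambda>l. {0..2 * int l})"

definition \<tau> :: "nat \<times> int \<Rightarrow> complex^'n^'n"
  where "\<tau> i = T (fst i) (snd i)"

definition lam :: "nat \<times> int \<Rightarrow> real"
  where "lam i = eigval (fst i)"

lemma finite_idx [simp]: "finite idx"
  by (simp add: idx_def)

lemma lam_pos: "i \<in> idx \<Longrightarrow> lam i > 0"
  by (auto simp: idx_def lam_def intro!: eigval_pos)

lemma \<tau>_orthonormal: "i \<in> idx \<Longrightarrow> j \<in> idx \<Longrightarrow> mat_inner (\<tau> i) (\<tau> j) = (if i = j then 1 else 0)"
  unfolding \<tau>_def by (subst T_orthonormal) (auto simp: idx_def prod_eq_iff)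

lemma laplacian_\<tau>: "i \<in> idx \<Longrightarrow> laplacian S (\<tau> i) = cscale (- of_real (lam i)) (\<tau> i)"
  unfolding \<tau>_def lam_def by (rule laplacian_T) (auto simp: idx_def)

lemma trace_\<tau>: "i \<in> idx \<Longrightarrow> trace (\<tau> i) = 0"
  using laplacian_\<tau>[of i] lam_pos[of i] trace_laplacian[of S "\<tau> i"] by simp

text \<open>
  The tensors of positive rank have trace \<open>0\<close>, being eigenvectors of the Laplacian for nonzero eigenvalues. Hence the
  identity matrix is a multiple of \<open>T 0 0\<close>, and having trace \<open>0\<close> means being orthogonal to \<open>T 0 0\<close>.
\<close>
lemma \<tau>_expansion:
  assumes "trace X = 0"
  shows "X = (\<Sum>i\<in>idx. cscale (mat_inner (\<tau> i) X) (\<tau> i))"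
proof -
  have split: "Y = cscale (mat_inner (T 0 0) Y) (T 0 0) + (\<Sum>i\<in>idx. cscale (mat_inner (\<tau> i) Y) (\<tau> i))" for Y
  proof -
    have "Sigma {0..J} (\<lambda>l. {0..2 * int l}) = insert (0, 0) idx"
      unfolding idx_def by (auto simp: not_less_eq_eq intro: Suc_leI)
    moreover have "(0, 0) \<notin> idx" by (simp add: idx_def)
    ultimately show ?thesis
      using T_expansion[of Y, symmetric] by (simp add: \<tau>_def case_prod_beta)
  qed
  have "mat_inner (\<tau> i) (mat 1) = 0" if "i \<in> idx" for i
    using trace_\<tau>[OF that] cnj_mat_inner[of "mat 1" "\<tau> i"] by (simp add: mat_inner_mat_1)
  then have one: "mat 1 = cscale (mat_inner (T 0 0) (mat 1)) (T 0 0)" (is "_ = cscale ?c _")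
    using split[of "mat 1", symmetric] by simp
  have "?c \<noteq> 0"
  proof
    assume "?c = 0"
    then have "(mat 1 :: complex^'n^'n) $ undefined $ undefined = 0" using one by simp
    then show False by (simp add: mat_def)
  qed
  moreover have "cnj ?c * mat_inner (T 0 0) X = 0"
    using assms mat_inner_mat_1[of X] one by (metis mat_inner_simps(7))
  ultimately show ?thesis using split[of X, symmetric] by simp
qed

lemma traceless_eqI:
  assumes "trace X = 0" "\<And>i. i \<in> idx \<Longrightarrow> mat_inner (\<tau> i) X = 0"
  shows "X = 0"
  using \<tau>_expansion[OF assms(1), symmetric] assms(2) by simp

text \<open>
  The inverse of minus the Laplacian on the matrices of trace \<open>0\<close>.
\<close>
definition Ainv :: "complex^'n^'n \<Rightarrow> complex^'n^'n"
  where "Ainv X = (\<Sum>i\<in>idx. cscale (mat_inner (\<tau> i) X / of_real (lam i)) (\<tau> i))"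

lemma mat_inner_Ainv:
  assumes "i \<in> idx"
  shows "mat_inner (\<tau> i) (Ainv X) = mat_inner (\<tau> i) X / of_real (lam i)"
proof -
  have "mat_inner (\<tau> i) (Ainv X) = (\<Sum>j\<in>idx. if j = i then mat_inner (\<tau> i) X / of_real (lam i) else 0)"
    unfolding Ainv_def mat_inner_sum_right using assms
    by (intro sum.cong refl) (auto simp: \<tau>_orthonormal)
  then show ?thesis using assms by simp
qed

lemma clinear_Ainv: "clinear Ainv"
  unfolding clinear_def Ainv_def
  by (simp add: add_divide_distrib cscale_distrib sum.distrib cscale_sum)

lemma trace_Ainv [simp]: "trace (Ainv X) = 0"
  unfolding Ainv_def trace_sum by (simp add: trace_\<tau>)

lemma laplacian_Ainv: "trace X = 0 \<Longrightarrow> laplacian S (Ainv X) = - X"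
proof -
  assume X: "trace X = 0"
  have "laplacian S (Ainv X) = - (\<Sum>i\<in>idx. cscale (mat_inner (\<tau> i) X) (\<tau> i))"
    unfolding Ainv_def laplacian_sum laplacian_linear sum_negf[symmetric]
  proof (intro sum.cong refl)
    fix i assume i: "i \<in> idx"
    show "cscale (mat_inner (\<tau> i) X / of_real (lam i)) (laplacian S (\<tau> i)) = - cscale (mat_inner (\<tau> i) X) (\<tau> i)"
      using lam_pos[OF i] unfolding laplacian_\<tau>[OF i] by (simp add: cscale_distrib)
  qed
  then show ?thesis by (simp only: \<tau>_expansion[OF X, symmetric])
qed

lemma mat_inner_laplacian_\<tau>: "i \<in> idx \<Longrightarrow> mat_inner (\<tau> i) (laplacian S X) = - of_real (lam i) * mat_inner (\<tau> i) X"
  by (simp add: laplacian_symmetric laplacian_\<tau>)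

lemma laplacian_injective:
  assumes "trace X = 0" "laplacian S X = 0"
  shows "X = 0"
proof (rule traceless_eqI[OF assms(1)])
  fix i assume i: "i \<in> idx"
  show "mat_inner (\<tau> i) X = 0"
    using mat_inner_laplacian_\<tau>[OF i, of X] lam_pos[OF i] assms(2) by simp
qed

text \<open>
  The Laplacian commutes with the conjugate transpose and is injective on matrices of trace \<open>0\<close>.
\<close>
lemma Ainv_su: "X \<in> su \<Longrightarrow> Ainv X \<in> su"
proof -
  assume X: "X \<in> su"
  have "conj_transpose (Ainv X) + Ainv X = 0"
  proof (rule laplacian_injective)
    show "trace (conj_transpose (Ainv X) + Ainv X) = 0" by (simp add: trace_add trace_conj_transpose)
    show "laplacian S (conj_transpose (Ainv X) + Ainv X) = 0"
      using X by (simp add: laplacian_linear laplacian_conj_transpose laplacian_Ainv su_iff)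
  qed
  then show ?thesis unfolding su_iff by (simp only: trace_Ainv eq_neg_iff_add_eq_0 simp_thms)
qed

lemma laplacian_su: "X \<in> su \<Longrightarrow> laplacian S X \<in> su"
  by (simp add: su_iff trace_laplacian laplacian_conj_transpose[symmetric] laplacian_linear)

end

section \<open>The connection and its curvature\<close>

lemma wigner6j_not_triad: "\<not> triad a b c \<Longrightarrow> wigner6j a b c d e f = 0"
  unfolding wigner6j_threej by (simp add: threej_not_triad)

context spin_representation
begin

definition h :: real
  where "h = hbar (J + 1)"

lemma ad_eq: "ad u v = - (1 / h) *\<^sub>R commutator u v" for u v :: "complex^'n^'n"
  by (simp add: ad_def h_def card_n)

lemma zeitlin_metric_sym: "zeitlin_metric S u v = - ((laplacian S u) \<bullet> v) / real CARD('n)"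
  unfolding zeitlin_metric_eq by (simp add: Re_mat_inner[symmetric] laplacian_symmetric)

lemma inner_commutator:
  assumes "u \<in> su"
  shows "X \<bullet> commutator u Y = - (commutator u X \<bullet> Y)"
  using assms by (simp add: Re_mat_inner[symmetric] mat_inner_commutator su_iff)

text \<open>
  For \<open>u\<close> in su(N) the commutator with \<open>u\<close> is skew for the trace form, so it can be moved to the other side. Uniqueness is
  the nondegeneracy of the metric, tested on \<open>Ainv\<close> of the difference of two candidates.
\<close>
lemma ad_star_eq:
  assumes u: "u \<in> su" and v: "v \<in> su"
  shows "ad_star S u v = (1 / h) *\<^sub>R Ainv (commutator u (- laplacian S v))"
  unfolding ad_star_def
proof (rule the_equality)
  let ?x = "(1 / h) *\<^sub>R Ainv (commutator u (- laplacian S v))"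
  have x: "?x \<in> su" using u v unfolding scaleR_eq_cscale
    by (intro su_closed Ainv_su laplacian_su)
  have met: "zeitlin_metric S ?x w = zeitlin_metric S v (ad u w)" for w
  proof -
    have "laplacian S ?x = - ((1 / h) *\<^sub>R commutator u (- laplacian S v))"
      unfolding scaleR_eq_cscale laplacian_linear by (subst laplacian_Ainv) (simp_all add: cscale_distrib)
    then show ?thesis
      unfolding zeitlin_metric_sym ad_eq using inner_commutator[OF u, of "laplacian S v" w]
      by simp
  qed
  show "?x \<in> su \<and> (\<forall>w\<in>su. zeitlin_metric S ?x w = zeitlin_metric S v (ad u w))"
    using x met by blast
  fix y assume y: "y \<in> su \<and> (\<forall>w\<in>su. zeitlin_metric S y w = zeitlin_metric S v (ad u w))"
  have d: "y - ?x \<in> su" using x y by (intro su_closed) auto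
  have "zeitlin_metric S y (Ainv (y - ?x)) = zeitlin_metric S ?x (Ainv (y - ?x))"
    using y met Ainv_su[OF d] by simp
  then have "y \<bullet> (y - ?x) = ?x \<bullet> (y - ?x)"
    unfolding zeitlin_metric_eq laplacian_Ainv[OF d[unfolded su_iff, THEN conjunct2]]
    by (simp only: minus_minus divide_cancel_right of_nat_eq_0_iff card_n) simp
  then have "(y - ?x) \<bullet> (y - ?x) = 0" by (simp only: inner_diff_left)
  then show "y = ?x" by simp
qed

text \<open>
  The complex-bilinear extension of the connection to all matrices. Two signs differ from the usual formula because
  \<open>A\<close> is minus the Laplacian.
\<close>
definition cnabla :: "complex^'n^'n \<Rightarrow> complex^'n^'n \<Rightarrow> complex^'n^'n"
  where "cnabla u v = cscale (of_real (1 / (2 * h)))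
    (- commutator u v + Ainv (commutator u (laplacian S v)) + Ainv (commutator v (laplacian S u)))"

lemma nabla_eq: "u \<in> su \<Longrightarrow> v \<in> su \<Longrightarrow> nabla S u v = cnabla u v"
  unfolding nabla_def cnabla_def ad_eq
  by (simp add: ad_star_eq scaleR_eq_cscale clinearD[OF clinear_Ainv] cscale_distrib)

lemma cnabla_su: "u \<in> su \<Longrightarrow> v \<in> su \<Longrightarrow> cnabla u v \<in> su"
  unfolding cnabla_def by (intro su_closed Ainv_su laplacian_su)

lemma ad_su: "u \<in> su \<Longrightarrow> v \<in> su \<Longrightarrow> ad u v \<in> su" for u v :: "complex^'n^'n"
proof -
  assume "u \<in> su" "v \<in> su"
  then have "- cscale (of_real (1 / h)) (commutator u v) \<in> su" by (intro su_closed)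
  then show ?thesis by (simp add: ad_eq scaleR_eq_cscale cscale_distrib)
qed

lemma clinear_cnabla: "clinear (\<lambda>w. cnabla w v)" "clinear (cnabla u)"
  by (simp_all add: clinear_def cnabla_def laplacian_linear clinearD[OF clinear_Ainv] cscale_distrib)

lemma trace_cnabla [simp]: "trace (cnabla u v) = 0"
  by (simp add: cnabla_def trace_add trace_sub)

definition cad :: "complex^'n^'n \<Rightarrow> complex^'n^'n \<Rightarrow> complex^'n^'n"
  where "cad u w = cscale (of_real (1 / h)) (commutator u w)"

lemma ad_eq_cad: "ad w u = cad u w"
  by (simp add: ad_eq cad_def scaleR_eq_cscale commutator_commute[of w] cscale_distrib)

definition cRiemann :: "complex^'n^'n \<Rightarrow> complex^'n^'n \<Rightarrow> complex^'n^'n \<Rightarrow> complex^'n^'n"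
  where "cRiemann u v w = cnabla w (cnabla u v) - cnabla u (cnabla w v) - cnabla (cad u w) v"

lemma Ric_eq_trace:
  assumes u: "u \<in> su" and v: "v \<in> su"
  shows "Ric S u v = Re (\<Sum>i\<in>idx. mat_inner (\<tau> i) (cRiemann u v (\<tau> i)))"
  unfolding Ric_def
proof (rule trace_on_su)
  have "cad u (X + Y) = cad u X + cad u Y" "cad u (cscale z X) = cscale z (cad u X)" for X Y z
    by (simp_all add: cad_def cscale_distrib mult.commute)
  then show "clinear (cRiemann u v)"
    by (simp add: clinear_def cRiemann_def clinearD[OF clinear_cnabla(1)] clinearD[OF clinear_cnabla(2)]
      cscale_distrib)
  show R: "riemann S X u v = cRiemann u v X" if "X \<in> su" for X
    using that u v by (simp add: riemann_def cRiemann_def nabla_eq cnabla_su ad_su ad_eq_cad[symmetric])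
  show "cRiemann u v X \<in> su" if "X \<in> su" for X
    unfolding cRiemann_def ad_eq_cad[symmetric] using that u v
    by (intro su_closed cnabla_su ad_su)
qed (auto simp: trace_\<tau> su_iff intro: \<tau>_expansion)

definition D :: "complex^'n^'n \<Rightarrow> nat \<times> int \<Rightarrow> nat \<times> int \<Rightarrow> complex"
  where "D u i j = mat_inner (\<tau> i) (commutator u (\<tau> j))"

lemma D_skew: "u \<in> su \<Longrightarrow> D u j i = - cnj (D u i j)"
  by (simp add: D_def cnj_mat_inner mat_inner_commutator[of u "\<tau> j"] su_iff)

lemma cnabla_left:
  assumes "i \<in> idx" "j \<in> idx" and v: "laplacian S v = cscale (- of_real b) v"
  shows "mat_inner (\<tau> i) (cnabla (\<tau> j) v)
    = of_real (1 / (2 * h) * (1 + b / lam i - lam j / lam i)) * D v i j"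
proof -
  have "cnabla (\<tau> j) v = cscale (of_real (1 / (2 * h))) (commutator v (\<tau> j)
      + cscale (of_real b) (Ainv (commutator v (\<tau> j))) - cscale (of_real (lam j)) (Ainv (commutator v (\<tau> j))))"
    using assms(2) unfolding cnabla_def v
    by (simp add: laplacian_\<tau> clinearD[OF clinear_Ainv] commutator_commute[of "\<tau> j" v] cscale_distrib)
  then show ?thesis using assms(1)
    by (simp add: mat_inner_Ainv D_def[symmetric]) (simp add: field_simps)
qed

lemma cnabla_right:
  assumes "i \<in> idx" "j \<in> idx" and u: "laplacian S u = cscale (- of_real a) u"
  shows "mat_inner (\<tau> i) (cnabla u (\<tau> j))
    = of_real (1 / (2 * h) * (a / lam i - lam j / lam i - 1)) * D u i j"
proof -
  have "cnabla u (\<tau> j) = cscale (of_real (1 / (2 * h))) (- commutator u (\<tau> j)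
      - cscale (of_real (lam j)) (Ainv (commutator u (\<tau> j))) + cscale (of_real a) (Ainv (commutator u (\<tau> j))))"
    using assms(2) unfolding cnabla_def u
    by (simp add: laplacian_\<tau> clinearD[OF clinear_Ainv] commutator_commute[of "\<tau> j" u] cscale_distrib)
  then show ?thesis using assms(1)
    by (simp add: mat_inner_Ainv D_def[symmetric]) (simp add: field_simps)
qed

text \<open>
  The trace of \<open>w \<mapsto> \<nabla>\<^sub>w z\<close> has no real part: the terms with \<open>z\<close> itself cancel on the diagonal, and what is left is a diagonal entry
  of the skew-Hermitian \<open>D\<close>.
\<close>
lemma cnabla_diagonal:
  assumes i: "i \<in> idx" and z: "z \<in> su"
  shows "Re (mat_inner (\<tau> i) (cnabla (\<tau> i) z)) = 0"
proof -
  have skew: "Re (D y i i) = 0" if "y \<in> su" for y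
    using D_skew[OF that, of i i] by (simp add: complex_eq_iff)
  have "cnabla (\<tau> i) z = cscale (of_real (1 / (2 * h))) (commutator z (\<tau> i)
      - Ainv (commutator (laplacian S z) (\<tau> i)) - cscale (of_real (lam i)) (Ainv (commutator z (\<tau> i))))"
    using i unfolding cnabla_def
    by (simp add: laplacian_\<tau> clinearD[OF clinear_Ainv] commutator_commute[of "\<tau> i"] cscale_distrib)
  then have "mat_inner (\<tau> i) (cnabla (\<tau> i) z) = of_real (1 / (2 * h)) * (- D (laplacian S z) i i / of_real (lam i))"
    using i lam_pos[OF i] by (simp add: mat_inner_Ainv D_def[symmetric])
  then show ?thesis using skew[OF laplacian_su[OF z]]
    by (simp add: Re_divide_of_real)
qed

lemma expand_apply:
  assumes "clinear L" "trace X = 0"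
  shows "mat_inner Y (L X) = (\<Sum>j\<in>idx. mat_inner (\<tau> j) X * mat_inner Y (L (\<tau> j)))"
proof -
  have "L X = L (\<Sum>j\<in>idx. cscale (mat_inner (\<tau> j) X) (\<tau> j))"
    by (rule arg_cong[OF \<tau>_expansion[OF assms(2)]])
  then show ?thesis by (simp add: clinear_sum[OF assms(1)] clinearD[OF assms(1)] mat_inner_sum_right)
qed

lemma Re_scaled_cnj:
  fixes p q :: real and x y :: complex
  shows "Re (of_real p * - cnj x * (of_real q * y)) = - (p * q * Re (y * cnj x))"
    "Re (of_real p * - cnj x * (of_real q * y)) = - (p * q * Re (x * cnj y))"
  by (simp_all add: algebra_simps)

text \<open>
  Collects the weights of the two surviving terms of the curvature, with \<open>x = lam i\<close> and \<open>y = lam j\<close>.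
\<close>
lemma ricci_weight:
  fixes a b x y :: real
  assumes "x > 0" "y > 0" "h > 0"
  shows "- (- (1 / (2 * h) * (1 + b / y - x / y) * (1 / (2 * h) * (a / x - y / x - 1))))
      + 1 / h * (1 / (2 * h) * (1 + b / x - y / x))
    = (a * b + x\<^sup>2 - 3 * y\<^sup>2 + 2 * x * y + (a + b) * (y - x)) / (4 * h\<^sup>2 * (x * y))"
  using assms by (simp add: field_simps power2_eq_square)

text \<open>
  Of the three terms of the curvature the first is traceless. The other two are products of matrices whose entries are
  those of \<open>D u\<close> and \<open>D v\<close> times rational functions of the eigenvalues. Since \<open>D\<close> is skew-Hermitian, the real part of
  \<open>D u i j \<cdot> cnj (D v i j)\<close> is symmetric in \<open>i, j\<close>, so only the symmetric part of the weight counts; there the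
  terms linear in \<open>a\<close> and \<open>b\<close> drop out.
\<close>
lemma Ric_structure_constants:
  assumes u: "u \<in> su" "laplacian S u = cscale (- of_real a) u"
    and v: "v \<in> su" "laplacian S v = cscale (- of_real b) v" and h: "h > 0"
  shows "Ric S u v = (\<Sum>i\<in>idx. \<Sum>j\<in>idx. (a * b - (lam i - lam j)\<^sup>2) / (4 * h\<^sup>2 * (lam i * lam j))
    * Re (D u i j * cnj (D v i j)))"
proof -
  define c where "c i j = Re (D u i j * cnj (D v i j))" for i j
  have c_sym: "c i j = c j i" for i j
    unfolding c_def D_skew[OF u(1), of j i] D_skew[OF v(1), of j i] by simp
  define w where "w i j = (a * b + (lam i)\<^sup>2 - 3 * (lam j)\<^sup>2 + 2 * lam i * lam j + (a + b) * (lam j - lam i))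
    / (4 * h\<^sup>2 * (lam i * lam j))" for i j
  have summand: "Re (mat_inner (\<tau> i) (cRiemann u v (\<tau> i))) = (\<Sum>j\<in>idx. w i j * c i j)" if i: "i \<in> idx" for i
  proof -
    have 1: "mat_inner (\<tau> i) (cnabla u (cnabla (\<tau> i) v))
      = (\<Sum>j\<in>idx. of_real (1 / (2 * h) * (1 + b / lam j - lam i / lam j)) * D v j i
          * (of_real (1 / (2 * h) * (a / lam i - lam j / lam i - 1)) * D u i j))"
      by (subst expand_apply[OF clinear_cnabla(2)]) (simp_all only: trace_cnabla cnabla_left[OF _ i v(2)] cnabla_right[OF i _ u(2)] cong: sum.cong)
    have 2: "mat_inner (\<tau> i) (cnabla (cad u (\<tau> i)) v)
      = (\<Sum>j\<in>idx. of_real (1 / h) * D u j i * (of_real (1 / (2 * h) * (1 + b / lam i - lam j / lam i)) * D v i j))"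
    proof -
      have "trace (cad u (\<tau> i)) = 0" by (simp add: cad_def)
      then have "mat_inner (\<tau> i) (cnabla (cad u (\<tau> i)) v)
        = (\<Sum>j\<in>idx. mat_inner (\<tau> j) (cad u (\<tau> i)) * mat_inner (\<tau> i) (cnabla (\<tau> j) v))"
        by (rule expand_apply[OF clinear_cnabla(1)])
      also have "\<dots> = (\<Sum>j\<in>idx. of_real (1 / h) * D u j i * (of_real (1 / (2 * h) * (1 + b / lam i - lam j / lam i)) * D v i j))"
        by (intro sum.cong refl) (simp only: cnabla_left[OF i _ v(2)] cad_def mat_inner_simps D_def[symmetric])
      finally show ?thesis .
    qed
    have "Re (mat_inner (\<tau> i) (cRiemann u v (\<tau> i)))
      = - Re (mat_inner (\<tau> i) (cnabla u (cnabla (\<tau> i) v))) - Re (mat_inner (\<tau> i) (cnabla (cad u (\<tau> i)) v))"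
      using cnabla_diagonal[OF i cnabla_su[OF u(1) v(1)]]
      unfolding cRiemann_def mat_inner_simps minus_complex.sel by linarith
    also have "\<dots> = (\<Sum>j\<in>idx. w i j * c i j)"
      unfolding 1 2 Re_sum sum_negf[symmetric] sum_subtractf[symmetric]
    proof (intro sum.cong refl)
      fix j assume j: "j \<in> idx"
      let ?p = "1 / (2 * h) * (1 + b / lam j - lam i / lam j)" and ?q = "1 / (2 * h) * (a / lam i - lam j / lam i - 1)"
        and ?r = "1 / (2 * h) * (1 + b / lam i - lam j / lam i)"
      have "Re (of_real ?p * D v j i * (of_real ?q * D u i j)) = - (?p * ?q * c i j)"
        unfolding D_skew[OF v(1), of j i] c_def
        by (rule Re_scaled_cnj(1))
      moreover have "Re (of_real (1 / h) * D u j i * (of_real ?r * D v i j)) = - (1 / h * ?r * c i j)"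
        unfolding D_skew[OF u(1), of j i] c_def
        by (rule Re_scaled_cnj(2))
      moreover have "- (- (?p * ?q)) + 1 / h * ?r = w i j"
        unfolding w_def by (rule ricci_weight[OF lam_pos[OF i] lam_pos[OF j] h])
      ultimately show "- Re (of_real ?p * D v j i * (of_real ?q * D u i j))
          - Re (of_real (1 / h) * D u j i * (of_real ?r * D v i j)) = w i j * c i j"
        by (simp only:) (simp only: minus_minus diff_minus_eq_add distrib_right[symmetric])
    qed
    finally show ?thesis .
  qed
  have "Ric S u v = (\<Sum>i\<in>idx. \<Sum>j\<in>idx. w i j * c i j)"
    unfolding Ric_eq_trace[OF u(1) v(1)] Re_sum by (intro sum.cong refl summand)
  also have "\<dots> = (\<Sum>i\<in>idx. \<Sum>j\<in>idx. (w i j + w j i) / 2 * c i j)"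
  proof -
    have "(\<Sum>i\<in>idx. \<Sum>j\<in>idx. w i j * c i j) = (\<Sum>i\<in>idx. \<Sum>j\<in>idx. w j i * c i j)"
      by (subst sum.swap) (simp add: c_sym)
    then have "(\<Sum>i\<in>idx. \<Sum>j\<in>idx. w i j * c i j)
      = ((\<Sum>i\<in>idx. \<Sum>j\<in>idx. w i j * c i j) + (\<Sum>i\<in>idx. \<Sum>j\<in>idx. w j i * c i j)) / 2" by simp
    then show ?thesis
      by (simp only: sum.distrib[symmetric] sum_divide_distrib add_divide_distrib distrib_right) simp
  qed
  also have "\<dots> = (\<Sum>i\<in>idx. \<Sum>j\<in>idx. (a * b - (lam i - lam j)\<^sup>2) / (4 * h\<^sup>2 * (lam i * lam j)) * c i j)"
  proof (intro sum.cong refl arg_cong2[where f = "(*)"])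
    fix i j
    have "w i j + w j i = 2 * (a * b - (lam i - lam j)\<^sup>2) / (4 * h\<^sup>2 * (lam i * lam j))"
      unfolding w_def mult.commute[of "lam j" "lam i"] add_divide_distrib[symmetric]
      by (rule arg_cong2[where f = "(/)"]) (simp_all add: power2_eq_square algebra_simps)
    moreover have "2 * x / y / 2 = x / y" for x y :: real by simp
    ultimately show "(w i j + w j i) / 2 = (a * b - (lam i - lam j)\<^sup>2) / (4 * h\<^sup>2 * (lam i * lam j))"
      by (simp only:)
  qed
  finally show ?thesis unfolding c_def .
qed


section \<open>The Ricci tensor on the eigenspaces\<close>

lemma V_spaceD:
  assumes "u \<in> V_space S l"
  shows "u \<in> su" "laplacian S u = cscale (- of_real (eigval l)) u"
  using assms by (simp_all add: V_space_def scaleR_eq_cscale cscale_distrib)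

lemma V_space_orthogonal:
  assumes u: "u \<in> V_space S l" and "i \<in> idx" "fst i \<noteq> l"
  shows "mat_inner (\<tau> i) u = 0"
proof -
  have "of_real (lam i - eigval l) * mat_inner (\<tau> i) u = 0"
    using mat_inner_laplacian_\<tau>[OF assms(2), of u] V_spaceD(2)[OF u] by (auto simp: algebra_simps)
  then show ?thesis using assms(3) by (simp add: lam_def eigval_inject)
qed

lemma V_space_sum:
  assumes u: "u \<in> V_space S l" and l: "l \<in> {1..J}" and f: "\<And>i. f i 0 = (0 :: 'a::comm_monoid_add)"
  shows "(\<Sum>i\<in>idx. f i (mat_inner (\<tau> i) u)) = (\<Sum>\<mu>\<in>{0..2 * int l}. f (l, \<mu>) (mat_inner (T l \<mu>) u))"
proof -
  have "(\<Sum>i\<in>idx. f i (mat_inner (\<tau> i) u)) = (\<Sum>i\<in>Pair l ` {0..2 * int l}. f i (mat_inner (\<tau> i) u))"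
  proof (rule sum.mono_neutral_right)
    show "\<forall>i\<in>idx - Pair l ` {0..2 * int l}. f i (mat_inner (\<tau> i) u) = 0"
    proof
      fix i assume i: "i \<in> idx - Pair l ` {0..2 * int l}"
      then have "fst i \<noteq> l" by (auto simp: idx_def)
      with i show "f i (mat_inner (\<tau> i) u) = 0" by (simp add: V_space_orthogonal[OF u] f)
    qed
  qed (use l in \<open>auto simp: idx_def\<close>)
  also have "\<dots> = (\<Sum>\<mu>\<in>{0..2 * int l}. f (l, \<mu>) (mat_inner (T l \<mu>) u))"
    by (subst sum.reindex) (auto simp: inj_on_def \<tau>_def)
  finally show ?thesis .
qed

lemma V_space_expansion:
  assumes u: "u \<in> V_space S l" and l: "l \<in> {1..J}"
  shows "u = (\<Sum>\<mu>\<in>{0..2 * int l}. cscale (mat_inner (T l \<mu>) u) (T l \<mu>))"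
proof -
  have "trace u = 0" using V_spaceD(1)[OF u] by (simp add: su_iff)
  from \<tau>_expansion[OF this] V_space_sum[OF u l, of "\<lambda>i z. cscale z (\<tau> i)"]
  show ?thesis by (simp add: \<tau>_def)
qed

lemma V_space_mat_inner:
  assumes u: "u \<in> V_space S l" and v: "v \<in> V_space S l'" and l: "l \<in> {1..J}"
  shows "mat_inner v u = (\<Sum>\<mu>\<in>{0..2 * int l}. if l = l' then mat_inner (T l \<mu>) u * cnj (mat_inner (T l \<mu>) v) else 0)"
proof -
  have "trace u = 0" using V_spaceD(1)[OF u] by (simp add: su_iff)
  then have "mat_inner v u = mat_inner v (\<Sum>i\<in>idx. cscale (mat_inner (\<tau> i) u) (\<tau> i))"
    by (rule arg_cong[OF \<tau>_expansion])
  also have "\<dots> = (\<Sum>i\<in>idx. mat_inner (\<tau> i) u * cnj (mat_inner (\<tau> i) v))"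
    by (simp add: mat_inner_sum_right cnj_mat_inner)
  also have "\<dots> = (\<Sum>\<mu>\<in>{0..2 * int l}. mat_inner (T l \<mu>) u * cnj (mat_inner (T l \<mu>) v))"
    by (subst V_space_sum[OF u l, of "\<lambda>i z. z * cnj (mat_inner (\<tau> i) v)"]) (simp_all add: \<tau>_def)
  also have "\<dots> = (\<Sum>\<mu>\<in>{0..2 * int l}. if l = l' then mat_inner (T l \<mu>) u * cnj (mat_inner (T l \<mu>) v) else 0)"
  proof (intro sum.cong refl)
    fix \<mu> assume "\<mu> \<in> {0..2 * int l}"
    then have "mat_inner (T l \<mu>) v = 0" if "l \<noteq> l'"
      using V_space_orthogonal[OF v, of "(l, \<mu>)"] that l by (auto simp: \<tau>_def idx_def)
    then show "mat_inner (T l \<mu>) u * cnj (mat_inner (T l \<mu>) v)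
      = (if l = l' then mat_inner (T l \<mu>) u * cnj (mat_inner (T l \<mu>) v) else 0)" by simp
  qed
  finally show ?thesis .
qed

text \<open>
  The adjoint of a tensor is a tensor of the same rank with reflected magnetic number, up to sign, so the matrix
  entry is a trace of three tensors contracted with the coordinates of \<open>u\<close>.
\<close>
lemma D_threej:
  assumes u: "u \<in> V_space S l" and l: "l \<in> {1..J}"
  shows "D u (k, p) (k', p') = - of_real (psign (p - int k) * ((1 - psign (int (l + k + k'))) *
      (sqrt (2 * real l + 1) * sqrt (2 * real k + 1) * sqrt (2 * real k' + 1)
      * wigner6j (2 * l) (2 * k) (2 * k') J J J))) *
    (\<Sum>\<mu>\<in>{0..2 * int l}. mat_inner (T l \<mu>) u * of_real (threej (2 * l) (2 * k) (2 * k') \<mu> (2 * int k - p) p'))"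
proof -
  let ?B = "T k (2 * int k - p)" and ?C = "T k' p'"
  have "D u (k, p) (k', p') = of_real (psign (p - int k)) * trace (?B ** commutator u ?C)"
    by (simp add: D_def \<tau>_def mat_inner_def conj_transpose_T cscale_mult)
  also have "trace (?B ** commutator u ?C) = - trace (u ** commutator ?B ?C)"
    by (simp add: commutator_def matrix_mult_distrib trace_sub matrix_mul_assoc
      trace_mult_commute[of ?B "u ** ?C"] trace_mult_commute[of "?B ** ?C" u])
      (metis matrix_mul_assoc trace_mult_commute)
  also have "trace (u ** commutator ?B ?C)
    = trace ((\<Sum>\<mu>\<in>{0..2 * int l}. cscale (mat_inner (T l \<mu>) u) (T l \<mu>)) ** commutator ?B ?C)"
    by (rule arg_cong[OF V_space_expansion[OF u l]])
  also have "\<dots> = (\<Sum>\<mu>\<in>{0..2 * int l}. mat_inner (T l \<mu>) u * trace (T l \<mu> ** commutator ?B ?C))"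
    by (simp add: matrix_mult_sum trace_sum cscale_mult)
  also have "\<dots> = of_real ((1 - psign (int (l + k + k'))) *
      (sqrt (2 * real l + 1) * sqrt (2 * real k + 1) * sqrt (2 * real k' + 1)
      * wigner6j (2 * l) (2 * k) (2 * k') J J J)) *
    (\<Sum>\<mu>\<in>{0..2 * int l}. mat_inner (T l \<mu>) u * of_real (threej (2 * l) (2 * k) (2 * k') \<mu> (2 * int k - p) p'))"
    unfolding trace_T_commutator sum_distrib_left by (intro sum.cong refl) (simp only: of_real_mult mult_ac)
  finally show ?thesis
    by (simp only: of_real_mult mult_minus_left mult_minus_right mult.assoc)
qed

text \<open>
  Orthogonality of the 3j symbols in the slot of \<open>l\<close>. The 6j factors make the statement hold also when
  \<open>l, k, k'\<close> violate the triangle inequalities, where the 3j symbol has norm \<open>0\<close> instead of \<open>1\<close>.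
\<close>
lemma sum_threej_6j:
  assumes "\<mu> \<in> {0..2 * int l}"
  shows "wigner6j (2 * l) (2 * k) (2 * k') J J J * wigner6j (2 * l') (2 * k) (2 * k') J J J *
    (\<Sum>p\<in>{0..2 * int k}. \<Sum>p'\<in>{0..2 * int k'}. threej (2 * l) (2 * k) (2 * k') \<mu> (2 * int k - p) p' *
       threej (2 * l') (2 * k) (2 * k') \<nu> (2 * int k - p) p')
    = (if l = l' \<and> \<mu> = \<nu> then (wigner6j (2 * l) (2 * k) (2 * k') J J J)\<^sup>2 / (2 * real l + 1) else 0)"
proof (cases "triad (2 * l) (2 * k) (2 * k')")
  case True
  let ?X = "\<lambda>l. threej (2 * k) (2 * k') (2 * l)"
  have X: "threej (2 * l) (2 * k) (2 * k') \<mu> p p' = ?X l p p' \<mu>" for l \<mu> p p' by (rule threej_cycle[symmetric])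
  have "(\<Sum>p\<in>{0..2 * int k}. \<Sum>p'\<in>{0..2 * int k'}. ?X l (2 * int k - p) p' \<mu> * ?X l' (2 * int k - p) p' \<nu>)
    = overlap (2 * k) (2 * k') (?X l) (?X l') \<mu> \<nu>"
    unfolding overlap_def
    using sum_reflect[of "\<lambda>p. \<Sum>p'\<in>{0..2 * int k'}. ?X l p p' \<mu> * ?X l' p p' \<nu>" "2 * k"] by simp
  moreover have "overlap (2 * k) (2 * k') (?X l) (?X l') \<mu> \<nu>
    = (if 2 * l = 2 * l' \<and> \<mu> = \<nu> \<and> \<mu> \<in> {0..int (2 * l)} then 1 / (real (2 * l) + 1) else 0)"
    by (rule overlap_threej) (use True triad_perm in metis)
  ultimately show ?thesis unfolding X using assms by (simp add: power2_eq_square)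
next
  case False
  then show ?thesis by (cases "l = l'") (simp_all add: wigner6j_not_triad)
qed

lemma sum_swap4:
  "(\<Sum>a\<in>A. \<Sum>b\<in>B. \<Sum>c\<in>C. \<Sum>d\<in>E. f a b c d) = (\<Sum>c\<in>C. \<Sum>d\<in>E. \<Sum>a\<in>A. \<Sum>b\<in>B. f a b c d)"
proof -
  have "(\<Sum>a\<in>A. \<Sum>b\<in>B. \<Sum>c\<in>C. \<Sum>d\<in>E. f a b c d) = (\<Sum>a\<in>A. \<Sum>c\<in>C. \<Sum>b\<in>B. \<Sum>d\<in>E. f a b c d)"
    by (rule sum.cong[OF refl], rule sum.swap)
  also have "\<dots> = (\<Sum>c\<in>C. \<Sum>a\<in>A. \<Sum>b\<in>B. \<Sum>d\<in>E. f a b c d)" by (rule sum.swap)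
  also have "\<dots> = (\<Sum>c\<in>C. \<Sum>a\<in>A. \<Sum>d\<in>E. \<Sum>b\<in>B. f a b c d)"
    by (rule sum.cong[OF refl], rule sum.cong[OF refl], rule sum.swap)
  also have "\<dots> = (\<Sum>c\<in>C. \<Sum>d\<in>E. \<Sum>a\<in>A. \<Sum>b\<in>B. f a b c d)"
    by (rule sum.cong[OF refl], rule sum.swap)
  finally show ?thesis .
qed

lemma sum_idx: "sum f idx = (\<Sum>k\<in>{1..J}. \<Sum>p\<in>{0..2 * int k}. f (k, p))"
  unfolding idx_def by (simp add: sum.Sigma)

text \<open>
  The outer product of the coordinates of \<open>u\<close> and \<open>v\<close> is contracted with a product of two 3j symbols that is the identity up to a
  factor, which leaves the trace form of \<open>u\<close> and \<open>v\<close>.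
\<close>
lemma block_sum:
  assumes u: "u \<in> V_space S l" and v: "v \<in> V_space S l'" and l: "l \<in> {1..J}" and l': "l' \<in> {1..J}"
  shows "(\<Sum>p\<in>{0..2 * int k}. \<Sum>p'\<in>{0..2 * int k'}. D u (k, p) (k', p') * cnj (D v (k, p) (k', p')))
    = of_real ((1 - psign (int (l + k + k')))\<^sup>2 * (2 * real k + 1) * (2 * real k' + 1) *
        (wigner6j (2 * l) (2 * k) (2 * k') J J J)\<^sup>2) * mat_inner v u"
proof -
  let ?w = "\<lambda>l. wigner6j (2 * l) (2 * k) (2 * k') J J J" and ?X = "\<lambda>l. threej (2 * l) (2 * k) (2 * k')"
  let ?P = "{0..2 * int k}" and ?P' = "{0..2 * int k'}"
  let ?x = "\<lambda>\<mu>. mat_inner (T l \<mu>) u" and ?y = "\<lambda>\<nu>. mat_inner (T l' \<nu>) v"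
  define c where "c l = (1 - psign (int (l + k + k'))) *
      (sqrt (2 * real l + 1) * sqrt (2 * real k + 1) * sqrt (2 * real k' + 1))" for l
  have "D u (k, p) (k', p') * cnj (D v (k, p) (k', p')) = (\<Sum>\<mu>\<in>{0..2 * int l}. \<Sum>\<nu>\<in>{0..2 * int l'}.
      ?x \<mu> * cnj (?y \<nu>) * of_real (c l * c l' * (?w l * ?w l' * (?X l \<mu> (2 * int k - p) p' * ?X l' \<nu> (2 * int k - p) p'))))" for p p'
  proof -
    have "of_real (psign q * a) * A * cnj (of_real (psign q * b) * B) = of_real (a * b) * (A * cnj B)" for q a b A B
      by (simp add: psign_def)
    then have "D u (k, p) (k', p') * cnj (D v (k, p) (k', p')) = of_real (c l * ?w l * (c l' * ?w l')) *
      ((\<Sum>\<mu>\<in>{0..2 * int l}. ?x \<mu> * of_real (?X l \<mu> (2 * int k - p) p'))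
       * cnj (\<Sum>\<nu>\<in>{0..2 * int l'}. ?y \<nu> * of_real (?X l' \<nu> (2 * int k - p) p')))"
      unfolding D_threej[OF u l] D_threej[OF v l'] complex_cnj_minus minus_mult_minus c_def complex_cnj_mult
        mult_minus_left mult_minus_right minus_minus by (simp only: mult.assoc)
    then show ?thesis
      unfolding cnj_sum sum_product by (simp add: sum_distrib_left mult_ac)
  qed
  then have "(\<Sum>p\<in>?P. \<Sum>p'\<in>?P'. D u (k, p) (k', p') * cnj (D v (k, p) (k', p')))
    = (\<Sum>p\<in>?P. \<Sum>p'\<in>?P'. \<Sum>\<mu>\<in>{0..2 * int l}. \<Sum>\<nu>\<in>{0..2 * int l'}.
      ?x \<mu> * cnj (?y \<nu>) * of_real (c l * c l' * (?w l * ?w l' * (?X l \<mu> (2 * int k - p) p' * ?X l' \<nu> (2 * int k - p) p'))))"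
    by simp
  also have "\<dots> = (\<Sum>\<mu>\<in>{0..2 * int l}. \<Sum>\<nu>\<in>{0..2 * int l'}. \<Sum>p\<in>?P. \<Sum>p'\<in>?P'.
      ?x \<mu> * cnj (?y \<nu>) * of_real (c l * c l' * (?w l * ?w l' * (?X l \<mu> (2 * int k - p) p' * ?X l' \<nu> (2 * int k - p) p'))))"
    by (rule sum_swap4)
  also have "\<dots> = (\<Sum>\<mu>\<in>{0..2 * int l}. \<Sum>\<nu>\<in>{0..2 * int l'}.
      ?x \<mu> * cnj (?y \<nu>) * of_real (c l * c l' * (?w l * ?w l' * (\<Sum>p\<in>?P. \<Sum>p'\<in>?P'. ?X l \<mu> (2 * int k - p) p' * ?X l' \<nu> (2 * int k - p) p'))))"
    by (simp add: sum_distrib_left)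
  also have "\<dots> = (\<Sum>\<mu>\<in>{0..2 * int l}. \<Sum>\<nu>\<in>{0..2 * int l'}. if \<nu> = \<mu> then
      (if l = l' then ?x \<mu> * cnj (?y \<mu>) * of_real ((c l)\<^sup>2 * ((?w l)\<^sup>2 / (2 * real l + 1))) else 0) else 0)"
    by (intro sum.cong refl) (simp add: sum_threej_6j power2_eq_square)
  also have "\<dots> = (\<Sum>\<mu>\<in>{0..2 * int l}. of_real ((c l)\<^sup>2 * ((?w l)\<^sup>2 / (2 * real l + 1))) *
      (if l = l' then ?x \<mu> * cnj (mat_inner (T l \<mu>) v) else 0))"
    by (intro sum.cong refl) auto
  also have "\<dots> = of_real ((c l)\<^sup>2 * ((?w l)\<^sup>2 / (2 * real l + 1))) * mat_inner v u"
    unfolding V_space_mat_inner[OF u v l] sum_distrib_left ..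
  also have "(c l)\<^sup>2 * ((?w l)\<^sup>2 / (2 * real l + 1)) = (1 - psign (int (l + k + k')))\<^sup>2 * (2 * real k + 1) * (2 * real k' + 1) * (?w l)\<^sup>2"
    unfolding c_def power_mult_distrib by (simp add: field_simps)
  finally show ?thesis .
qed

text \<open>
  The sum over basis pairs grouped by blocks; the squared commutator factor is \<open>4\<close> or \<open>0\<close>.
\<close>
lemma Ric_V_space:
  assumes u: "u \<in> V_space S l" and v: "v \<in> V_space S l'" and l: "l \<in> {1..J}" and l': "l' \<in> {1..J}"
  shows "Ric S u v = (\<Sum>k\<in>{1..J}. \<Sum>k'\<in>{1..J}. if odd (k + k' + l) then
      (eigval l * eigval l' - (eigval k - eigval k')\<^sup>2) / (h\<^sup>2 * (eigval k * eigval k')) *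
      ((2 * real k + 1) * (2 * real k' + 1) * (wigner6j (2 * l) (2 * k) (2 * k') J J J)\<^sup>2) * (v \<bullet> u) else 0)"
proof -
  have h: "h > 0" using l unfolding h_def by (intro hbar_pos) auto
  let ?W = "\<lambda>k k'. (eigval l * eigval l' - (eigval k - eigval k')\<^sup>2) / (4 * h\<^sup>2 * (eigval k * eigval k'))"
  have "Ric S u v = (\<Sum>i\<in>idx. \<Sum>j\<in>idx. ?W (fst i) (fst j) * Re (D u i j * cnj (D v i j)))"
    unfolding Ric_structure_constants[OF V_spaceD[OF u] V_spaceD[OF v] h] lam_def ..
  also have "\<dots> = (\<Sum>k\<in>{1..J}. \<Sum>p\<in>{0..2 * int k}. \<Sum>k'\<in>{1..J}. \<Sum>p'\<in>{0..2 * int k'}.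
      ?W k k' * Re (D u (k, p) (k', p') * cnj (D v (k, p) (k', p'))))"
    unfolding sum_idx fst_conv ..
  also have "\<dots> = (\<Sum>k\<in>{1..J}. \<Sum>k'\<in>{1..J}. \<Sum>p\<in>{0..2 * int k}. \<Sum>p'\<in>{0..2 * int k'}.
      ?W k k' * Re (D u (k, p) (k', p') * cnj (D v (k, p) (k', p'))))"
    by (intro sum.cong refl sum.swap)
  also have "\<dots> = (\<Sum>k\<in>{1..J}. \<Sum>k'\<in>{1..J}. ?W k k' * Re (\<Sum>p\<in>{0..2 * int k}. \<Sum>p'\<in>{0..2 * int k'}.
      D u (k, p) (k', p') * cnj (D v (k, p) (k', p'))))"
    by (simp add: sum_distrib_left)
  also have "\<dots> = (\<Sum>k\<in>{1..J}. \<Sum>k'\<in>{1..J}. ?W k k' * ((1 - psign (int (l + k + k')))\<^sup>2 *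
      ((2 * real k + 1) * (2 * real k' + 1) * (wigner6j (2 * l) (2 * k) (2 * k') J J J)\<^sup>2) * (v \<bullet> u)))"
    unfolding block_sum[OF u v l l'] Re_mat_inner[symmetric] by (simp add: mult_ac)
  also have "\<dots> = (\<Sum>k\<in>{1..J}. \<Sum>k'\<in>{1..J}. if odd (k + k' + l) then
      (eigval l * eigval l' - (eigval k - eigval k')\<^sup>2) / (h\<^sup>2 * (eigval k * eigval k')) *
      ((2 * real k + 1) * (2 * real k' + 1) * (wigner6j (2 * l) (2 * k) (2 * k') J J J)\<^sup>2) * (v \<bullet> u) else 0)"
  proof (intro sum.cong refl)
    fix k k'
    have p: "psign (int (l + k + k')) = (if odd (k + k' + l) then - 1 else 1)"
      by (simp add: psign_def) presburger
    have q: "a / (4 * b * c) * ((1 - - 1)\<^sup>2 * d * e) = a / (b * c) * d * e" for a b c d e :: real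
      by simp
    show "?W k k' * ((1 - psign (int (l + k + k')))\<^sup>2 *
        ((2 * real k + 1) * (2 * real k' + 1) * (wigner6j (2 * l) (2 * k) (2 * k') J J J)\<^sup>2) * (v \<bullet> u))
      = (if odd (k + k' + l) then
      (eigval l * eigval l' - (eigval k - eigval k')\<^sup>2) / (h\<^sup>2 * (eigval k * eigval k')) *
      ((2 * real k + 1) * (2 * real k' + 1) * (wigner6j (2 * l) (2 * k) (2 * k') J J J)\<^sup>2) * (v \<bullet> u) else 0)"
      unfolding p by (cases "odd (k + k' + l)") (simp_all only: if_True if_False q simp_thms, simp)
  qed
  finally show ?thesis .
qed

lemma ricci_coefficient:
  fixes a b c g w x y :: real
  assumes "a > 0" "b > 0" "c > 0"
  shows "a * g / d * (a / (b * c) * x * y * w - (b - c)\<^sup>2 / (b * c * a) * x * y * w)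
    = (a * a - (b - c)\<^sup>2) / (d * (b * c)) * (x * y * w) * g"
proof -
  have "a * (a / (b * c) * x * y * w - (b - c)\<^sup>2 / (b * c * a) * x * y * w)
    = (a * a - (b - c)\<^sup>2) / (b * c) * (x * y * w)"
    using assms by (simp add: divide_simps) (simp add: algebra_simps)
  then have "g / d * (a * (a / (b * c) * x * y * w - (b - c)\<^sup>2 / (b * c * a) * x * y * w))
    = g / d * ((a * a - (b - c)\<^sup>2) / (b * c) * (x * y * w))" by (rule arg_cong)
  then show ?thesis by (simp add: mult_ac)
qed

lemma odd_pairs_sum: "sum f (odd_pairs (J + 1) l) = (\<Sum>k\<in>{1..J}. \<Sum>k'\<in>{1..J}. if odd (k + k' + l) then f (k, k') else 0)"
proof -
  have "odd_pairs (J + 1) l = {x \<in> {1..J} \<times> {1..J}. odd (fst x + snd x + l)}"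
    by (auto simp: odd_pairs_def)
  then show ?thesis by (simp add: sum.inter_filter sum.cartesian_product case_prod_beta cong: if_cong)
qed

lemma Ric_eigenvalue:
  assumes u: "u \<in> V_space S l" and v: "v \<in> V_space S l'" and l: "l \<in> {1..J}" and l': "l' \<in> {1..J}"
  shows "Ric S u v = (r_plus (J + 1) l - r_minus (J + 1) l) * zeitlin_metric S u v"
    and "l \<noteq> l' \<Longrightarrow> Ric S u v = 0"
proof -
  have orth: "v \<bullet> u = 0" if "l \<noteq> l'"
    unfolding Re_mat_inner[symmetric] V_space_mat_inner[OF u v l] using that by simp
  show zero: "Ric S u v = 0" if "l \<noteq> l'"
    unfolding Ric_V_space[OF assms] orth[OF that] by (simp only: mult_zero_right if_cancel sum.neutral_const)
  have met: "zeitlin_metric S u v = eigval l * (v \<bullet> u) / real (J + 1)"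
    unfolding zeitlin_metric_sym V_spaceD(2)[OF u] card_n
    by (simp add: Re_mat_inner[symmetric] cscale_distrib) (simp add: Re_mat_inner inner_commute)
  show "Ric S u v = (r_plus (J + 1) l - r_minus (J + 1) l) * zeitlin_metric S u v"
  proof (cases "l = l'")
    case True
    have pos: "eigval l > 0" using l by (intro eigval_pos) auto
    have "(r_plus (J + 1) l - r_minus (J + 1) l) * zeitlin_metric S u v
      = (\<Sum>(k, k')\<in>odd_pairs (J + 1) l. eigval l * (v \<bullet> u) / h\<^sup>2 *
        (eigval l / (eigval k * eigval k') * (2 * real k + 1) * (2 * real k' + 1) *
          (wigner6j (2*l) (2*k) (2*k') J J J)\<^sup>2 -
         (eigval k - eigval k')\<^sup>2 / (eigval k * eigval k' * eigval l) * (2 * real k + 1) * (2 * real k' + 1) *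
          (wigner6j (2*l) (2*k) (2*k') J J J)\<^sup>2))"
    proof -
      have factor: "(N / h\<^sup>2 * P - N / h\<^sup>2 * M) * (eigval l * (v \<bullet> u) / N) = eigval l * (v \<bullet> u) / h\<^sup>2 * (P - M)"
        if "N \<noteq> 0" for N P M
        using that by (simp add: right_diff_distrib left_diff_distrib diff_divide_distrib mult_ac)
      have "(r_plus (J + 1) l - r_minus (J + 1) l) * zeitlin_metric S u v = eigval l * (v \<bullet> u) / h\<^sup>2 *
        ((\<Sum>(k, k')\<in>odd_pairs (J + 1) l. eigval l / (eigval k * eigval k') * (2 * real k + 1) * (2 * real k' + 1) *
           (wigner6j (2*l) (2*k) (2*k') (J + 1 - 1) (J + 1 - 1) (J + 1 - 1))\<^sup>2) -
         (\<Sum>(k, k')\<in>odd_pairs (J + 1) l. (eigval k - eigval k')\<^sup>2 / (eigval k * eigval k' * eigval l) *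
           (2 * real k + 1) * (2 * real k' + 1) *
           (wigner6j (2*l) (2*k) (2*k') (J + 1 - 1) (J + 1 - 1) (J + 1 - 1))\<^sup>2))"
        unfolding r_plus_def r_minus_def met h_def[symmetric] by (rule factor) simp
      then show ?thesis
        by (simp only: sum_subtractf[symmetric] sum_distrib_left case_prod_unfold add_diff_cancel_right')
    qed
    also have "\<dots> = Ric S u v"
      unfolding odd_pairs_sum Ric_V_space[OF assms]
    proof (intro sum.cong refl if_cong, simp only: prod.case)
      fix k k' assume "k \<in> {1..J}" "k' \<in> {1..J}"
      then have "eigval k > 0" "eigval k' > 0" by (auto intro!: eigval_pos)
      then show "eigval l * (v \<bullet> u) / h\<^sup>2 *
        (eigval l / (eigval k * eigval k') * (2 * real k + 1) * (2 * real k' + 1) *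
          (wigner6j (2*l) (2*k) (2*k') J J J)\<^sup>2 -
         (eigval k - eigval k')\<^sup>2 / (eigval k * eigval k' * eigval l) * (2 * real k + 1) * (2 * real k' + 1) *
          (wigner6j (2*l) (2*k) (2*k') J J J)\<^sup>2)
        = (eigval l * eigval l' - (eigval k - eigval k')\<^sup>2) / (h\<^sup>2 * (eigval k * eigval k')) *
      ((2 * real k + 1) * (2 * real k' + 1) * (wigner6j (2 * l) (2 * k) (2 * k') J J J)\<^sup>2) * (v \<bullet> u)"
        unfolding True[symmetric] using pos by (intro ricci_coefficient)
    qed
    finally show ?thesis ..
  next
    case False
    then show ?thesis using orth zero by (simp add: met)
  qed
qed

end

lemma r_plus_nonneg: "l \<ge> 1 \<Longrightarrow> r_plus N l \<ge> 0"
  unfolding r_plus_def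
  by (intro mult_nonneg_nonneg sum_nonneg) (auto simp: eigval_def)

lemma r_minus_nonneg: "l \<ge> 1 \<Longrightarrow> r_minus N l \<ge> 0"
  unfolding r_minus_def
  by (intro mult_nonneg_nonneg sum_nonneg) (auto simp: eigval_def)

theorem theorem1:
  fixes S :: "3 \<Rightarrow> complex^'n^'n"
  assumes "CARD('n) \<ge> 2"
    and "so3_irrep S"
  shows "(\<forall>l\<in>{1..CARD('n)-1}. \<forall>l'\<in>{1..CARD('n)-1}. \<forall>u\<in>V_space S l. \<forall>v\<in>V_space S l'.
            Ric S u v = (r_plus CARD('n) l - r_minus CARD('n) l) * zeitlin_metric S u v \<and>
            (l \<noteq> l' \<longrightarrow> Ric S u v = 0)) \<and>
         (\<forall>l\<in>{1..CARD('n)-1}. r_plus CARD('n) l \<ge> 0 \<and> r_minus CARD('n) l \<ge> 0)"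
proof -
  obtain e where "weight_basis S (CARD('n) - 1) e"
    using weight_basis_exists[OF assms(2)] .
  then interpret spin_representation S "CARD('n) - 1" e
    using assms by unfold_locales auto
  have N: "CARD('n) - 1 + 1 = CARD('n)" using assms(1) by simp
  show ?thesis
    using Ric_eigenvalue[unfolded N] by (auto intro: r_plus_nonneg r_minus_nonneg)
qed

end
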